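(* Let $\mathcal{D}=(G,\chi,a,\alpha)$ be a datum and let $\mathcal{H}=(H_{\mathcal{D}},\cdot,\mathbin{:})$ be a Hopf $q$-brace structure on $H_{\mathcal{D}}$ such that $x\cdot x\ne0$ and $x\mathbin{:}x\ne0$. Let $\lambda_{10}\in\mathds{k}^{\times}$ be the scalar such that $x\cdot x=\lambda_{10}(1-a)$. Then $\mathcal{H}$ is a Hopf skew-brace if and only if $G$ (with the $q$-brace structure obtained from $\mathcal{H}$ by restriction) is a skew-brace and $2\alpha(a^2-1)=\lambda_{10}(a^2-1)$.
   Context: $\mathds{k}$ is an algebraically closed field of characteristic zero. Sweedler notation is used. Multiplication has precedence over the binary operations $\cdot$ and $\mathbin{:}$, which have precedence over $+$ and $-$. Rank one pointed Hopf algebras. A datum $\mathcal{D}=(G,\chi,a,\alpha)$ consists of a finite group $G$, a character $\chi\colon G\to\mathds{k}^{\times}$, a central element $a\in G$ and $\alpha\in\mathds{k}$ such that, denoting by $n$ the order of $\chi(a)$, one has $n>1$ and ($\alpha(a^n-1)=0$ in $\mathds{k}[G]$ or $\chi^n=1$). $H_{\mathcal{D}}$ is the Hopf algebra generated as an algebra by $G$ and $x$, subject to the group relations of $G$, $x^n=\alpha(a^n-1)$ and $xg=\chi(g)gx$ for $g\in G$, with $\Delta(x)=x\otimes a+1\otimes x$, $\Delta(g)=g\otimes g$ (so $\epsilon(g)=1$, $\epsilon(x)=0$). It has $\mathds{k}$-basis $\{gx^m: g\in G,\ 0\le m<n\}$. Hopf $q$-braces. Let $X$ be a coalgebra and $p,d\colon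 X\otimes X\to X$ linear maps with $\epsilon\circ p=\epsilon\circ d=\epsilon\otimes\epsilon$; write $x\cdot y=p(x\otimes y)$, $x\mathbin{:}y=d(x\otimes y)$. $(X,\cdot,\mathbin{:})$ is a $q$-magma coalgebra if the map $X\otimes X^{\mathrm{cop}}\to X^{\mathrm{cop}}\otimes X$, $x\otimes y\mapsto y_{(1)}\mathbin{:}x_{(2)}\otimes x_{(1)}\cdot y_{(2)}$, is a coalgebra morphism; equivalently, $p,d\colon X\otimes X^{\mathrm{cop}}\to X$ are coalgebra maps and $v_{(1)}\mathbin{:}u_{(2)}\otimes u_{(1)}\cdot v_{(2)}=v_{(2)}\mathbin{:}u_{(1)}\otimes u_{(2)}\cdot v_{(1)}$ for all $u,v\in X$. It is left regular if $x\otimes y\mapsto x\cdot y_{(1)}\otimes y_{(2)}$ is bijective on $X\otimes X$, right regular if $x\otimes y\mapsto x\mathbin{:}y_{(2)}\otimes y_{(1)}$ is bijective, and regular if it is both. A $q$-cycle coalgebra is a left regular $q$-magma coalgebra such that for all $u,v,w$: $(u\cdot v_{(1)})\cdot(w\mathbin{:}v_{(2)})=(u\cdot w_{(2)})\cdot(v\cdot w_{(1)})$, $(u\cdot v_{(1)})\mathbin{:}(w\cdot v_{(2)})=(u\mathbin{:}w_{(2)})\cdot(v\mathbin{:}w_{(1)})$, $(u\mathbin{:}v_{(1)})\mathbin{:}(w\mathbin{:}v_{(2)})=(u\mathbin{:}w_{(2)})\mathbin{:}(v\cdot w_{(1)})$. A Hopf $q$-brace is a Hopf algebra $H$ with a regular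 $q$-cycle coalgebra structure $(H,\cdot,\mathbin{:})$ such that $(H,\cdot)$ and $(H,\mathbin{:})$ are right $H^{\mathrm{op}}$-modules (i.e. $h\cdot 1=h$, $h\cdot kl=(h\cdot l)\cdot k$, and likewise for $\mathbin{:}$) and, for all $h,k,l\in H$, $hk\cdot l=(h\cdot(l_{(1)}\mathbin{:}k_{(2)}))(k_{(1)}\cdot l_{(2)})$ and $hk\mathbin{:}l=(h\mathbin{:}(l_{(1)}\cdot k_{(2)}))(k_{(1)}\mathbin{:}l_{(2)})$. A Hopf skew-brace is a Hopf $q$-brace such that $(h\mathbin{:}l_{(2)})l_{(1)}=(l\cdot h_{(1)})h_{(2)}$ for all $h,l\in H$. A $q$-brace structure on a group $G$ is a pair of binary operations $\cdot,\mathbin{:}$ on the set $G$ whose linear extensions make $\mathds{k}[G]$ a Hopf $q$-brace; it is a skew-brace if $(l\mathbin{:}h)h=(h\cdot l)l$ for all $h,l\in G$. Known facts: for a Hopf $q$-brace on $H_{\mathcal{D}}$ with $x\cdot x\ne0$ and $x\mathbin{:}x\ne0$, one has $n=2$, $\chi^2=1$, the operations restrict to a $q$-brace structure on $G$ with $a\cdot g=a\mathbin{:}g=a$ and $g\cdot a=g\mathbin{:}a=g$, and there is $\lambda_{10}\in\mathds{k}^\times$ such that for all $h,g\in G$: $hx\cdot g=\chi(g)(h\cdot g)x$, $hx\mathbin{:}g=\chi(g)(h\mathbin{:}g)x$, $h\cdot gx=h\mathbin{:}gx=0$, $hx\cdot gx=\lambda_{10}(h\cdot g)(1-a)$, $hx\mathbin{:}gx=-\lambda_{10}(h\mathbin{:}g)(1-a)$.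 *)

theory Defs
  imports
    "HOL-Algebra.Multiplicative_Group"
    "HOL-Computational_Algebra.Polynomial"
    "HOL-Library.Poly_Mapping"
begin

section \<open>Vector spaces with a basis and their tensor products\<close>

text \<open>
  A vector space is given with a basis \<open>B :: 'b set\<close>: its elements are the finitely
  supported functions \<open>v :: 'b \<Rightarrow>\<^sub>0 'k\<close> with support in \<open>B\<close>.  The tensor product of
  the spaces on \<open>B\<close> and \<open>C\<close> is the space on \<open>B \<times> C\<close>.  Maps are total HOL functions of which
  only the values on the given space matter.
\<close>

type_synonym ('b, 'k) vect = "'b \<Rightarrow>\<^sub>0 'k"

definition fspace :: "'b set \<Rightarrow> ('b, 'k::field) vect set"
  where "fspace B = {v. Poly_Mapping.keys v \<subseteq> B}"

definition bv :: "'b \<Rightarrow> ('b, 'k::field) vect"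
  where "bv b = Poly_Mapping.single b 1"

definition scal :: "'k::field \<Rightarrow> ('b, 'k) vect \<Rightarrow> ('b, 'k) vect"  (infixr \<open>\<bullet>\<close> 75)
  where "c \<bullet> v = Poly_Mapping.map ((*) c) v"

definition lext :: "('b \<Rightarrow> ('c, 'k::field) vect) \<Rightarrow> ('b, 'k) vect \<Rightarrow> ('c, 'k) vect"
  where "lext f v = (\<Sum>b\<in>Poly_Mapping.keys v. Poly_Mapping.lookup v b \<bullet> f b)"

definition lext_form :: "('b \<Rightarrow> 'k::field) \<Rightarrow> ('b, 'k) vect \<Rightarrow> 'k"
  where "lext_form f v = (\<Sum>b\<in>Poly_Mapping.keys v. Poly_Mapping.lookup v b * f b)"

definition tensor :: "('b, 'k::field) vect \<Rightarrow> ('c, 'k) vect \<Rightarrow> ('b \<times> 'c, 'k) vect"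
    (infixr \<open>\<boxtimes>\<close> 72)
  where "v \<boxtimes> w = (\<Sum>b\<in>Poly_Mapping.keys v. \<Sum>c\<in>Poly_Mapping.keys w. Poly_Mapping.single (b, c) (Poly_Mapping.lookup v b * Poly_Mapping.lookup w c))"

text \<open>
  \<open>sweedler t F\<close> is the value at \<open>t\<close> of the linear map on the tensor square that is induced by the
  bilinear map \<open>F\<close>; in particular \<open>sweedler (\<Delta> h) (\<lambda>h\<^sub>1 h\<^sub>2. F h\<^sub>1 h\<^sub>2)\<close> is what Sweedler notation
  writes as \<open>F h\<^sub>(\<^sub>1\<^sub>) h\<^sub>(\<^sub>2\<^sub>)\<close>.
\<close>

definition sweedler ::
  "('b \<times> 'b, 'k::field) vect \<Rightarrow> (('b, 'k) vect \<Rightarrow> ('b, 'k) vect \<Rightarrow> ('c, 'k) vect) \<Rightarrow> ('c, 'k) vect"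
  where "sweedler t F = lext (\<lambda>(b, c). F (bv b) (bv c)) t"

definition map_tensor ::
  "(('b, 'k::field) vect \<Rightarrow> ('c, 'k) vect) \<Rightarrow> (('d, 'k) vect \<Rightarrow> ('e, 'k) vect) \<Rightarrow>
    ('b \<times> 'd, 'k) vect \<Rightarrow> ('c \<times> 'e, 'k) vect"
  where "map_tensor f g = lext (\<lambda>(b, d). f (bv b) \<boxtimes> g (bv d))"

lemma lookup_scal [simp]: "Poly_Mapping.lookup (c \<bullet> v) b = c * Poly_Mapping.lookup v b"
  unfolding scal_def by (simp add: map.rep_eq when_def)

lemma scal_simps [simp]:
  "c \<bullet> 0 = 0" "0 \<bullet> v = 0" "1 \<bullet> v = v" "c \<bullet> c' \<bullet> v = (c * c') \<bullet> v"
  by (rule poly_mapping_eqI; simp)+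

lemma scal_distribs:
  "c \<bullet> (u + v) = c \<bullet> u + c \<bullet> v" "(c + c') \<bullet> v = c \<bullet> v + c' \<bullet> v"
  "c \<bullet> (u - v) = c \<bullet> u - c \<bullet> v"
  by (rule poly_mapping_eqI; simp add: lookup_add lookup_minus algebra_simps)+

lemma scal_sum: "c \<bullet> (\<Sum>i\<in>A. f i) = (\<Sum>i\<in>A. c \<bullet> f i)"
  by (induction A rule: infinite_finite_induct) (simp_all add: scal_distribs)

lemma lext_superset:
  assumes "finite S" "Poly_Mapping.keys v \<subseteq> S"
  shows "lext f v = (\<Sum>b\<in>S. Poly_Mapping.lookup v b \<bullet> f b)"
  unfolding lext_def using assms by (intro sum.mono_neutral_left) (auto simp: in_keys_iff)

lemma lext_zero [simp]: "lext f 0 = 0"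
  by (simp add: lext_def)

lemma lext_bv [simp]: "lext f (bv b) = f b"
  by (simp add: lext_def bv_def)

lemma lext_add: "lext f (u + v) = lext f u + lext f v"
proof -
  let ?S = "Poly_Mapping.keys u \<union> Poly_Mapping.keys v"
  have "Poly_Mapping.keys (u + v) \<subseteq> ?S" by (rule keys_add)
  then show ?thesis
    by (simp add: lext_superset[of ?S] lookup_add scal_distribs sum.distrib)
qed

lemma lext_scal: "lext f (c \<bullet> v) = c \<bullet> lext f v"
proof -
  have "Poly_Mapping.keys (c \<bullet> v) \<subseteq> Poly_Mapping.keys v" by (auto simp: in_keys_iff)
  then show ?thesis
    by (simp add: lext_superset[of "Poly_Mapping.keys v"] scal_sum)
qed

lemma lext_diff: "lext f (u - v) = lext f u - lext f v"
  using lext_add[of f "u - v" v] by (simp add: algebra_simps)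

lemma fspace_iff: "v \<in> fspace B \<longleftrightarrow> (\<forall>b. b \<notin> B \<longrightarrow> Poly_Mapping.lookup v b = 0)"
  unfolding fspace_def by (auto simp: in_keys_iff)

lemma fspace_closed:
  "0 \<in> fspace B" "b \<in> B \<Longrightarrow> bv b \<in> fspace B"
  "u \<in> fspace B \<Longrightarrow> v \<in> fspace B \<Longrightarrow> u + v \<in> fspace B"
  "u \<in> fspace B \<Longrightarrow> v \<in> fspace B \<Longrightarrow> u - v \<in> fspace B"
  "v \<in> fspace B \<Longrightarrow> c \<bullet> v \<in> fspace B"
  by (auto simp: fspace_iff bv_def lookup_add lookup_minus lookup_single when_def)

lemma fspace_induct [consumes 1, case_names zero step]:
  assumes "v \<in> fspace B" and "P 0"
    and "\<And>c b v. b \<in> B \<Longrightarrow> v \<in> fspace B \<Longrightarrow> P v \<Longrightarrow> P (c \<bullet> bv b + v)"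
  shows "P v"
proof -
  have *: "finite S \<Longrightarrow> S \<subseteq> B \<Longrightarrow>
    P (\<Sum>b\<in>S. g b \<bullet> bv b) \<and> (\<Sum>b\<in>S. g b \<bullet> bv b) \<in> fspace B" for S g
    by (induction S rule: finite_induct) (auto simp: assms fspace_closed)
  have "v = (\<Sum>b\<in>Poly_Mapping.keys v. Poly_Mapping.lookup v b \<bullet> bv b)"
    by (rule poly_mapping_eqI)
      (simp add: lookup_sum bv_def lookup_single when_def in_keys_iff if_distrib cong: if_cong)
  moreover have "Poly_Mapping.keys v \<subseteq> B" using assms(1) by (simp add: fspace_def)
  ultimately show ?thesis using *[of "Poly_Mapping.keys v" "Poly_Mapping.lookup v"] by simp
qed

lemma lext_fspace: "v \<in> fspace B \<Longrightarrow> (\<And>b. b \<in> B \<Longrightarrow> f b \<in> fspace C) \<Longrightarrow> lext f v \<in> fspace C"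
  by (induction v rule: fspace_induct) (auto simp: lext_add lext_scal fspace_closed)

lemma lookup_tensor [simp]:
  "Poly_Mapping.lookup (u \<boxtimes> v) (b, c) = Poly_Mapping.lookup u b * Poly_Mapping.lookup v c"
proof -
  have "Poly_Mapping.lookup (u \<boxtimes> v) (b, c) =
    (\<Sum>b'\<in>Poly_Mapping.keys u. \<Sum>c'\<in>Poly_Mapping.keys v.
      if c' = c then (if b' = b then Poly_Mapping.lookup u b * Poly_Mapping.lookup v c else 0) else 0)"
    unfolding tensor_def by (auto simp: lookup_sum lookup_single when_def intro!: sum.cong)
  also have "\<dots> = (\<Sum>b'\<in>Poly_Mapping.keys u.
      if b' = b then Poly_Mapping.lookup u b * Poly_Mapping.lookup v c else 0)"
    by (intro sum.cong refl) (simp add: in_keys_iff)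
  also have "\<dots> = Poly_Mapping.lookup u b * Poly_Mapping.lookup v c"
    by (simp add: in_keys_iff)
  finally show ?thesis .
qed

lemma tensor_bilinear [simp]:
  "(u + u') \<boxtimes> v = u \<boxtimes> v + u' \<boxtimes> v" "u \<boxtimes> (v + v') = u \<boxtimes> v + u \<boxtimes> v'"
  "(u - u') \<boxtimes> v = u \<boxtimes> v - u' \<boxtimes> v" "u \<boxtimes> (v - v') = u \<boxtimes> v - u \<boxtimes> v'"
  "(c \<bullet> u) \<boxtimes> v = c \<bullet> (u \<boxtimes> v)" "u \<boxtimes> (c \<bullet> v) = c \<bullet> (u \<boxtimes> v)"
  "0 \<boxtimes> v = 0" "u \<boxtimes> 0 = 0"
  by (rule poly_mapping_eqI, clarsimp simp: lookup_add lookup_minus algebra_simps)+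

lemma tensor_bv [simp]: "bv b \<boxtimes> bv c = bv (b, c)"
  by (rule poly_mapping_eqI) (auto simp: bv_def lookup_single when_def split: if_splits)

lemma tensor_fspace: "u \<in> fspace B \<Longrightarrow> v \<in> fspace C \<Longrightarrow> u \<boxtimes> v \<in> fspace (B \<times> C)"
  unfolding fspace_iff by auto

definition linear_map :: "'b set \<Rightarrow> 'c set \<Rightarrow> (('b, 'k::field) vect \<Rightarrow> ('c, 'k) vect) \<Rightarrow> bool"
  where "linear_map B C f \<longleftrightarrow>
    f \<in> fspace B \<rightarrow> fspace C \<and>
    (\<forall>u\<in>fspace B. \<forall>v\<in>fspace B. f (u + v) = f u + f v) \<and>
    (\<forall>c. \<forall>v\<in>fspace B. f (c \<bullet> v) = c \<bullet> f v)"

definition linear_form :: "'b set \<Rightarrow> (('b, 'k::field) vect \<Rightarrow> 'k) \<Rightarrow> bool"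
  where "linear_form B f \<longleftrightarrow>
    (\<forall>u\<in>fspace B. \<forall>v\<in>fspace B. f (u + v) = f u + f v) \<and>
    (\<forall>c. \<forall>v\<in>fspace B. f (c \<bullet> v) = c * f v)"


section \<open>Coalgebras and Hopf algebras\<close>

record (overloaded) ('b, 'k) coalg =
  cbasis :: "'b set"
  comul :: "('b, 'k::field) vect \<Rightarrow> ('b \<times> 'b, 'k) vect"
  counit :: "('b, 'k) vect \<Rightarrow> 'k"

abbreviation cspace :: "('b, 'k::field, 'z) coalg_scheme \<Rightarrow> ('b, 'k) vect set"
  where "cspace X \<equiv> fspace (cbasis X)"

definition coalgebra :: "('b, 'k::field, 'z) coalg_scheme \<Rightarrow> bool"
  where "coalgebra X \<longleftrightarrow>
    linear_map (cbasis X) (cbasis X \<times> cbasis X) (comul X) \<and>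
    linear_form (cbasis X) (counit X) \<and>
    (\<forall>v\<in>cspace X.
      lext (\<lambda>((b, c), d). bv (b, (c, d))) (map_tensor (comul X) id (comul X v)) =
        map_tensor id (comul X) (comul X v)) \<and>
    (\<forall>v\<in>cspace X. sweedler (comul X v) (\<lambda>v1 v2. counit X v1 \<bullet> v2) = v) \<and>
    (\<forall>v\<in>cspace X. sweedler (comul X v) (\<lambda>v1 v2. counit X v2 \<bullet> v1) = v)"

definition cop :: "('b, 'k::field, 'z) coalg_scheme \<Rightarrow> ('b, 'k) coalg"
  where "cop X = \<lparr>cbasis = cbasis X,
    comul = (\<lambda>v. sweedler (comul X v) (\<lambda>v1 v2. v2 \<boxtimes> v1)), counit = counit X\<rparr>"

definition tensor_coalg ::
  "('b, 'k::field, 'y) coalg_scheme \<Rightarrow> ('c, 'k, 'z) coalg_scheme \<Rightarrow> ('b \<times> 'c, 'k) coalg"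
  where "tensor_coalg X Y = \<lparr>cbasis = cbasis X \<times> cbasis Y,
    comul = lext (\<lambda>(b, c).
      sweedler (comul X (bv b)) (\<lambda>x1 x2.
        sweedler (comul Y (bv c)) (\<lambda>y1 y2. (x1 \<boxtimes> y1) \<boxtimes> (x2 \<boxtimes> y2)))),
    counit = lext_form (\<lambda>(b, c). counit X (bv b) * counit Y (bv c))\<rparr>"

definition coalg_morphism ::
  "('b, 'k::field, 'y) coalg_scheme \<Rightarrow> ('c, 'k, 'z) coalg_scheme \<Rightarrow>
    (('b, 'k) vect \<Rightarrow> ('c, 'k) vect) \<Rightarrow> bool"
  where "coalg_morphism X Y f \<longleftrightarrow>
    linear_map (cbasis X) (cbasis Y) f \<and>
    (\<forall>v\<in>cspace X. comul Y (f v) = map_tensor f f (comul X v)) \<and>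
    (\<forall>v\<in>cspace X. counit Y (f v) = counit X v)"

record (overloaded) ('b, 'k) hopf_alg = "('b, 'k::field) coalg" +
  hmul :: "('b, 'k) vect \<Rightarrow> ('b, 'k) vect \<Rightarrow> ('b, 'k) vect"
  hone :: "('b, 'k) vect"

definition algebra :: "'b set \<Rightarrow> (('b, 'k::field) vect \<Rightarrow> ('b, 'k) vect \<Rightarrow> ('b, 'k) vect) \<Rightarrow>
    ('b, 'k) vect \<Rightarrow> bool"
  where "algebra B m e \<longleftrightarrow>
    (\<forall>u\<in>fspace B. linear_map B B (\<lambda>v. m u v)) \<and>
    (\<forall>v\<in>fspace B. linear_map B B (\<lambda>u. m u v)) \<and>
    e \<in> fspace B \<and>
    (\<forall>u\<in>fspace B. \<forall>v\<in>fspace B. \<forall>w\<in>fspace B. m (m u v) w = m u (m v w)) \<and>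
    (\<forall>v\<in>fspace B. m e v = v \<and> m v e = v)"

definition bialgebra :: "('b, 'k::field, 'z) hopf_alg_scheme \<Rightarrow> bool"
  where "bialgebra H \<longleftrightarrow>
    coalgebra H \<and> algebra (cbasis H) (hmul H) (hone H) \<and>
    (\<forall>u\<in>cspace H. \<forall>v\<in>cspace H. comul H (hmul H u v) =
      sweedler (comul H u) (\<lambda>u1 u2. sweedler (comul H v) (\<lambda>v1 v2. hmul H u1 v1 \<boxtimes> hmul H u2 v2))) \<and>
    comul H (hone H) = hone H \<boxtimes> hone H \<and>
    (\<forall>u\<in>cspace H. \<forall>v\<in>cspace H. counit H (hmul H u v) = counit H u * counit H v) \<and>
    counit H (hone H) = 1"

definition hopf_algebra :: "('b, 'k::field, 'z) hopf_alg_scheme \<Rightarrow> bool"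
  where "hopf_algebra H \<longleftrightarrow>
    bialgebra H \<and>
    (\<exists>S. linear_map (cbasis H) (cbasis H) S \<and>
      (\<forall>h\<in>cspace H.
        sweedler (comul H h) (\<lambda>h1 h2. hmul H (S h1) h2) = counit H h \<bullet> hone H \<and>
        sweedler (comul H h) (\<lambda>h1 h2. hmul H h1 (S h2)) = counit H h \<bullet> hone H))"


section \<open>Hopf q-braces\<close>

text \<open>
  Throughout, \<open>p\<close> and \<open>d\<close> are maps on the tensor square, with \<open>x \<cdot> y = p (x \<boxtimes> y)\<close> and
  \<open>x : y = d (x \<boxtimes> y)\<close>.
\<close>

definition q_magma_coalgebra ::
  "('b, 'k::field, 'z) coalg_scheme \<Rightarrow> (('b \<times> 'b, 'k) vect \<Rightarrow> ('b, 'k) vect) \<Rightarrow>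
    (('b \<times> 'b, 'k) vect \<Rightarrow> ('b, 'k) vect) \<Rightarrow> bool"
  where "q_magma_coalgebra X p d \<longleftrightarrow>
    coalgebra X \<and>
    linear_map (cbasis X \<times> cbasis X) (cbasis X) p \<and>
    linear_map (cbasis X \<times> cbasis X) (cbasis X) d \<and>
    (\<forall>u\<in>cspace X. \<forall>v\<in>cspace X.
      counit X (p (u \<boxtimes> v)) = counit X u * counit X v \<and>
      counit X (d (u \<boxtimes> v)) = counit X u * counit X v) \<and>
    coalg_morphism (tensor_coalg X (cop X)) (tensor_coalg (cop X) X)
      (lext (\<lambda>(b, c).
        sweedler (comul X (bv b)) (\<lambda>x1 x2. sweedler (comul X (bv c)) (\<lambda>y1 y2.
          d (y1 \<boxtimes> x2) \<boxtimes> p (x1 \<boxtimes> y2)))))"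

definition left_regular ::
  "('b, 'k::field, 'z) coalg_scheme \<Rightarrow> (('b \<times> 'b, 'k) vect \<Rightarrow> ('b, 'k) vect) \<Rightarrow> bool"
  where "left_regular X p \<longleftrightarrow>
    bij_betw (lext (\<lambda>(b, c). sweedler (comul X (bv c)) (\<lambda>y1 y2. p (bv b \<boxtimes> y1) \<boxtimes> y2)))
      (fspace (cbasis X \<times> cbasis X)) (fspace (cbasis X \<times> cbasis X))"

definition right_regular ::
  "('b, 'k::field, 'z) coalg_scheme \<Rightarrow> (('b \<times> 'b, 'k) vect \<Rightarrow> ('b, 'k) vect) \<Rightarrow> bool"
  where "right_regular X d \<longleftrightarrow>
    bij_betw (lext (\<lambda>(b, c). sweedler (comul X (bv c)) (\<lambda>y1 y2. d (bv b \<boxtimes> y2) \<boxtimes> y1)))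
      (fspace (cbasis X \<times> cbasis X)) (fspace (cbasis X \<times> cbasis X))"

definition q_cycle_coalgebra ::
  "('b, 'k::field, 'z) coalg_scheme \<Rightarrow> (('b \<times> 'b, 'k) vect \<Rightarrow> ('b, 'k) vect) \<Rightarrow>
    (('b \<times> 'b, 'k) vect \<Rightarrow> ('b, 'k) vect) \<Rightarrow> bool"
  where "q_cycle_coalgebra X p d \<longleftrightarrow>
    q_magma_coalgebra X p d \<and> left_regular X p \<and>
    (\<forall>u\<in>cspace X. \<forall>v\<in>cspace X. \<forall>w\<in>cspace X.
      sweedler (comul X v) (\<lambda>v1 v2. p (p (u \<boxtimes> v1) \<boxtimes> d (w \<boxtimes> v2))) =
        sweedler (comul X w) (\<lambda>w1 w2. p (p (u \<boxtimes> w2) \<boxtimes> p (v \<boxtimes> w1))) \<and>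
      sweedler (comul X v) (\<lambda>v1 v2. d (p (u \<boxtimes> v1) \<boxtimes> p (w \<boxtimes> v2))) =
        sweedler (comul X w) (\<lambda>w1 w2. p (d (u \<boxtimes> w2) \<boxtimes> d (v \<boxtimes> w1))) \<and>
      sweedler (comul X v) (\<lambda>v1 v2. d (d (u \<boxtimes> v1) \<boxtimes> d (w \<boxtimes> v2))) =
        sweedler (comul X w) (\<lambda>w1 w2. d (d (u \<boxtimes> w2) \<boxtimes> p (v \<boxtimes> w1))))"

definition right_op_module ::
  "('b, 'k::field, 'z) hopf_alg_scheme \<Rightarrow> (('b \<times> 'b, 'k) vect \<Rightarrow> ('b, 'k) vect) \<Rightarrow> bool"
  where "right_op_module H p \<longleftrightarrow>
    linear_map (cbasis H \<times> cbasis H) (cbasis H) p \<and>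
    (\<forall>h\<in>cspace H. p (h \<boxtimes> hone H) = h) \<and>
    (\<forall>h\<in>cspace H. \<forall>k\<in>cspace H. \<forall>l\<in>cspace H.
      p (h \<boxtimes> hmul H k l) = p (p (h \<boxtimes> l) \<boxtimes> k))"

definition hopf_q_brace ::
  "('b, 'k::field, 'z) hopf_alg_scheme \<Rightarrow> (('b \<times> 'b, 'k) vect \<Rightarrow> ('b, 'k) vect) \<Rightarrow>
    (('b \<times> 'b, 'k) vect \<Rightarrow> ('b, 'k) vect) \<Rightarrow> bool"
  where "hopf_q_brace H p d \<longleftrightarrow>
    hopf_algebra H \<and> q_cycle_coalgebra H p d \<and> right_regular H d \<and>
    right_op_module H p \<and> right_op_module H d \<and>
    (\<forall>h\<in>cspace H. \<forall>k\<in>cspace H. \<forall>l\<in>cspace H.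
      p (hmul H h k \<boxtimes> l) =
        sweedler (comul H k) (\<lambda>k1 k2. sweedler (comul H l) (\<lambda>l1 l2.
          hmul H (p (h \<boxtimes> d (l1 \<boxtimes> k2))) (p (k1 \<boxtimes> l2)))) \<and>
      d (hmul H h k \<boxtimes> l) =
        sweedler (comul H k) (\<lambda>k1 k2. sweedler (comul H l) (\<lambda>l1 l2.
          hmul H (d (h \<boxtimes> p (l1 \<boxtimes> k2))) (d (k1 \<boxtimes> l2)))))"

definition hopf_skew_brace ::
  "('b, 'k::field, 'z) hopf_alg_scheme \<Rightarrow> (('b \<times> 'b, 'k) vect \<Rightarrow> ('b, 'k) vect) \<Rightarrow>
    (('b \<times> 'b, 'k) vect \<Rightarrow> ('b, 'k) vect) \<Rightarrow> bool"
  where "hopf_skew_brace H p d \<longleftrightarrow>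
    hopf_q_brace H p d \<and>
    (\<forall>h\<in>cspace H. \<forall>l\<in>cspace H.
      sweedler (comul H l) (\<lambda>l1 l2. hmul H (d (h \<boxtimes> l2)) l1) =
        sweedler (comul H h) (\<lambda>h1 h2. hmul H (p (l \<boxtimes> h1)) h2))"


section \<open>Group algebras, q-braces and skew-braces on groups\<close>

definition group_hopf :: "('g, 'm) monoid_scheme \<Rightarrow> ('g, 'k::field) hopf_alg"
  where "group_hopf G = \<lparr>cbasis = carrier G,
    comul = lext (\<lambda>g. bv g \<boxtimes> bv g),
    counit = lext_form (\<lambda>g. 1),
    hmul = (\<lambda>u v. lext (\<lambda>(g, h). bv (g \<otimes>\<^bsub>G\<^esub> h)) (u \<boxtimes> v)),
    hone = bv \<one>\<^bsub>G\<^esub>\<rparr>"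

text \<open>The type argument fixes the ground field of the group algebra.\<close>

definition q_brace_group ::
  "'k::field itself \<Rightarrow> ('g, 'm) monoid_scheme \<Rightarrow> ('g \<Rightarrow> 'g \<Rightarrow> 'g) \<Rightarrow> ('g \<Rightarrow> 'g \<Rightarrow> 'g) \<Rightarrow> bool"
  where "q_brace_group K G dt cl \<longleftrightarrow>
    (\<forall>g\<in>carrier G. \<forall>h\<in>carrier G. dt g h \<in> carrier G \<and> cl g h \<in> carrier G) \<and>
    hopf_q_brace (group_hopf G :: ('g, 'k) hopf_alg)
      (lext (\<lambda>(g, h). bv (dt g h))) (lext (\<lambda>(g, h). bv (cl g h)))"

definition skew_brace_group ::
  "'k::field itself \<Rightarrow> ('g, 'm) monoid_scheme \<Rightarrow> ('g \<Rightarrow> 'g \<Rightarrow> 'g) \<Rightarrow> ('g \<Rightarrow> 'g \<Rightarrow> 'g) \<Rightarrow> bool"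
  where "skew_brace_group K G dt cl \<longleftrightarrow>
    q_brace_group K G dt cl \<and>
    (\<forall>h\<in>carrier G. \<forall>l\<in>carrier G. cl l h \<otimes>\<^bsub>G\<^esub> h = dt h l \<otimes>\<^bsub>G\<^esub> l)"


section \<open>Rank one pointed Hopf algebras\<close>

definition unit_group :: "'k::field monoid"
  where "unit_group = \<lparr>carrier = {c. c \<noteq> 0}, monoid.mult = (*), one = 1\<rparr>"

definition datum :: "('g, 'm) monoid_scheme \<Rightarrow> ('g \<Rightarrow> 'k::field) \<Rightarrow> 'g \<Rightarrow> 'k \<Rightarrow> bool"
  where "datum G \<chi> a \<alpha> \<longleftrightarrow>
    group G \<and> finite (carrier G) \<and> \<chi> \<in> hom G unit_group \<and>
    a \<in> carrier G \<and> (\<forall>g\<in>carrier G. a \<otimes>\<^bsub>G\<^esub> g = g \<otimes>\<^bsub>G\<^esub> a) \<and>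
    (let n = group.ord unit_group (\<chi> a) in
      1 < n \<and>
      (\<alpha> \<bullet> (bv (a [^]\<^bsub>G\<^esub> n) - bv \<one>\<^bsub>G\<^esub>) = (0 :: ('g, 'k) vect) \<or>
       (\<forall>g\<in>carrier G. \<chi> g ^ n = 1)))"

text \<open>
  The basis element \<open>(g, m)\<close> stands for \<open>g x\<^sup>m\<close>, so the basis is \<open>carrier G \<times> {..<n}\<close>.
  The product of \<open>g x\<^sup>i\<close> and \<open>h x\<^sup>j\<close> is \<open>\<chi>(h)\<^sup>i gh x\<^sup>i\<^sup>+\<^sup>j\<close>, reduced by
  \<open>x\<^sup>n = \<alpha>(a\<^sup>n - 1)\<close> if \<open>i + j \<ge> n\<close>.
  The theorems \<open>rank_one_algebra\<close>, \<open>rank_one_relations\<close> and \<open>rank_one_universal\<close> below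
  show that this is the algebra presented by \<open>G\<close>, \<open>x\<close> and the relations of \<open>G\<close>,
  \<open>x\<^sup>n = \<alpha>(a\<^sup>n - 1)\<close>, \<open>x g = \<chi>(g) g x\<close>.
\<close>

definition rank_one_mul ::
  "('g, 'm) monoid_scheme \<Rightarrow> ('g \<Rightarrow> 'k::field) \<Rightarrow> 'g \<Rightarrow> 'k \<Rightarrow> nat \<Rightarrow>
    ('g \<times> nat, 'k) vect \<Rightarrow> ('g \<times> nat, 'k) vect \<Rightarrow> ('g \<times> nat, 'k) vect"
  where "rank_one_mul G \<chi> a \<alpha> n u v =
    lext (\<lambda>((g, i), (h, j)).
      \<chi> h ^ i \<bullet>
        (if i + j < n then bv (g \<otimes>\<^bsub>G\<^esub> h, i + j)
         else \<alpha> \<bullet> (bv (g \<otimes>\<^bsub>G\<^esub> h \<otimes>\<^bsub>G\<^esub> a [^]\<^bsub>G\<^esub> n, i + j - n) -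
                  bv (g \<otimes>\<^bsub>G\<^esub> h, i + j - n)))) (u \<boxtimes> v)"

definition grp :: "'g \<Rightarrow> ('g \<times> nat, 'k::field) vect"
  where "grp g = bv (g, 0)"

definition gen_x :: "('g, 'm) monoid_scheme \<Rightarrow> ('g \<times> nat, 'k::field) vect"
  where "gen_x G = bv (\<one>\<^bsub>G\<^esub>, 1)"

lemma rank_one_mul_bilinear:
  "rank_one_mul G \<chi> a \<alpha> n (u + u') v = rank_one_mul G \<chi> a \<alpha> n u v + rank_one_mul G \<chi> a \<alpha> n u' v"
  "rank_one_mul G \<chi> a \<alpha> n u (v + v') = rank_one_mul G \<chi> a \<alpha> n u v + rank_one_mul G \<chi> a \<alpha> n u v'"
  "rank_one_mul G \<chi> a \<alpha> n (u - u') v = rank_one_mul G \<chi> a \<alpha> n u v - rank_one_mul G \<chi> a \<alpha> n u' v"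
  "rank_one_mul G \<chi> a \<alpha> n u (v - v') = rank_one_mul G \<chi> a \<alpha> n u v - rank_one_mul G \<chi> a \<alpha> n u v'"
  "rank_one_mul G \<chi> a \<alpha> n (c \<bullet> u) v = c \<bullet> rank_one_mul G \<chi> a \<alpha> n u v"
  "rank_one_mul G \<chi> a \<alpha> n u (c \<bullet> v) = c \<bullet> rank_one_mul G \<chi> a \<alpha> n u v"
  "rank_one_mul G \<chi> a \<alpha> n 0 v = 0" "rank_one_mul G \<chi> a \<alpha> n u 0 = 0"
  by (simp_all add: rank_one_mul_def lext_add lext_diff lext_scal)

lemma group_unit_group: "group (unit_group :: 'k::field monoid)"
proof (rule groupI)
  fix c :: 'k assume "c \<in> carrier unit_group"
  then show "\<exists>d\<in>carrier unit_group. d \<otimes>\<^bsub>unit_group\<^esub> c = \<one>\<^bsub>unit_group\<^esub>"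
    by (intro bexI[of _ "inverse c"]) (auto simp: unit_group_def)
qed (auto simp: unit_group_def)

lemma unit_group_pow: "x [^]\<^bsub>unit_group\<^esub> (k::nat) = (x :: 'k::field) ^ k"
  by (induction k) (simp_all add: unit_group_def nat_pow_def)

locale rank_one_datum =
  fixes G :: "('g, 'm) monoid_scheme" (structure) and \<chi> :: "'g \<Rightarrow> 'k::field" and a :: 'g
    and \<alpha> :: 'k and n :: nat
  assumes dat: "datum G \<chi> a \<alpha>" and n_def: "n = group.ord unit_group (\<chi> a)"
begin

sublocale group G
  using dat by (simp add: datum_def)

abbreviation mlt (infixl \<open>\<star>\<close> 70) where "u \<star> v \<equiv> rank_one_mul G \<chi> a \<alpha> n u v"

lemma chi_mult: "g \<in> carrier G \<Longrightarrow> h \<in> carrier G \<Longrightarrow> \<chi> (g \<otimes> h) = \<chi> g * \<chi> h"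
  and chi_nonzero: "g \<in> carrier G \<Longrightarrow> \<chi> g \<noteq> 0"
  using dat by (auto simp: datum_def hom_def unit_group_def Pi_def)

lemma a_closed [simp]: "a \<in> carrier G"
  and a_central: "g \<in> carrier G \<Longrightarrow> a \<otimes> g = g \<otimes> a"
  and n_gt: "1 < n"
  using dat by (auto simp: datum_def Let_def n_def)

lemma chi_one: "\<chi> \<one> = 1"
  using chi_mult[of \<one> \<one>] chi_nonzero[of \<one>] by simp

lemma chi_pow: "g \<in> carrier G \<Longrightarrow> \<chi> (g [^] (k::nat)) = \<chi> g ^ k"
  by (induction k) (simp_all add: chi_one chi_mult)

lemma chi_a_pow_n: "\<chi> a ^ n = 1"
proof -
  have "\<chi> a \<in> carrier unit_group" using chi_nonzero by (simp add: unit_group_def)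
  from group.pow_ord_eq_1[OF group_unit_group this] show ?thesis
    unfolding n_def[symmetric] unit_group_pow by (simp add: unit_group_def)
qed

lemma a_pow_central: "g \<in> carrier G \<Longrightarrow> a [^] (k::nat) \<otimes> g = g \<otimes> a [^] k"
proof (induction k)
  case (Suc k)
  have "a [^] Suc k \<otimes> g = a [^] k \<otimes> (a \<otimes> g)" using Suc.prems by (simp add: m_assoc)
  also have "\<dots> = a [^] k \<otimes> g \<otimes> a" using Suc.prems by (simp add: a_central m_assoc)
  also have "\<dots> = g \<otimes> a [^] Suc k" using Suc by (simp add: m_assoc)
  finally show ?case .
qed simp

lemma datum_cases:
  obtains "\<alpha> = 0" | "a [^] n = \<one>" | "\<And>g. g \<in> carrier G \<Longrightarrow> \<chi> g ^ n = 1"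
proof -
  have "a [^] n = \<one>" if "\<alpha> \<bullet> (bv (a [^] n) - bv \<one>) = (0 :: ('g, 'k) vect)" "\<alpha> \<noteq> 0"
  proof (rule ccontr)
    assume "a [^] n \<noteq> \<one>"
    then have "Poly_Mapping.lookup (\<alpha> \<bullet> (bv (a [^] n) - bv \<one>) :: ('g, 'k) vect) (a [^] n) = \<alpha>"
      by (simp add: lookup_minus bv_def lookup_single when_def)
    with that show False by simp
  qed
  with dat that show ?thesis by (auto simp: datum_def Let_def n_def)
qed

text \<open>The normal form of \<open>g x\<^sup>m\<close> for arbitrary \<open>m\<close>.\<close>

function nf :: "'g \<Rightarrow> nat \<Rightarrow> ('g \<times> nat, 'k) vect"
  where "nf g m = (if 0 < n \<and> n \<le> m then \<alpha> \<bullet> (nf (g \<otimes> a [^] n) (m - n) - nf g (m - n)) else bv (g, m))"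
  by auto
termination by (relation "Wellfounded.measure snd") auto

declare nf.simps [simp del]

lemma nf_lt: "m < n \<Longrightarrow> nf g m = bv (g, m)"
  and nf_ge: "n \<le> m \<Longrightarrow> nf g m = \<alpha> \<bullet> (nf (g \<otimes> a [^] n) (m - n) - nf g (m - n))"
  using n_gt by (simp_all add: nf.simps[of g m])

lemma nf_fspace: "g \<in> carrier G \<Longrightarrow> nf g m \<in> fspace (carrier G \<times> {..<n})"
proof (induction m arbitrary: g rule: less_induct)
  case (less m)
  show ?case
  proof (cases "n \<le> m")
    case True
    then have "m - n < m" using n_gt by simp
    with less True show ?thesis by (simp add: nf_ge fspace_closed)
  next
    case False
    with less show ?thesis by (simp add: nf_lt fspace_closed)
  qed
qed

lemma mult_bv:
  assumes "i < n" "j < n"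
  shows "bv (g, i) \<star> bv (h, j) = \<chi> h ^ i \<bullet> nf (g \<otimes> h) (i + j)"
proof (cases "n \<le> i + j")
  case True
  then have "i + j - n < n" using assms by simp
  with True show ?thesis by (simp add: rank_one_mul_def nf_ge[of "i + j"] nf_lt[of "i + j - n"])
next
  case False
  then show ?thesis by (simp add: rank_one_mul_def nf_lt)
qed

lemma mult_nf_bv:
  assumes "h \<in> carrier G" "j < n"
  shows "g \<in> carrier G \<Longrightarrow> nf g i \<star> bv (h, j) = \<chi> h ^ i \<bullet> nf (g \<otimes> h) (i + j)"
proof (induction i arbitrary: g rule: less_induct)
  case (less i)
  show ?case
  proof (cases "n \<le> i")
    case True
    then have lt: "i - n < i" using n_gt by simp
    have G: "g \<otimes> a [^] n \<otimes> h = g \<otimes> h \<otimes> a [^] n"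
      using less.prems assms by (simp add: m_assoc a_pow_central)
    have e: "i - n + j = i + j - n" using True by simp
    have "nf g i \<star> bv (h, j) =
        \<alpha> \<bullet> (\<chi> h ^ (i - n) \<bullet> nf (g \<otimes> h \<otimes> a [^] n) (i + j - n) -
             \<chi> h ^ (i - n) \<bullet> nf (g \<otimes> h) (i + j - n))"
      using less True lt assms by (simp add: nf_ge[of i] rank_one_mul_bilinear G e)
    also have "\<dots> = (\<alpha> * \<chi> h ^ (i - n)) \<bullet>
        (nf (g \<otimes> h \<otimes> a [^] n) (i + j - n) - nf (g \<otimes> h) (i + j - n))"
      by (simp add: scal_distribs)
    also have "\<dots> = (\<chi> h ^ i * \<alpha>) \<bullet>
        (nf (g \<otimes> h \<otimes> a [^] n) (i + j - n) - nf (g \<otimes> h) (i + j - n))"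
    proof (cases rule: datum_cases)
      case 2
      then show ?thesis using less.prems assms by simp
    next
      case 3
      have "\<chi> h ^ i = \<chi> h ^ (i - n) * \<chi> h ^ n" using True by (simp flip: power_add)
      then show ?thesis using 3 assms by (simp add: mult.commute)
    qed simp
    also have "\<dots> = \<chi> h ^ i \<bullet> nf (g \<otimes> h) (i + j)" using True by (simp add: nf_ge)
    finally show ?thesis .
  next
    case False
    then show ?thesis using assms by (simp add: nf_lt[of i] mult_bv)
  qed
qed

lemma mult_bv_nf:
  assumes "g \<in> carrier G" "i < n"
  shows "h \<in> carrier G \<Longrightarrow> bv (g, i) \<star> nf h j = \<chi> h ^ i \<bullet> nf (g \<otimes> h) (i + j)"
proof (induction j arbitrary: h rule: less_induct)
  case (less j)
  show ?case
  proof (cases "n \<le> j")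
    case True
    then have lt: "j - n < j" using n_gt by simp
    have X: "\<chi> (h \<otimes> a [^] n) = \<chi> h"
      using less.prems by (simp add: chi_mult chi_pow chi_a_pow_n)
    have e: "i + (j - n) = i + j - n" using True by simp
    have "bv (g, i) \<star> nf h j =
        \<alpha> \<bullet> (\<chi> h ^ i \<bullet> nf (g \<otimes> (h \<otimes> a [^] n)) (i + j - n) - \<chi> h ^ i \<bullet> nf (g \<otimes> h) (i + j - n))"
      using less True lt by (simp add: nf_ge[of j] rank_one_mul_bilinear X e)
    also have "\<dots> = \<chi> h ^ i \<bullet> nf (g \<otimes> h) (i + j)"
      using True less.prems assms
      by (simp add: nf_ge[of "i + j"] scal_distribs m_assoc mult.commute)
    finally show ?thesis .
  next
    case False
    then show ?thesis using assms by (simp add: nf_lt[of j] mult_bv)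
  qed
qed

lemma mult_fspace:
  assumes "u \<in> fspace (carrier G \<times> {..<n})" "v \<in> fspace (carrier G \<times> {..<n})"
  shows "u \<star> v \<in> fspace (carrier G \<times> {..<n})"
  using assms(1)
proof (induction u rule: fspace_induct)
  case (step c b u)
  obtain g i where b: "b = (g, i)" by (cases b)
  have "bv b \<star> v \<in> fspace (carrier G \<times> {..<n})"
    using assms(2)
  proof (induction v rule: fspace_induct)
    case (step c' b' v)
    then show ?case using \<open>b \<in> _\<close> b
      by (cases b') (auto simp: rank_one_mul_bilinear mult_bv fspace_closed nf_fspace)
  qed (simp add: rank_one_mul_bilinear fspace_closed)
  with step show ?case by (simp add: rank_one_mul_bilinear fspace_closed)
qed (simp add: rank_one_mul_bilinear fspace_closed)

lemma mult_assoc_bv: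
  assumes "b \<in> carrier G \<times> {..<n}" "c \<in> carrier G \<times> {..<n}" "d \<in> carrier G \<times> {..<n}"
  shows "bv b \<star> bv c \<star> bv d = bv b \<star> (bv c \<star> bv d)"
proof -
  obtain g i h j l k where bcd: "b = (g, i)" "c = (h, j)" "d = (l, k)"
    by (cases b, cases c, cases d)
  then have *: "g \<in> carrier G" "h \<in> carrier G" "l \<in> carrier G" "i < n" "j < n" "k < n"
    using assms by auto
  have "bv b \<star> bv c \<star> bv d = (\<chi> h ^ i * \<chi> l ^ (i + j)) \<bullet> nf (g \<otimes> h \<otimes> l) (i + j + k)"
    using * by (simp add: bcd mult_bv rank_one_mul_bilinear mult_nf_bv)
  moreover have "bv b \<star> (bv c \<star> bv d) = (\<chi> l ^ j * \<chi> (h \<otimes> l) ^ i) \<bullet> nf (g \<otimes> (h \<otimes> l)) (i + (j + k))"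
    using * by (simp add: bcd mult_bv rank_one_mul_bilinear mult_bv_nf)
  ultimately show ?thesis
    using * by (simp add: chi_mult m_assoc power_add power_mult_distrib mult_ac add_ac)
qed

lemma mult_assoc:
  assumes u: "u \<in> fspace (carrier G \<times> {..<n})" and v: "v \<in> fspace (carrier G \<times> {..<n})"
    and w: "w \<in> fspace (carrier G \<times> {..<n})"
  shows "u \<star> v \<star> w = u \<star> (v \<star> w)"
proof -
  have 1: "bv b \<star> bv c \<star> w = bv b \<star> (bv c \<star> w)"
    if "b \<in> carrier G \<times> {..<n}" "c \<in> carrier G \<times> {..<n}" for b c
    using w by (induction w rule: fspace_induct) (simp_all add: rank_one_mul_bilinear mult_assoc_bv that)
  have 2: "bv b \<star> v \<star> w = bv b \<star> (v \<star> w)" if "b \<in> carrier G \<times> {..<n}" for b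
    using v by (induction v rule: fspace_induct) (simp_all add: rank_one_mul_bilinear 1 that)
  show ?thesis
    using u by (induction u rule: fspace_induct) (simp_all add: rank_one_mul_bilinear 2)
qed

lemma mult_one:
  assumes "v \<in> fspace (carrier G \<times> {..<n})"
  shows "grp \<one> \<star> v = v" "v \<star> grp \<one> = v"
proof -
  have *: "grp \<one> \<star> bv b = bv b \<and> bv b \<star> grp \<one> = bv b" if "b \<in> carrier G \<times> {..<n}" for b
    using that n_gt by (cases b) (simp add: grp_def mult_bv nf_lt chi_one)
  have "grp \<one> \<star> v = v \<and> v \<star> grp \<one> = v"
    using assms by (induction v rule: fspace_induct) (simp_all add: rank_one_mul_bilinear *)
  then show "grp \<one> \<star> v = v" "v \<star> grp \<one> = v" by simp_all
qed

lemma grp_fspace: "g \<in> carrier G \<Longrightarrow> grp g \<in> fspace (carrier G \<times> {..<n})"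
  using n_gt by (simp add: grp_def fspace_closed)

theorem rank_one_algebra:
  "algebra (carrier G \<times> {..<n}) (rank_one_mul G \<chi> a \<alpha> n) (grp \<one>)"
  unfolding algebra_def linear_map_def
  by (auto simp: mult_fspace rank_one_mul_bilinear mult_assoc mult_one grp_fspace)

lemma pow_x: "((\<lambda>u. u \<star> gen_x G) ^^ m) (grp g) = nf g m" if "g \<in> carrier G"
proof (induction m)
  case 0
  then show ?case using n_gt by (simp add: grp_def nf_lt)
next
  case (Suc m)
  then show ?case using n_gt that by (simp add: gen_x_def mult_nf_bv chi_one)
qed

theorem rank_one_relations:
  "grp g \<star> grp h = grp (g \<otimes> h)"
  "((\<lambda>u. u \<star> gen_x G) ^^ n) (grp \<one>) = \<alpha> \<bullet> (grp (a [^] n) - grp \<one>)"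
  "g \<in> carrier G \<Longrightarrow> gen_x G \<star> grp g = \<chi> g \<bullet> (grp g \<star> gen_x G)"
  "g \<in> carrier G \<Longrightarrow> m < n \<Longrightarrow> bv (g, m) = ((\<lambda>u. u \<star> gen_x G) ^^ m) (grp g)"
proof -
  show "grp g \<star> grp h = grp (g \<otimes> h)"
    using n_gt by (simp add: grp_def mult_bv nf_lt)
  show "((\<lambda>u. u \<star> gen_x G) ^^ n) (grp \<one>) = \<alpha> \<bullet> (grp (a [^] n) - grp \<one>)"
    using n_gt unfolding pow_x[OF one_closed] by (simp add: nf_ge nf_lt grp_def)
  show "gen_x G \<star> grp g = \<chi> g \<bullet> (grp g \<star> gen_x G)" if "g \<in> carrier G"
    using n_gt that by (simp add: grp_def gen_x_def mult_bv nf_lt)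
  show "bv (g, m) = ((\<lambda>u. u \<star> gen_x G) ^^ m) (grp g)" if "g \<in> carrier G" "m < n"
    using that by (simp add: pow_x nf_lt)
qed

definition alg_hom :: "('k \<Rightarrow> 'r::ring_1) \<Rightarrow> (('g \<times> nat, 'k) vect \<Rightarrow> 'r) \<Rightarrow> bool"
  where "alg_hom s \<Phi> \<longleftrightarrow>
    (\<forall>u\<in>fspace (carrier G \<times> {..<n}). \<forall>v\<in>fspace (carrier G \<times> {..<n}).
      \<Phi> (u + v) = \<Phi> u + \<Phi> v \<and> \<Phi> (u \<star> v) = \<Phi> u * \<Phi> v) \<and>
    (\<forall>c. \<forall>v\<in>fspace (carrier G \<times> {..<n}). \<Phi> (c \<bullet> v) = s c * \<Phi> v) \<and>
    \<Phi> (grp \<one>) = 1"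

theorem rank_one_universal:
  fixes s :: "'k \<Rightarrow> 'r::ring_1" and f :: "'g \<Rightarrow> 'r" and y :: 'r
  assumes s: "\<And>c c'. s (c + c') = s c + s c'" "\<And>c c'. s (c * c') = s c * s c'" "s 1 = 1"
      "\<And>c r. s c * r = r * s c"
    and f: "\<And>g h. g \<in> carrier G \<Longrightarrow> h \<in> carrier G \<Longrightarrow> f (g \<otimes> h) = f g * f h" "f \<one> = 1"
    and y: "y ^ n = s \<alpha> * (f (a [^] n) - 1)"
      "\<And>g. g \<in> carrier G \<Longrightarrow> y * f g = s (\<chi> g) * (f g * y)"
  shows "\<exists>\<Phi>. alg_hom s \<Phi> \<and> (\<forall>g\<in>carrier G. \<Phi> (grp g) = f g) \<and> \<Phi> (gen_x G) = y \<and>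
    (\<forall>\<Psi>. alg_hom s \<Psi> \<and> (\<forall>g\<in>carrier G. \<Psi> (grp g) = f g) \<and> \<Psi> (gen_x G) = y \<longrightarrow>
      (\<forall>v\<in>fspace (carrier G \<times> {..<n}). \<Psi> v = \<Phi> v))"
proof -
  define \<Phi> where "\<Phi> v = (\<Sum>b\<in>Poly_Mapping.keys v. s (Poly_Mapping.lookup v b) * (f (fst b) * y ^ snd b))" for v
  have s0: "s 0 = 0" using s(1)[of 0 0] by simp
  have \<Phi>_sup: "\<Phi> v = (\<Sum>b\<in>S. s (Poly_Mapping.lookup v b) * (f (fst b) * y ^ snd b))"
    if "finite S" "Poly_Mapping.keys v \<subseteq> S" for v S
    unfolding \<Phi>_def using that by (intro sum.mono_neutral_left) (auto simp: in_keys_iff s0)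
  have \<Phi>_add: "\<Phi> (u + v) = \<Phi> u + \<Phi> v" for u v
    using keys_add[of u v]
    by (simp add: \<Phi>_sup[of "Poly_Mapping.keys u \<union> Poly_Mapping.keys v"] lookup_add s(1)
        algebra_simps sum.distrib)
  have \<Phi>_scal: "\<Phi> (c \<bullet> v) = s c * \<Phi> v" for c v
  proof -
    have "Poly_Mapping.keys (c \<bullet> v) \<subseteq> Poly_Mapping.keys v" by (auto simp: in_keys_iff)
    then show ?thesis
      by (simp add: \<Phi>_sup[of "Poly_Mapping.keys v"] s(2) mult.assoc sum_distrib_left)
  qed
  have \<Phi>_0: "\<Phi> 0 = 0" by (simp add: \<Phi>_def)
  have \<Phi>_diff: "\<Phi> (u - v) = \<Phi> u - \<Phi> v" for u v
    using \<Phi>_add[of "u - v" v] by (simp add: algebra_simps)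
  have \<Phi>_bv: "\<Phi> (bv (g, i)) = f g * y ^ i" for g i
    by (simp add: \<Phi>_def bv_def s(3))
  have \<Phi>_nf: "\<Phi> (nf g m) = f g * y ^ m" if "g \<in> carrier G" for g m
    using that
  proof (induction m arbitrary: g rule: less_induct)
    case (less m)
    show ?case
    proof (cases "n \<le> m")
      case True
      then have lt: "m - n < m" using n_gt by simp
      have "\<Phi> (nf g m) = s \<alpha> * (f g * (f (a [^] n) - 1) * y ^ (m - n))"
        using less True lt by (simp add: nf_ge[of m] \<Phi>_scal \<Phi>_diff f algebra_simps)
      also have "\<dots> = f g * (y ^ n * y ^ (m - n))"
        using s(4)[of \<alpha> "f g"] by (simp add: y(1) mult.assoc[symmetric])
      also have "y ^ n * y ^ (m - n) = y ^ m" using True by (simp flip: power_add)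
      finally show ?thesis .
    qed (simp add: nf_lt \<Phi>_bv)
  qed
  have yf: "y ^ i * f h = s (\<chi> h ^ i) * (f h * y ^ i)" if "h \<in> carrier G" for i h
  proof (induction i)
    case (Suc i)
    have "y ^ Suc i * f h = y * (y ^ i * f h)" by (simp add: mult.assoc)
    also have "\<dots> = s (\<chi> h ^ i) * (y * f h * y ^ i)"
      using s(4)[of "\<chi> h ^ i" y] by (simp add: Suc mult.assoc[symmetric])
    also have "\<dots> = s (\<chi> h ^ Suc i) * (f h * y ^ Suc i)"
      using that s(4)[of "\<chi> h ^ i" "s (\<chi> h)"] by (simp add: y s(2) mult.assoc[symmetric])
    finally show ?case .
  qed (simp add: s(3))
  have \<Phi>_mult_bv: "\<Phi> (bv b \<star> bv c) = \<Phi> (bv b) * \<Phi> (bv c)"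
    if "b \<in> carrier G \<times> {..<n}" "c \<in> carrier G \<times> {..<n}" for b c
  proof -
    obtain g i h j where bc: "b = (g, i)" "c = (h, j)" by (cases b, cases c)
    then have *: "g \<in> carrier G" "h \<in> carrier G" "i < n" "j < n" using that by auto
    have "\<Phi> (bv b) * \<Phi> (bv c) = f g * (y ^ i * f h) * y ^ j"
      by (simp add: bc \<Phi>_bv mult.assoc)
    also have "\<dots> = s (\<chi> h ^ i) * (f g * f h * y ^ (i + j))"
      using * s(4)[of "\<chi> h ^ i" "f g"] by (simp add: yf power_add mult.assoc[symmetric])
    also have "\<dots> = \<Phi> (bv b \<star> bv c)"
      using * by (simp add: bc mult_bv \<Phi>_scal \<Phi>_nf f)
    finally show ?thesis by simp
  qed
  have \<Phi>_mult: "\<Phi> (u \<star> v) = \<Phi> u * \<Phi> v"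
    if u: "u \<in> fspace (carrier G \<times> {..<n})" and v: "v \<in> fspace (carrier G \<times> {..<n})" for u v
  proof -
    have 1: "\<Phi> (bv b \<star> v) = \<Phi> (bv b) * \<Phi> v" if b: "b \<in> carrier G \<times> {..<n}" for b
      using v
    proof (induction v rule: fspace_induct)
      case (step c b' v)
      have "s c * (\<Phi> (bv b) * \<Phi> (bv b')) = \<Phi> (bv b) * (s c * \<Phi> (bv b'))"
        using s(4)[of c "\<Phi> (bv b)"] by (simp add: mult.assoc[symmetric])
      with step show ?case
        by (simp add: rank_one_mul_bilinear \<Phi>_add \<Phi>_scal \<Phi>_mult_bv[OF b] distrib_left)
    qed (simp add: rank_one_mul_bilinear \<Phi>_0)
    show ?thesis
      using u by (induction u rule: fspace_induct)
        (simp_all add: rank_one_mul_bilinear \<Phi>_0 \<Phi>_add \<Phi>_scal 1 distrib_right mult.assoc)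
  qed
  have hom: "alg_hom s \<Phi>"
    by (simp add: alg_hom_def \<Phi>_add \<Phi>_scal \<Phi>_mult grp_def \<Phi>_bv f)
  have uniq: "\<Psi> v = \<Phi> v"
    if \<Psi>: "alg_hom s \<Psi>" "\<And>g. g \<in> carrier G \<Longrightarrow> \<Psi> (grp g) = f g" "\<Psi> (gen_x G) = y"
      and v: "v \<in> fspace (carrier G \<times> {..<n})" for \<Psi> v
  proof -
    have x: "gen_x G \<in> fspace (carrier G \<times> {..<n})"
      using n_gt by (simp add: gen_x_def fspace_closed)
    have p: "\<Psi> (nf g m) = f g * y ^ m" if "g \<in> carrier G" for g m
    proof (induction m)
      case 0
      then show ?case using \<Psi>(2)[OF that] n_gt by (simp add: nf_lt grp_def)
    next
      case (Suc m)
      have "nf g (Suc m) = nf g m \<star> gen_x G"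
        using pow_x[OF that, of m] pow_x[OF that, of "Suc m"] by simp
      moreover have "\<Psi> (nf g m \<star> gen_x G) = \<Psi> (nf g m) * \<Psi> (gen_x G)"
        using \<Psi>(1) x nf_fspace[OF that] unfolding alg_hom_def by blast
      ultimately show ?case
        using Suc \<Psi>(3) by (simp only: power_Suc2 mult.assoc)
    qed
    have z: "\<Psi> 0 = 0"
    proof -
      have "\<Psi> (0 + 0) = \<Psi> 0 + \<Psi> 0" using \<Psi>(1) fspace_closed(1) unfolding alg_hom_def by blast
      then show ?thesis by simp
    qed
    show ?thesis
      using v
    proof (induction v rule: fspace_induct)
      case (step c b v)
      obtain g m where b: "b = (g, m)" "g \<in> carrier G" "m < n" using step by auto
      have bf: "bv b \<in> fspace (carrier G \<times> {..<n})" using step by (simp add: fspace_closed)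
      have "\<Psi> (bv b) = \<Phi> (bv b)" using p[OF b(2), of m] b by (simp add: nf_lt \<Phi>_bv)
      moreover have "\<Psi> (c \<bullet> bv b + v) = \<Psi> (c \<bullet> bv b) + \<Psi> v"
        using \<Psi>(1) step(2) fspace_closed(5)[OF bf, of c] unfolding alg_hom_def by blast
      moreover have "\<Psi> (c \<bullet> bv b) = s c * \<Psi> (bv b)"
        using \<Psi>(1) bf unfolding alg_hom_def by blast
      ultimately show ?case using step by (simp add: \<Phi>_add \<Phi>_scal)
    qed (simp add: z \<Phi>_0)
  qed
  have "\<Phi> (gen_x G) = y" "\<forall>g\<in>carrier G. \<Phi> (grp g) = f g"
    by (simp_all add: gen_x_def grp_def \<Phi>_bv f)
  with hom uniq show ?thesis by blast
qed

end


text \<open>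
  The comultiplication sends \<open>g x\<^sup>m\<close> to \<open>(g \<otimes> g) (x \<otimes> a + 1 \<otimes> x)\<^sup>m\<close>,
  computed in the tensor square of the algebra.
\<close>

definition rank_one_hopf ::
  "('g, 'm) monoid_scheme \<Rightarrow> ('g \<Rightarrow> 'k::field) \<Rightarrow> 'g \<Rightarrow> 'k \<Rightarrow> ('g \<times> nat, 'k) hopf_alg"
  where "rank_one_hopf G \<chi> a \<alpha> =
    (let n = group.ord unit_group (\<chi> a);
         m = rank_one_mul G \<chi> a \<alpha> n;
         \<Delta>x = gen_x G \<boxtimes> grp a + grp \<one>\<^bsub>G\<^esub> \<boxtimes> gen_x G;
         mul2 = (\<lambda>s t. sweedler s (\<lambda>s1 s2. sweedler t (\<lambda>t1 t2. m s1 t1 \<boxtimes> m s2 t2)))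
     in \<lparr>cbasis = carrier G \<times> {..<n},
         comul = lext (\<lambda>(g, i). ((\<lambda>t. mul2 t \<Delta>x) ^^ i) (grp g \<boxtimes> grp g)),
         counit = lext_form (\<lambda>(g, i). if i = 0 then 1 else 0),
         hmul = m,
         hone = grp \<one>\<^bsub>G\<^esub>\<rparr>)"

text \<open>
  The operation on \<open>G\<close> obtained by restricting an operation on \<open>H\<^sub>D\<close> to the group elements.
\<close>

definition restrict_op ::
  "('g, 'm) monoid_scheme \<Rightarrow> ((('g \<times> nat) \<times> ('g \<times> nat), 'k::field) vect \<Rightarrow> ('g \<times> nat, 'k) vect) \<Rightarrow>
    'g \<Rightarrow> 'g \<Rightarrow> 'g"
  where "restrict_op G p g h = (THE k. k \<in> carrier G \<and> p (grp g \<boxtimes> grp h) = grp k)"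

end

theory Submission
  imports Defs
begin

text \<open>
  Write \<open>x\<close> for the generator, \<open>\<cdot>\<close> and \<open>:\<close> for the two operations.  The skew-brace law is linear in
  both arguments, so it only has to be tested on a basis, and the work lies in computing
  both operations on that basis.

  In a q-magma coalgebra both operations are coalgebra maps on \<open>X \<otimes> X\<^sup>c\<^sup>o\<^sup>p\<close> and satisfy an exchange
  identity (\<open>comul_p\<close>, \<open>comul_d\<close>, \<open>exchange\<close>).  The comultiplication of \<open>H\<^sub>D\<close> is homogeneous for the
  degree in \<open>x\<close>, which forces every group-like element into \<open>G\<close> (\<open>group_like_is_grp\<close>) and every
  skew-primitive element \<open>v\<close>, with coproduct \<open>v \<otimes> k + 1 \<otimes> v\<close>, to be a multiple of \<open>1 - k\<close> unless
  \<open>k = a\<close>, where it has the form \<open>c x + b (1 - a)\<close> (\<open>skew_primitive\<close>).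
  Consequently the operations restrict to \<open>G\<close>, one has \<open>a \<cdot> g = a\<close>, and \<open>x \<cdot> g = c x + b (1 - a)\<close>
  with \<open>c \<noteq> 0\<close>.  Comparing coefficients in the exchange identity for \<open>g\<close> and \<open>x\<close> gives
  \<open>g \<cdot> a = g\<close> and \<open>g \<cdot> x = 0\<close>.

  Acting on \<open>x\<close> by \<open>x g = \<chi>(g) g x\<close> yields \<open>x \<cdot> x = \<lambda> (1 - a)\<close> and \<open>c = \<chi>(g)\<close>; then the cycle
  identity \<open>(x \<cdot> g) \<cdot> (x \<cdot> g) = (x \<cdot> x) \<cdot> g\<close> gives \<open>b = 0\<close> and \<open>\<chi>(g)\<^sup>2 = 1\<close>, so \<open>n = 2\<close> and
  \<open>\<chi>(a) = -1\<close>.  The mixed cycle identity at \<open>x, x, x\<close> gives \<open>x : x = - \<lambda> (1 - a)\<close>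
  (\<open>x_actions\<close>).

  With these values the skew-brace law for \<open>g x\<^sup>i\<close> and \<open>h x\<^sup>j\<close> with \<open>(i, j) \<noteq> (1, 1)\<close> amounts to
  the skew-brace law of \<open>G\<close> for \<open>g\<close> and \<open>h\<close>, multiplied by \<open>x\<^sup>i\<^sup>+\<^sup>j\<close>.  For \<open>i = j = 1\<close> and with
  \<open>k\<close> the common value in \<open>G\<close>, it reads \<open>- k x\<^sup>2 - \<lambda> k (1 - a) = \<lambda> k (a - a\<^sup>2) + k x\<^sup>2\<close>, and
  \<open>x\<^sup>2 = \<alpha> (a\<^sup>2 - 1)\<close> turns this into \<open>k\<close> times \<open>2 \<alpha> (a\<^sup>2 - 1) = \<lambda> (a\<^sup>2 - 1)\<close>
  (\<open>skew_brace_iff\<close>).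
\<close>

section \<open>Linear extension and Sweedler sums\<close>

lemma lext_cong:
  assumes "v \<in> fspace B" "\<And>b. b \<in> B \<Longrightarrow> f b = g b"
  shows "lext f v = lext g v"
  using assms unfolding lext_def fspace_def by (auto intro!: sum.cong)

lemma lext_fun_add: "lext (\<lambda>b. f b + g b) v = lext f v + lext g v"
  by (simp add: lext_def scal_distribs sum.distrib)

lemma lext_fun_scal: "lext (\<lambda>b. c \<bullet> f b) v = c \<bullet> lext f v"
  by (simp add: lext_def scal_sum mult.commute)

lemma lext_fun_zero [simp]: "lext (\<lambda>b. 0) v = 0"
  by (simp add: lext_def)

lemma lext_sum: "lext f (\<Sum>i\<in>A. g i) = (\<Sum>i\<in>A. lext f (g i))"
  by (induction A rule: infinite_finite_induct) (simp_all add: lext_add)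

lemma lext_lext: "lext f (lext g v) = lext (\<lambda>b. lext f (g b)) v"
  by (simp add: lext_def[of g] lext_def[of "\<lambda>b. lext f (g b)"] lext_sum lext_scal)

lemma vect_induct [case_names zero step]:
  assumes "P 0" "\<And>c b v. P v \<Longrightarrow> P (c \<bullet> bv b + v)"
  shows "P v"
  by (rule fspace_induct[of v UNIV]) (use assms in \<open>auto simp: fspace_def\<close>)

lemma lext_bv_id [simp]: "lext bv v = v"
  by (induction v rule: vect_induct) (simp_all add: lext_add lext_scal)

lemma lext_tensor: "lext f (u \<boxtimes> v) = lext (\<lambda>b. lext (\<lambda>c. f (b, c)) v) u"
proof (induction u rule: vect_induct)
  case (step c b u)
  have "lext f (bv b \<boxtimes> v) = lext (\<lambda>c. f (b, c)) v"
    by (induction v rule: vect_induct) (simp_all add: lext_add lext_scal)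
  with step show ?case by (simp add: lext_add lext_scal)
qed simp

lemma linear_map_lext:
  assumes f: "linear_map B C f" and v: "v \<in> fspace A" and g: "\<And>b. b \<in> A \<Longrightarrow> g b \<in> fspace B"
  shows "f (lext g v) = lext (\<lambda>b. f (g b)) v"
proof -
  have "f (0 \<bullet> 0) = 0 \<bullet> f 0" using f fspace_closed(1)[of B] unfolding linear_map_def by blast
  then have f0: "f 0 = 0" by simp
  have "lext g v \<in> fspace B \<and> f (lext g v) = lext (\<lambda>b. f (g b)) v"
    using v
  proof (induction v rule: fspace_induct)
    case (step c b v)
    then have "c \<bullet> g b \<in> fspace B" "lext g v \<in> fspace B" using g by (auto simp: fspace_closed)
    then have "f (c \<bullet> g b + lext g v) = c \<bullet> f (g b) + f (lext g v)"
      using f g[OF step(1)] unfolding linear_map_def by simp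
    with step g show ?case by (simp add: lext_add lext_scal fspace_closed)
  qed (simp add: f0 fspace_closed)
  then show ?thesis by simp
qed

lemma linear_mapD:
  assumes "linear_map B C f"
  shows "u \<in> fspace B \<Longrightarrow> f u \<in> fspace C"
    "u \<in> fspace B \<Longrightarrow> v \<in> fspace B \<Longrightarrow> f (u + v) = f u + f v"
    "u \<in> fspace B \<Longrightarrow> f (c \<bullet> u) = c \<bullet> f u"
  using assms by (auto simp: linear_map_def)

lemma linear_map_lextI: "(\<And>b. b \<in> B \<Longrightarrow> f b \<in> fspace C) \<Longrightarrow> linear_map B C (lext f)"
  by (auto simp: linear_map_def lext_add lext_scal intro: lext_fspace)

lemma sweedler_simps [simp]:
  "sweedler (bv (b, c)) F = F (bv b) (bv c)"
  "sweedler 0 F = 0"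
  "sweedler (s + t) F = sweedler s F + sweedler t F"
  "sweedler (c' \<bullet> s) F = c' \<bullet> sweedler s F"
  "sweedler t (\<lambda>x y. x \<boxtimes> y) = t"
  by (simp_all add: sweedler_def lext_add lext_scal case_prod_unfold)

lemma sweedler_cong:
  assumes "t \<in> fspace (B \<times> C)"
    "\<And>b c. b \<in> B \<Longrightarrow> c \<in> C \<Longrightarrow> F (bv b) (bv c) = F' (bv b) (bv c)"
  shows "sweedler t F = sweedler t F'"
  unfolding sweedler_def using assms by (intro lext_cong) auto

lemma sweedler_fspace:
  assumes "t \<in> fspace (B \<times> C)"
    "\<And>b c. b \<in> B \<Longrightarrow> c \<in> C \<Longrightarrow> F (bv b) (bv c) \<in> fspace D"
  shows "sweedler t F \<in> fspace D"
  unfolding sweedler_def using assms by (intro lext_fspace) auto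

lemma lext_sweedler: "lext f (sweedler t F) = sweedler t (\<lambda>x y. lext f (F x y))"
  by (simp add: sweedler_def lext_lext case_prod_unfold)

lemma sweedler_scal: "sweedler t (\<lambda>x y. c \<bullet> F x y) = c \<bullet> sweedler t F"
  by (simp add: sweedler_def case_prod_unfold lext_fun_scal)

lemma sweedler_commute:
  "sweedler s (\<lambda>x y. sweedler t (F x y)) = sweedler t (\<lambda>x' y'. sweedler s (\<lambda>x y. F x y x' y'))"
proof (induction s rule: vect_induct)
  case (step c b s)
  have "sweedler t (\<lambda>x y. c \<bullet> F1 x y + F2 x y) = c \<bullet> sweedler t F1 + sweedler t F2" for F1 F2
    by (simp add: sweedler_def case_prod_unfold lext_fun_add lext_fun_scal)
  then have "sweedler t (\<lambda>x' y'. c \<bullet> F (bv (fst b)) (bv (snd b)) x' y' + sweedler s (\<lambda>x y. F x y x' y')) =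
      c \<bullet> sweedler t (F (bv (fst b)) (bv (snd b))) + sweedler t (\<lambda>x' y'. sweedler s (\<lambda>x y. F x y x' y'))" .
  with step show ?case by (cases b) simp
qed (simp add: sweedler_def case_prod_unfold)

lemma map_tensor_simps [simp]:
  "map_tensor f g (bv (b, c)) = f (bv b) \<boxtimes> g (bv c)"
  "map_tensor f g 0 = 0"
  "map_tensor f g (s + t) = map_tensor f g s + map_tensor f g t"
  "map_tensor f g (c' \<bullet> s) = c' \<bullet> map_tensor f g s"
  by (simp_all add: map_tensor_def lext_add lext_scal)

lemma map_tensor_sweedler:
  "map_tensor f g (sweedler t F) = sweedler t (\<lambda>x y. map_tensor f g (F x y))"
  by (simp add: map_tensor_def lext_sweedler)

lemma map_tensor_tensor: "map_tensor (lext f) (lext g) (u \<boxtimes> v) = lext f u \<boxtimes> lext g v"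
proof (induction u rule: vect_induct)
  case (step c b u)
  have "map_tensor (lext f) (lext g) (bv b \<boxtimes> v) = f b \<boxtimes> lext g v"
    by (induction v rule: vect_induct) (simp_all add: map_tensor_def lext_add lext_scal)
  with step show ?case by (simp add: map_tensor_def lext_add lext_scal)
qed (simp add: map_tensor_def)

section \<open>q-magma coalgebras\<close>

lemma coalgebra_comul_fspace:
  assumes "coalgebra X" "v \<in> cspace X"
  shows "comul X v \<in> fspace (cbasis X \<times> cbasis X)"
  using assms by (auto simp: coalgebra_def linear_map_def)

lemma coalgebra_counit_lext:
  assumes "coalgebra X" "v \<in> cspace X"
  shows "lext (\<lambda>b. counit X (bv b) \<bullet> w) v = counit X v \<bullet> w"
  using assms(2)
proof (induction v rule: fspace_induct)
  case zero
  have "counit X (0 \<bullet> 0) = 0 * counit X 0"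
    using assms(1) fspace_closed(1)[of "cbasis X"] unfolding coalgebra_def linear_form_def by blast
  then show ?case by simp
next
  case (step c b v)
  then have "counit X (c \<bullet> bv b + v) = c * counit X (bv b) + counit X v"
    using assms(1) by (simp add: coalgebra_def linear_form_def fspace_closed)
  then show ?case using step by (simp add: lext_add lext_scal scal_distribs)
qed

text \<open>
  The counit axioms in the form in which Sweedler calculations use them: a map that is only known to
  be linear on the coalgebra itself enters through its values on the basis.
\<close>

lemma coalgebra_counit_sweedler:
  assumes X: "coalgebra X" and v: "v \<in> cspace X"
    and f: "\<And>b. b \<in> cbasis X \<Longrightarrow> F (bv b) = lext f (bv b)"
  shows "sweedler (comul X v) (\<lambda>x y. counit X x \<bullet> F y) = lext f v"
    "sweedler (comul X v) (\<lambda>x y. counit X y \<bullet> F x) = lext f v"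
proof -
  note t = coalgebra_comul_fspace[OF X v]
  have "sweedler (comul X v) (\<lambda>x y. counit X x \<bullet> F y) =
      lext f (sweedler (comul X v) (\<lambda>x y. counit X x \<bullet> y))"
    unfolding lext_sweedler using t f by (intro sweedler_cong) (auto simp: lext_scal)
  also have "\<dots> = lext f v" using X v by (simp add: coalgebra_def)
  finally show "sweedler (comul X v) (\<lambda>x y. counit X x \<bullet> F y) = lext f v" .
  have "sweedler (comul X v) (\<lambda>x y. counit X y \<bullet> F x) =
      lext f (sweedler (comul X v) (\<lambda>x y. counit X y \<bullet> x))"
    unfolding lext_sweedler using t f by (intro sweedler_cong) (auto simp: lext_scal)
  also have "\<dots> = lext f v" using X v by (simp add: coalgebra_def)
  finally show "sweedler (comul X v) (\<lambda>x y. counit X y \<bullet> F x) = lext f v" .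
qed

definition swap_tensor :: "('b \<times> 'b, 'k::field) vect \<Rightarrow> ('b \<times> 'b, 'k) vect"
  where "swap_tensor t = sweedler t (\<lambda>x y. y \<boxtimes> x)"

lemma swap_swap [simp]: "swap_tensor (swap_tensor t) = t"
  by (induction t rule: vect_induct) (auto simp: swap_tensor_def)

lemma swap_sweedler: "swap_tensor (sweedler t F) = sweedler t (\<lambda>x y. swap_tensor (F x y))"
  by (simp add: swap_tensor_def sweedler_def lext_lext case_prod_unfold)

lemma sweedler_swap: "sweedler (swap_tensor t) F = sweedler t (\<lambda>x y. F y x)"
  by (induction t rule: vect_induct) (auto simp: swap_tensor_def)

lemma swap_tensor_tensor [simp]: "swap_tensor (u \<boxtimes> v) = v \<boxtimes> u"
proof (induction u rule: vect_induct)
  case (step c b u)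
  have "swap_tensor (bv b \<boxtimes> v) = v \<boxtimes> bv b"
    by (induction v rule: vect_induct) (auto simp: swap_tensor_def)
  with step show ?case by (simp add: swap_tensor_def)
qed (simp add: swap_tensor_def)

locale q_magma =
  fixes X :: "('b, 'k::field, 'z) coalg_scheme" and p d
  assumes q_magma: "q_magma_coalgebra X p d"
begin

lemma coalg: "coalgebra X"
  and linear_p: "linear_map (cbasis X \<times> cbasis X) (cbasis X) p"
  and linear_d: "linear_map (cbasis X \<times> cbasis X) (cbasis X) d"
  and counit_p: "u \<in> cspace X \<Longrightarrow> v \<in> cspace X \<Longrightarrow> counit X (p (u \<boxtimes> v)) = counit X u * counit X v"
  and counit_d: "u \<in> cspace X \<Longrightarrow> v \<in> cspace X \<Longrightarrow> counit X (d (u \<boxtimes> v)) = counit X u * counit X v"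
  using q_magma by (auto simp: q_magma_coalgebra_def)

lemma comul_fspace: "v \<in> cspace X \<Longrightarrow> comul X v \<in> fspace (cbasis X \<times> cbasis X)"
  by (rule coalgebra_comul_fspace[OF coalg])

text \<open>
  The map \<open>x \<otimes> y \<mapsto> y\<^sub>(\<^sub>1\<^sub>) : x\<^sub>(\<^sub>2\<^sub>) \<otimes> x\<^sub>(\<^sub>1\<^sub>) \<cdot> y\<^sub>(\<^sub>2\<^sub>)\<close>.  That it is a coalgebra morphism is one identity in a
  fourfold tensor product; the three usual identities are its images under applying the counit to one
  of the two factors in each half: the two left factors give \<open>comul_p\<close>, the two right factors
  \<open>comul_d\<close>, and one of each gives \<open>exchange\<close>.
\<close>

definition braid where
  "braid b c = sweedler (comul X (bv b)) (\<lambda>x1 x2. sweedler (comul X (bv c)) (\<lambda>y1 y2.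
          d (y1 \<boxtimes> x2) \<boxtimes> p (x1 \<boxtimes> y2)))"

definition counit_left where
  "counit_left = lext (\<lambda>(b, c). counit X (bv b) \<bullet> (bv c :: ('b, 'k) vect))"

definition counit_right where
  "counit_right = lext (\<lambda>(b, c). counit X (bv c) \<bullet> (bv b :: ('b, 'k) vect))"

lemma counit_left_tensor: "u \<in> cspace X \<Longrightarrow> counit_left (u \<boxtimes> v) = counit X u \<bullet> v"
  by (simp add: counit_left_def lext_tensor lext_fun_scal coalgebra_counit_lext[OF coalg])

lemma counit_right_tensor: "v \<in> cspace X \<Longrightarrow> counit_right (u \<boxtimes> v) = counit X v \<bullet> u"
  by (simp add: counit_right_def lext_tensor lext_fun_scal coalgebra_counit_lext[OF coalg])

lemma counit_left_bv [simp]: "counit_left (bv (b, c)) = counit X (bv b) \<bullet> bv c"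
  and counit_right_bv [simp]: "counit_right (bv (b, c)) = counit X (bv c) \<bullet> bv b"
  by (simp_all add: counit_left_def counit_right_def)

lemma p_closed: "b \<in> cbasis X \<Longrightarrow> c \<in> cbasis X \<Longrightarrow> p (bv (b, c)) \<in> cspace X"
  and d_closed: "b \<in> cbasis X \<Longrightarrow> c \<in> cbasis X \<Longrightarrow> d (bv (b, c)) \<in> cspace X"
  using linear_mapD(1)[OF linear_p] linear_mapD(1)[OF linear_d] by (simp_all add: fspace_closed)

lemma braid_fspace:
  assumes "b \<in> cbasis X" "c \<in> cbasis X"
  shows "braid b c \<in> fspace (cbasis X \<times> cbasis X)"
  unfolding braid_def using assms
  by (auto intro!: sweedler_fspace[OF comul_fspace] tensor_fspace p_closed d_closed
      simp: fspace_closed)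

lemma counit_left_braid:
  assumes b: "b \<in> cbasis X" and c: "c \<in> cbasis X"
  shows "counit_left (braid b c) = p (bv (b, c))"
proof -
  note [simp] = fspace_closed
  have "counit_left (braid b c) = sweedler (comul X (bv b)) (\<lambda>x1 x2. sweedler (comul X (bv c)) (\<lambda>y1 y2.
          counit_left (d (y1 \<boxtimes> x2) \<boxtimes> p (x1 \<boxtimes> y2))))"
    by (simp add: braid_def counit_left_def lext_sweedler)
  also have "\<dots> = sweedler (comul X (bv b)) (\<lambda>x1 x2. counit X x2 \<bullet> p (x1 \<boxtimes> bv c))"
  proof (rule sweedler_cong[OF comul_fspace])
    fix b1 b2 assume B: "b1 \<in> cbasis X" "b2 \<in> cbasis X"
    have "sweedler (comul X (bv c)) (\<lambda>y1 y2. counit_left (d (y1 \<boxtimes> bv b2) \<boxtimes> p (bv b1 \<boxtimes> y2)))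
       = sweedler (comul X (bv c)) (\<lambda>y1 y2. counit X y1 \<bullet> counit X (bv b2) \<bullet> p (bv b1 \<boxtimes> y2))"
      using B counit_d[of "bv _" "bv _"]
      by (intro sweedler_cong[OF comul_fspace]) (auto simp: c counit_left_tensor d_closed)
    also have "\<dots> = lext (\<lambda>c. counit X (bv b2) \<bullet> p (bv (b1, c))) (bv c)"
      by (rule coalgebra_counit_sweedler[OF coalg]) (simp_all add: c)
    finally show "sweedler (comul X (bv c)) (\<lambda>y1 y2. counit_left (d (y1 \<boxtimes> bv b2) \<boxtimes> p (bv b1 \<boxtimes> y2)))
       = counit X (bv b2) \<bullet> p (bv b1 \<boxtimes> bv c)" by simp
  qed (simp add: b)
  also have "\<dots> = lext (\<lambda>b. p (bv (b, c))) (bv b)"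
    by (rule coalgebra_counit_sweedler[OF coalg]) (simp_all add: b)
  finally show ?thesis by simp
qed

lemma counit_right_braid:
  assumes b: "b \<in> cbasis X" and c: "c \<in> cbasis X"
  shows "counit_right (braid b c) = d (bv (c, b))"
proof -
  note [simp] = fspace_closed
  have "counit_right (braid b c) = sweedler (comul X (bv b)) (\<lambda>x1 x2. sweedler (comul X (bv c)) (\<lambda>y1 y2.
          counit_right (d (y1 \<boxtimes> x2) \<boxtimes> p (x1 \<boxtimes> y2))))"
    by (simp add: braid_def counit_right_def lext_sweedler)
  also have "\<dots> = sweedler (comul X (bv b)) (\<lambda>x1 x2. counit X x1 \<bullet> d (bv c \<boxtimes> x2))"
  proof (rule sweedler_cong[OF comul_fspace])
    fix b1 b2 assume B: "b1 \<in> cbasis X" "b2 \<in> cbasis X"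
    have "sweedler (comul X (bv c)) (\<lambda>y1 y2. counit_right (d (y1 \<boxtimes> bv b2) \<boxtimes> p (bv b1 \<boxtimes> y2)))
       = sweedler (comul X (bv c)) (\<lambda>y1 y2. counit X y2 \<bullet> counit X (bv b1) \<bullet> d (y1 \<boxtimes> bv b2))"
      using B counit_p[of "bv _" "bv _"]
      by (intro sweedler_cong[OF comul_fspace]) (auto simp: c counit_right_tensor p_closed mult.commute)
    also have "\<dots> = lext (\<lambda>c. counit X (bv b1) \<bullet> d (bv (c, b2))) (bv c)"
      by (rule coalgebra_counit_sweedler[OF coalg]) (simp_all add: c)
    finally show "sweedler (comul X (bv c)) (\<lambda>y1 y2. counit_right (d (y1 \<boxtimes> bv b2) \<boxtimes> p (bv b1 \<boxtimes> y2)))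
       = counit X (bv b1) \<bullet> d (bv c \<boxtimes> bv b2)" by simp
  qed (simp add: b)
  also have "\<dots> = lext (\<lambda>b. d (bv (c, b))) (bv b)"
    by (rule coalgebra_counit_sweedler[OF coalg]) (simp_all add: b)
  finally show ?thesis by simp
qed

text \<open>The comultiplication of \<open>X\<^sup>c\<^sup>o\<^sup>p \<otimes> X\<close>.\<close>

definition comul2 where
  "comul2 b c = sweedler (comul X (bv b)) (\<lambda>x1 x2. sweedler (comul X (bv c)) (\<lambda>y1 y2.
     (x2 \<boxtimes> y1) \<boxtimes> (x1 \<boxtimes> y2)))"

lemma comul_target: "comul (tensor_coalg (cop X) X) t = lext (\<lambda>(b, c). comul2 b c) t"
  by (simp add: tensor_coalg_def cop_def comul2_def sweedler_swap flip: swap_tensor_def)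

lemma counit_left_comul2:
  assumes b: "b \<in> cbasis X" and c: "c \<in> cbasis X"
  shows "map_tensor counit_left counit_left (comul2 b c) = comul X (counit_left (bv (b, c)))"
proof -
  note [simp] = fspace_closed
  have "map_tensor counit_left counit_left (comul2 b c) =
    sweedler (comul X (bv b)) (\<lambda>x1 x2. sweedler (comul X (bv c)) (\<lambda>y1 y2.
      counit_left (x2 \<boxtimes> y1) \<boxtimes> counit_left (x1 \<boxtimes> y2)))"
    by (simp add: comul2_def map_tensor_sweedler counit_left_def map_tensor_tensor)
  also have "\<dots> = sweedler (comul X (bv b)) (\<lambda>x1 x2. counit X x1 \<bullet> counit X x2 \<bullet> comul X (bv c))"
  proof (intro sweedler_cong[OF comul_fspace])
    fix b1 b2 assume B: "b1 \<in> cbasis X" "b2 \<in> cbasis X"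
    have "sweedler (comul X (bv c)) (\<lambda>y1 y2. counit_left (bv b2 \<boxtimes> y1) \<boxtimes> counit_left (bv b1 \<boxtimes> y2)) =
        sweedler (comul X (bv c)) (\<lambda>y1 y2. (counit X (bv b1) * counit X (bv b2)) \<bullet> (y1 \<boxtimes> y2))"
      using B by (simp add: counit_left_tensor)
    then show "sweedler (comul X (bv c)) (\<lambda>y1 y2. counit_left (bv b2 \<boxtimes> y1) \<boxtimes> counit_left (bv b1 \<boxtimes> y2)) =
        counit X (bv b1) \<bullet> counit X (bv b2) \<bullet> comul X (bv c)" by (simp add: sweedler_scal)
  qed (simp add: b)
  also have "\<dots> = lext (\<lambda>b. counit X (bv b) \<bullet> comul X (bv c)) (bv b)"
    by (rule coalgebra_counit_sweedler[OF coalg]) (simp_all add: b)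
  also have "\<dots> = comul X (counit_left (bv (b, c)))"
    using c coalg by (simp add: counit_left_def coalgebra_def linear_map_def)
  finally show ?thesis .
qed

lemma counit_right_comul2:
  assumes b: "b \<in> cbasis X" and c: "c \<in> cbasis X"
  shows "map_tensor counit_right counit_right (comul2 b c) =
    swap_tensor (comul X (counit_right (bv (b, c))))"
proof -
  note [simp] = fspace_closed
  have "map_tensor counit_right counit_right (comul2 b c) =
    sweedler (comul X (bv b)) (\<lambda>x1 x2. sweedler (comul X (bv c)) (\<lambda>y1 y2.
      counit_right (x2 \<boxtimes> y1) \<boxtimes> counit_right (x1 \<boxtimes> y2)))"
    by (simp add: comul2_def map_tensor_sweedler counit_right_def map_tensor_tensor)
  also have "\<dots> = sweedler (comul X (bv b)) (\<lambda>x1 x2. counit X (bv c) \<bullet> (x2 \<boxtimes> x1))"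
  proof (intro sweedler_cong[OF comul_fspace])
    fix b1 b2 assume B: "b1 \<in> cbasis X" "b2 \<in> cbasis X"
    have "sweedler (comul X (bv c)) (\<lambda>y1 y2. counit_right (bv b2 \<boxtimes> y1) \<boxtimes> counit_right (bv b1 \<boxtimes> y2)) =
        sweedler (comul X (bv c)) (\<lambda>y1 y2. counit X y1 \<bullet> counit X y2 \<bullet> (bv b2 \<boxtimes> bv b1))"
      using B by (intro sweedler_cong[OF comul_fspace]) (auto simp: c counit_right_tensor mult.commute)
    also have "\<dots> = lext (\<lambda>c. counit X (bv c) \<bullet> (bv b2 \<boxtimes> bv b1)) (bv c)"
      by (rule coalgebra_counit_sweedler[OF coalg]) (simp_all add: c)
    finally show "sweedler (comul X (bv c)) (\<lambda>y1 y2. counit_right (bv b2 \<boxtimes> y1) \<boxtimes> counit_right (bv b1 \<boxtimes> y2)) =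
        counit X (bv c) \<bullet> (bv b2 \<boxtimes> bv b1)" by simp
  qed (simp add: b)
  also have "\<dots> = swap_tensor (comul X (counit_right (bv (b, c))))"
    using b coalg by (simp add: counit_right_def coalgebra_def linear_map_def sweedler_scal swap_tensor_def)
  finally show ?thesis .
qed

lemma counit_right_left_comul2:
  assumes b: "b \<in> cbasis X" and c: "c \<in> cbasis X"
  shows "map_tensor counit_right counit_left (comul2 b c) = bv (b, c)"
proof -
  note [simp] = fspace_closed
  have "map_tensor counit_right counit_left (comul2 b c) =
    sweedler (comul X (bv b)) (\<lambda>x1 x2. sweedler (comul X (bv c)) (\<lambda>y1 y2.
      counit_right (x2 \<boxtimes> y1) \<boxtimes> counit_left (x1 \<boxtimes> y2)))"
    by (simp add: comul2_def map_tensor_sweedler counit_right_def counit_left_def map_tensor_tensor)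
  also have "\<dots> = sweedler (comul X (bv b)) (\<lambda>x1 x2. counit X x1 \<bullet> (x2 \<boxtimes> bv c))"
  proof (intro sweedler_cong[OF comul_fspace])
    fix b1 b2 assume B: "b1 \<in> cbasis X" "b2 \<in> cbasis X"
    have "sweedler (comul X (bv c)) (\<lambda>y1 y2. counit_right (bv b2 \<boxtimes> y1) \<boxtimes> counit_left (bv b1 \<boxtimes> y2)) =
        sweedler (comul X (bv c)) (\<lambda>y1 y2. counit X y1 \<bullet> counit X (bv b1) \<bullet> (bv b2 \<boxtimes> y2))"
      using B by (intro sweedler_cong[OF comul_fspace])
        (auto simp: c counit_right_tensor counit_left_tensor mult.commute)
    also have "\<dots> = lext (\<lambda>c. counit X (bv b1) \<bullet> (bv b2 \<boxtimes> bv c)) (bv c)"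
      by (rule coalgebra_counit_sweedler[OF coalg]) (simp_all add: c)
    finally show "sweedler (comul X (bv c)) (\<lambda>y1 y2. counit_right (bv b2 \<boxtimes> y1) \<boxtimes> counit_left (bv b1 \<boxtimes> y2)) =
        counit X (bv b1) \<bullet> (bv b2 \<boxtimes> bv c)" by simp
  qed (simp add: b)
  also have "\<dots> = lext (\<lambda>b. bv b \<boxtimes> bv c) (bv b)"
    by (rule coalgebra_counit_sweedler[OF coalg]) (simp_all add: b)
  finally show ?thesis by simp
qed

lemma comul_braid:
  assumes b: "b \<in> cbasis X" and c: "c \<in> cbasis X"
  shows "lext (\<lambda>(b, c). comul2 b c) (braid b c) =
    sweedler (comul X (bv b)) (\<lambda>x1 x2. sweedler (comul X (bv c)) (\<lambda>y1 y2.
      map_tensor (lext (\<lambda>(b, c). braid b c)) (lext (\<lambda>(b, c). braid b c)) ((x1 \<boxtimes> y2) \<boxtimes> (x2 \<boxtimes> y1))))"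
proof -
  have bc: "bv (b, c) \<in> cspace (tensor_coalg X (cop X))"
    using b c by (simp add: tensor_coalg_def cop_def fspace_closed)
  have "coalg_morphism (tensor_coalg X (cop X)) (tensor_coalg (cop X) X) (lext (\<lambda>(b, c). braid b c))"
    using q_magma by (simp add: q_magma_coalgebra_def braid_def)
  then have "comul (tensor_coalg (cop X) X) (lext (\<lambda>(b, c). braid b c) (bv (b, c))) =
      map_tensor (lext (\<lambda>(b, c). braid b c)) (lext (\<lambda>(b, c). braid b c)) (comul (tensor_coalg X (cop X)) (bv (b, c)))"
    using bc unfolding coalg_morphism_def by blast
  then show ?thesis
    by (simp add: comul_target) (simp add: tensor_coalg_def cop_def sweedler_swap map_tensor_sweedler flip: swap_tensor_def)
qed

lemma apply_counits:
  assumes b: "b \<in> cbasis X" and c: "c \<in> cbasis X"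
  shows "lext (\<lambda>(b, c). map_tensor (lext f) (lext g) (comul2 b c)) (braid b c) =
    sweedler (comul X (bv b)) (\<lambda>x1 x2. sweedler (comul X (bv c)) (\<lambda>y1 y2.
      lext f (lext (\<lambda>(b, c). braid b c) (x1 \<boxtimes> y2)) \<boxtimes> lext g (lext (\<lambda>(b, c). braid b c) (x2 \<boxtimes> y1))))"
proof -
  have "lext (\<lambda>(b, c). map_tensor (lext f) (lext g) (comul2 b c)) (braid b c) =
      map_tensor (lext f) (lext g) (lext (\<lambda>(b, c). comul2 b c) (braid b c))"
    by (simp add: map_tensor_def[of "lext f"] lext_lext case_prod_unfold)
  also have "\<dots> = sweedler (comul X (bv b)) (\<lambda>x1 x2. sweedler (comul X (bv c)) (\<lambda>y1 y2.
      lext f (lext (\<lambda>(b, c). braid b c) (x1 \<boxtimes> y2)) \<boxtimes> lext g (lext (\<lambda>(b, c). braid b c) (x2 \<boxtimes> y1))))"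
    unfolding comul_braid[OF b c] map_tensor_sweedler
    by (simp add: map_tensor_tensor)
  finally show ?thesis .
qed

lemma comul_p:
  assumes b: "b \<in> cbasis X" and c: "c \<in> cbasis X"
  shows "comul X (p (bv b \<boxtimes> bv c)) =
    sweedler (comul X (bv b)) (\<lambda>x1 x2. sweedler (comul X (bv c)) (\<lambda>y1 y2. p (x1 \<boxtimes> y2) \<boxtimes> p (x2 \<boxtimes> y1)))"
proof -
  have lin: "linear_map (cbasis X) (cbasis X \<times> cbasis X) (comul X)"
    using coalg by (simp add: coalgebra_def)
  have "comul X (counit_left (braid b c)) = lext (\<lambda>(b, c). comul X (counit_left (bv (b, c)))) (braid b c)"
    unfolding counit_left_def
    by (subst linear_map_lext[OF lin braid_fspace[OF b c]]) (auto simp: fspace_closed case_prod_unfold)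
  also have "\<dots> = lext (\<lambda>(b, c). map_tensor counit_left counit_left (comul2 b c)) (braid b c)"
    by (rule lext_cong[OF braid_fspace[OF b c]]) (auto simp: counit_left_comul2)
  also have "\<dots> = sweedler (comul X (bv b)) (\<lambda>x1 x2. sweedler (comul X (bv c)) (\<lambda>y1 y2.
      counit_left (lext (\<lambda>(b, c). braid b c) (x1 \<boxtimes> y2)) \<boxtimes> counit_left (lext (\<lambda>(b, c). braid b c) (x2 \<boxtimes> y1))))"
    unfolding counit_left_def by (rule apply_counits[OF b c])
  also have "\<dots> = sweedler (comul X (bv b)) (\<lambda>x1 x2. sweedler (comul X (bv c)) (\<lambda>y1 y2. p (x1 \<boxtimes> y2) \<boxtimes> p (x2 \<boxtimes> y1)))"
    by (intro sweedler_cong[OF comul_fspace]) (auto simp: fspace_closed b c counit_left_braid)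
  finally show ?thesis by (simp add: counit_left_braid[OF b c])
qed

lemma comul_d:
  assumes b: "b \<in> cbasis X" and c: "c \<in> cbasis X"
  shows "comul X (d (bv b \<boxtimes> bv c)) =
    sweedler (comul X (bv b)) (\<lambda>x1 x2. sweedler (comul X (bv c)) (\<lambda>y1 y2. d (x1 \<boxtimes> y2) \<boxtimes> d (x2 \<boxtimes> y1)))"
proof -
  have lin: "linear_map (cbasis X) (cbasis X \<times> cbasis X) (comul X)"
    using coalg by (simp add: coalgebra_def)
  have "comul X (counit_right (braid c b)) = lext (\<lambda>(b, c). comul X (counit_right (bv (b, c)))) (braid c b)"
    unfolding counit_right_def
    by (subst linear_map_lext[OF lin braid_fspace[OF c b]]) (auto simp: fspace_closed case_prod_unfold)
  also have "\<dots> = lext (\<lambda>(b, c). swap_tensor (map_tensor counit_right counit_right (comul2 b c))) (braid c b)"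
    by (rule lext_cong[OF braid_fspace[OF c b]]) (auto simp: counit_right_comul2)
  also have "\<dots> = swap_tensor (lext (\<lambda>(b, c). map_tensor counit_right counit_right (comul2 b c)) (braid c b))"
    by (simp add: swap_tensor_def sweedler_def lext_lext case_prod_unfold)
  also have "\<dots> = swap_tensor (sweedler (comul X (bv c)) (\<lambda>x1 x2. sweedler (comul X (bv b)) (\<lambda>y1 y2.
      counit_right (lext (\<lambda>(b, c). braid b c) (x1 \<boxtimes> y2)) \<boxtimes> counit_right (lext (\<lambda>(b, c). braid b c) (x2 \<boxtimes> y1)))))"
    unfolding counit_right_def apply_counits[OF c b] ..
  also have "\<dots> = swap_tensor (sweedler (comul X (bv c)) (\<lambda>x1 x2. sweedler (comul X (bv b)) (\<lambda>y1 y2. d (y2 \<boxtimes> x1) \<boxtimes> d (y1 \<boxtimes> x2))))"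
    by (intro arg_cong[of _ _ swap_tensor] sweedler_cong[OF comul_fspace])
      (auto simp: fspace_closed b c counit_right_braid)
  also have "\<dots> = sweedler (comul X (bv b)) (\<lambda>x1 x2. sweedler (comul X (bv c)) (\<lambda>y1 y2. d (x1 \<boxtimes> y2) \<boxtimes> d (x2 \<boxtimes> y1)))"
    by (simp add: swap_sweedler) (rule sweedler_commute)
  finally show ?thesis by (simp add: counit_right_braid[OF c b])
qed

lemma exchange:
  assumes b: "b \<in> cbasis X" and c: "c \<in> cbasis X"
  shows "sweedler (comul X (bv b)) (\<lambda>x1 x2. sweedler (comul X (bv c)) (\<lambda>y1 y2. d (y1 \<boxtimes> x2) \<boxtimes> p (x1 \<boxtimes> y2))) =
     sweedler (comul X (bv b)) (\<lambda>x1 x2. sweedler (comul X (bv c)) (\<lambda>y1 y2. d (y2 \<boxtimes> x1) \<boxtimes> p (x2 \<boxtimes> y1)))"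
proof -
  have "lext bv (braid b c) = lext (\<lambda>(b, c). map_tensor counit_right counit_left (comul2 b c)) (braid b c)"
    by (rule lext_cong[OF braid_fspace[OF b c]]) (auto simp: counit_right_left_comul2)
  also have "\<dots> = sweedler (comul X (bv b)) (\<lambda>x1 x2. sweedler (comul X (bv c)) (\<lambda>y1 y2.
      counit_right (lext (\<lambda>(b, c). braid b c) (x1 \<boxtimes> y2)) \<boxtimes> counit_left (lext (\<lambda>(b, c). braid b c) (x2 \<boxtimes> y1))))"
    unfolding counit_left_def counit_right_def by (rule apply_counits[OF b c])
  also have "\<dots> = sweedler (comul X (bv b)) (\<lambda>x1 x2. sweedler (comul X (bv c)) (\<lambda>y1 y2. d (y2 \<boxtimes> x1) \<boxtimes> p (x2 \<boxtimes> y1)))"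
    by (intro sweedler_cong[OF comul_fspace]) (auto simp: fspace_closed b c counit_left_braid counit_right_braid)
  finally show ?thesis by (simp add: braid_def)
qed

end

section \<open>Group algebras\<close>

lemma lext_form_superset:
  assumes "finite S" "Poly_Mapping.keys v \<subseteq> S"
  shows "lext_form f v = (\<Sum>b\<in>S. Poly_Mapping.lookup v b * f b)"
  unfolding lext_form_def using assms by (intro sum.mono_neutral_left) (auto simp: in_keys_iff)

lemma lext_form_simps [simp]:
  "lext_form f (bv b) = f b" "lext_form f 0 = 0"
  "lext_form f (u + v) = lext_form f u + lext_form f v"
  "lext_form f (c \<bullet> v) = c * lext_form f v"
proof -
  have "Poly_Mapping.keys (u + v) \<subseteq> Poly_Mapping.keys u \<union> Poly_Mapping.keys v" by (rule keys_add)
  then show "lext_form f (u + v) = lext_form f u + lext_form f v"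
    by (simp add: lext_form_superset[of "Poly_Mapping.keys u \<union> Poly_Mapping.keys v"] lookup_add
        distrib_right sum.distrib)
  have "Poly_Mapping.keys (c \<bullet> v) \<subseteq> Poly_Mapping.keys v" by (auto simp: in_keys_iff)
  then show "lext_form f (c \<bullet> v) = c * lext_form f v"
    by (simp add: lext_form_superset[of "Poly_Mapping.keys v"] sum_distrib_left mult.assoc)
qed (simp_all add: lext_form_def bv_def)

lemma lext_inverse_bij_betw:
  assumes "\<And>b. b \<in> B \<Longrightarrow> f b \<in> fspace C" "\<And>c. c \<in> C \<Longrightarrow> g c \<in> fspace B"
    "\<And>b. b \<in> B \<Longrightarrow> lext g (f b) = bv b" "\<And>c. c \<in> C \<Longrightarrow> lext f (g c) = bv c"
  shows "bij_betw (lext f) (fspace B) (fspace C)"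
proof (rule bij_betw_byWitness[where f' = "lext g"])
  have "lext g (lext f v) = v" if "v \<in> fspace B" for v
    using that assms(3) lext_cong[OF that, of "\<lambda>b. lext g (f b)" bv] by (simp add: lext_lext)
  then show "\<forall>v\<in>fspace B. lext g (lext f v) = v" by blast
  have "lext f (lext g v) = v" if "v \<in> fspace C" for v
    using that assms(4) lext_cong[OF that, of "\<lambda>b. lext f (g b)" bv] by (simp add: lext_lext)
  then show "\<forall>v\<in>fspace C. lext f (lext g v) = v" by blast
qed (use assms(1,2) in \<open>auto intro: lext_fspace\<close>)

lemma sweedler_diagonal: "sweedler (lext (\<lambda>g. bv (g, g)) v) F = lext (\<lambda>g. F (bv g) (bv g)) v"
  by (simp add: sweedler_def lext_lext)

lemma lext_commute: "lext (\<lambda>x. lext (\<lambda>y. f x y) v) u = lext (\<lambda>y. lext (\<lambda>x. f x y) u) v"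
  by (induction u rule: vect_induct)
    (simp_all add: lext_add lext_scal lext_fun_add lext_fun_scal)

lemma lext_rotate:
  "lext (\<lambda>z. lext (\<lambda>x. lext (\<lambda>y. f x y z) v) u) w = lext (\<lambda>x. lext (\<lambda>y. lext (\<lambda>z. f x y z) w) v) u"
  by (subst lext_commute) (intro arg_cong[of _ _ "\<lambda>f. lext f u"] ext lext_commute)

abbreviation lin_op :: "('b \<Rightarrow> 'b \<Rightarrow> 'b) \<Rightarrow> ('b \<times> 'b, 'k::field) vect \<Rightarrow> ('b, 'k) vect" where
  "lin_op f \<equiv> lext (\<lambda>(g, h). bv (f g h))"

text \<open>
  Reduction of a trilinear identity to basis vectors; the three sums may have to be
  brought into the order of the arguments before it applies.
\<close>

lemma trilinear_eqI:
  assumes u: "u \<in> fspace A" and v: "v \<in> fspace B" and w: "w \<in> fspace C"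
    and F: "\<And>u v w. F u v w = lext (\<lambda>x. lext (\<lambda>y. lext (\<lambda>z. f x y z) w) v) u"
    and F': "\<And>u v w. F' u v w = lext (\<lambda>x. lext (\<lambda>y. lext (\<lambda>z. f' x y z) w) v) u"
    and eq: "\<And>x y z. x \<in> A \<Longrightarrow> y \<in> B \<Longrightarrow> z \<in> C \<Longrightarrow> f x y z = f' x y z"
  shows "F u v w = F' u v w"
  unfolding F F' by (intro lext_cong[OF u] lext_cong[OF v] lext_cong[OF w] eq)

context group
begin

lemma group_hopf_simps [simp]:
  "cbasis (group_hopf G) = carrier G"
  "comul (group_hopf G) = lext (\<lambda>g. bv (g, g))"
  "counit (group_hopf G) = lext_form (\<lambda>g. 1)"
  "hmul (group_hopf G) u v = lext (\<lambda>g. lext (\<lambda>h. bv (g \<otimes> h)) v) u"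
  "hone (group_hopf G) = bv \<one>"
  by (simp_all add: group_hopf_def lext_tensor)

lemma coalgebra_group_hopf: "coalgebra (group_hopf G :: ('a, 'k::field) hopf_alg)"
  unfolding coalgebra_def
proof (intro conjI ballI)
  show "linear_map (cbasis (group_hopf G)) (cbasis (group_hopf G) \<times> cbasis (group_hopf G))
      (comul (group_hopf G :: ('a, 'k) hopf_alg))"
    by (auto intro!: linear_map_lextI simp: fspace_closed)
next
  fix v :: "('a, 'k) vect"
  show "lext (\<lambda>((b, c), d). bv (b, c, d)) (map_tensor (comul (group_hopf G)) id (comul (group_hopf G) v)) =
         map_tensor id (comul (group_hopf G)) (comul (group_hopf G) v)"
    by (simp add: map_tensor_def lext_lext)
qed (simp_all add: linear_form_def sweedler_diagonal)

lemma algebra_group_hopf: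
  "algebra (carrier G) (hmul (group_hopf G :: ('a, 'k::field) hopf_alg)) (bv \<one>)"
  unfolding algebra_def
proof (intro conjI ballI)
  fix u v w :: "('a, 'k) vect"
  assume u: "u \<in> fspace (carrier G)" and v: "v \<in> fspace (carrier G)" and w: "w \<in> fspace (carrier G)"
  show "hmul (group_hopf G) (hmul (group_hopf G) u v) w = hmul (group_hopf G) u (hmul (group_hopf G) v w)"
    by (rule trilinear_eqI[OF u v w, where f = "\<lambda>x y z. bv (x \<otimes> y \<otimes> z)"
          and f' = "\<lambda>x y z. bv (x \<otimes> (y \<otimes> z))"])
      (simp_all add: lext_lext m_assoc)
next
  fix u :: "('a, 'k) vect" assume u: "u \<in> fspace (carrier G)"
  show "linear_map (carrier G) (carrier G) (\<lambda>v. hmul (group_hopf G) u v)"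
    using u by (auto simp: linear_map_def lext_add lext_scal lext_fun_add lext_fun_scal
        intro!: lext_fspace fspace_closed)
  show "linear_map (carrier G) (carrier G) (\<lambda>v. hmul (group_hopf G) v u)"
    using u by (auto simp: linear_map_def lext_add lext_scal intro!: lext_fspace fspace_closed)
  show "hmul (group_hopf G) (bv \<one>) u = u" "hmul (group_hopf G) u (bv \<one>) = u"
    using lext_cong[OF u, of "\<lambda>g. bv (\<one> \<otimes> g)" bv] lext_cong[OF u, of "\<lambda>g. bv (g \<otimes> \<one>)" bv]
    by simp_all
qed (simp add: fspace_closed)

lemma lext_form_lext: "lext_form f (lext g v) = lext_form (\<lambda>b. lext_form f (g b)) v"
  by (induction v rule: vect_induct) (simp_all add: lext_add lext_scal)

lemma hopf_algebra_group_hopf: "hopf_algebra (group_hopf G :: ('a, 'k::field) hopf_alg)"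
  unfolding hopf_algebra_def bialgebra_def
proof (intro conjI ballI exI[of _ "lext (\<lambda>g. bv (inv g))"])
  fix u v :: "('a, 'k) vect"
  assume u: "u \<in> cspace (group_hopf G)" and v: "v \<in> cspace (group_hopf G)"
  show "comul (group_hopf G) (hmul (group_hopf G) u v) = sweedler (comul (group_hopf G) u) (\<lambda>u1 u2.
      sweedler (comul (group_hopf G) v) (\<lambda>v1 v2. hmul (group_hopf G) u1 v1 \<boxtimes> hmul (group_hopf G) u2 v2))"
    by (simp add: sweedler_diagonal lext_lext)
  show "counit (group_hopf G) (hmul (group_hopf G) u v) = counit (group_hopf G) u * counit (group_hopf G) v"
    by (induction u rule: vect_induct)
      (simp_all add: lext_form_lext lext_add lext_scal algebra_simps)
next
  show "linear_map (cbasis (group_hopf G)) (cbasis (group_hopf G)) (lext (\<lambda>g. bv (inv g)))"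
    by (auto intro!: linear_map_lextI simp: fspace_closed)
next
  fix h :: "('a, 'k) vect" assume h: "h \<in> cspace (group_hopf G)"
  show "sweedler (comul (group_hopf G) h) (\<lambda>h1 h2. hmul (group_hopf G) (lext (\<lambda>g. bv (inv g)) h1) h2) =
      counit (group_hopf G) h \<bullet> hone (group_hopf G)"
    using h by (induction h rule: fspace_induct)
      (simp_all add: sweedler_diagonal lext_add lext_scal scal_distribs)
  show "sweedler (comul (group_hopf G) h) (\<lambda>h1 h2. hmul (group_hopf G) h1 (lext (\<lambda>g. bv (inv g)) h2)) =
      counit (group_hopf G) h \<bullet> hone (group_hopf G)"
    using h by (induction h rule: fspace_induct)
      (simp_all add: sweedler_diagonal lext_add lext_scal scal_distribs)
qed (use coalgebra_group_hopf algebra_group_hopf in simp_all)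

lemma regular_lin_op:
  assumes closed: "\<And>g h. g \<in> carrier G \<Longrightarrow> h \<in> carrier G \<Longrightarrow> f g h \<in> carrier G"
    and unit: "\<And>g. g \<in> carrier G \<Longrightarrow> f g \<one> = g"
    and act: "\<And>g h k. g \<in> carrier G \<Longrightarrow> h \<in> carrier G \<Longrightarrow> k \<in> carrier G \<Longrightarrow> f g (h \<otimes> k) = f (f g k) h"
  shows "bij_betw (lext (\<lambda>(b, c). bv (f b c, c)))
        (fspace (carrier G \<times> carrier G)) (fspace (carrier G \<times> carrier G) :: ('a \<times> 'a, 'k::field) vect set)"
proof -
  have "f (f b (inv c)) c = b" "f (f b c) (inv c) = b" if "b \<in> carrier G" "c \<in> carrier G" for b c
    using that act[of b c "inv c"] act[of b "inv c" c] by (simp_all add: unit)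
  then show ?thesis
    using closed
    by (intro lext_inverse_bij_betw[where g = "\<lambda>(b, c). bv (f b (inv c), c)"]) (auto simp: fspace_closed)
qed

lemma right_op_module_lin_op:
  assumes closed: "\<And>g h. g \<in> carrier G \<Longrightarrow> h \<in> carrier G \<Longrightarrow> f g h \<in> carrier G"
    and unit: "\<And>g. g \<in> carrier G \<Longrightarrow> f g \<one> = g"
    and act: "\<And>g h k. g \<in> carrier G \<Longrightarrow> h \<in> carrier G \<Longrightarrow> k \<in> carrier G \<Longrightarrow> f g (h \<otimes> k) = f (f g k) h"
  shows "right_op_module (group_hopf G :: ('a, 'k::field) hopf_alg) (lin_op f)"
  unfolding right_op_module_def
proof (intro conjI ballI)
  show "linear_map (cbasis (group_hopf G :: ('a, 'k) hopf_alg) \<times> cbasis (group_hopf G :: ('a, 'k) hopf_alg))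
      (cbasis (group_hopf G :: ('a, 'k) hopf_alg)) (lin_op f)"
    using closed by (auto intro!: linear_map_lextI simp: fspace_closed)
next
  fix h k l :: "('a, 'k) vect"
  assume h: "h \<in> cspace (group_hopf G)" and k: "k \<in> cspace (group_hopf G)" and l: "l \<in> cspace (group_hopf G)"
  show "lin_op f (h \<boxtimes> hmul (group_hopf G) k l) = lin_op f (lin_op f (h \<boxtimes> l) \<boxtimes> k)"
  proof (rule trilinear_eqI[OF h k l, where f = "\<lambda>x y z. bv (f x (y \<otimes> z))"
          and f' = "\<lambda>x y z. bv (f (f x z) y)"])
    show "lin_op f (lin_op f (h \<boxtimes> l) \<boxtimes> k) = lext (\<lambda>x. lext (\<lambda>y. lext (\<lambda>z. bv (f (f x z) y)) l) k) h"
      for h k l :: "('a, 'k) vect"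
      by (simp add: lext_lext lext_tensor) (intro arg_cong[of _ _ "\<lambda>f. lext f h"] ext lext_commute)
  qed (simp_all add: lext_lext lext_tensor act)
next
  fix h :: "('a, 'k) vect" assume h: "h \<in> cspace (group_hopf G)"
  show "lin_op f (h \<boxtimes> hone (group_hopf G)) = h"
    using lext_cong[OF h, of "\<lambda>g. bv (f g \<one>)" bv] by (simp add: lext_tensor unit)
qed

lemma product_lin_op:
  assumes prod: "\<And>g h k. g \<in> carrier G \<Longrightarrow> h \<in> carrier G \<Longrightarrow> k \<in> carrier G \<Longrightarrow>
        f (g \<otimes> h) k = f g (f' k h) \<otimes> f h k"
    and h: "h \<in> fspace (carrier G)" and k: "k \<in> fspace (carrier G)" and l: "l \<in> fspace (carrier G)"
  defines "K \<equiv> group_hopf G :: ('a, 'k::field) hopf_alg"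
  shows "lin_op f (hmul K h k \<boxtimes> l) = sweedler (comul K k) (\<lambda>k1 k2. sweedler (comul K l) (\<lambda>l1 l2.
    hmul K (lin_op f (h \<boxtimes> lin_op f' (l1 \<boxtimes> k2))) (lin_op f (k1 \<boxtimes> l2))))"
proof (rule trilinear_eqI[OF h k l, where f = "\<lambda>x y z. bv (f (x \<otimes> y) z)"
          and f' = "\<lambda>x y z. bv (f x (f' z y) \<otimes> f y z)"])
  show "sweedler (comul K k) (\<lambda>k1 k2. sweedler (comul K l) (\<lambda>l1 l2.
      hmul K (lin_op f (h \<boxtimes> lin_op f' (l1 \<boxtimes> k2))) (lin_op f (k1 \<boxtimes> l2)))) =
    lext (\<lambda>x. lext (\<lambda>y. lext (\<lambda>z. bv (f x (f' z y) \<otimes> f y z)) l) k) h" for h k l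
    by (simp add: K_def sweedler_diagonal lext_lext lext_tensor) (rule lext_rotate[symmetric])
qed (simp_all add: K_def lext_lext lext_tensor prod)

lemma cycle_lin_op:
  assumes cycle: "\<And>u v w. u \<in> carrier G \<Longrightarrow> v \<in> carrier G \<Longrightarrow> w \<in> carrier G \<Longrightarrow>
        f1 (f2 u v) (f3 w v) = f4 (f5 u w) (f6 v w)"
    and u: "u \<in> fspace (carrier G)" and v: "v \<in> fspace (carrier G)" and w: "w \<in> fspace (carrier G)"
  defines "K \<equiv> group_hopf G :: ('a, 'k::field) hopf_alg"
  shows "sweedler (comul K v) (\<lambda>v1 v2. lin_op f1 (lin_op f2 (u \<boxtimes> v1) \<boxtimes> lin_op f3 (w \<boxtimes> v2))) =
    sweedler (comul K w) (\<lambda>w1 w2. lin_op f4 (lin_op f5 (u \<boxtimes> w2) \<boxtimes> lin_op f6 (v \<boxtimes> w1)))"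
proof (rule trilinear_eqI[OF u v w, where f = "\<lambda>x y z. bv (f1 (f2 x y) (f3 z y))"
          and f' = "\<lambda>x y z. bv (f4 (f5 x z) (f6 y z))"])
  show "sweedler (comul K v) (\<lambda>v1 v2. lin_op f1 (lin_op f2 (u \<boxtimes> v1) \<boxtimes> lin_op f3 (w \<boxtimes> v2))) =
      lext (\<lambda>x. lext (\<lambda>y. lext (\<lambda>z. bv (f1 (f2 x y) (f3 z y))) w) v) u" for u v w
    by (simp add: K_def sweedler_diagonal lext_lext lext_tensor) (rule lext_commute)
  show "sweedler (comul K w) (\<lambda>w1 w2. lin_op f4 (lin_op f5 (u \<boxtimes> w2) \<boxtimes> lin_op f6 (v \<boxtimes> w1))) =
      lext (\<lambda>x. lext (\<lambda>y. lext (\<lambda>z. bv (f4 (f5 x z) (f6 y z))) w) v) u" for u v w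
    by (simp add: K_def sweedler_diagonal lext_lext lext_tensor) (rule lext_rotate)
qed (use cycle in simp_all)

text \<open>
  Every element of the basis \<open>G\<close> is group-like, so the axioms of a Hopf q-brace, being
  multilinear, reduce to identities between elements of \<open>G\<close>; regularity holds because \<open>g\<close> acts
  invertibly, with inverse the action of \<open>g\<^sup>-\<^sup>1\<close>.
\<close>

lemma q_brace_groupI:
  assumes closed: "\<And>g h. g \<in> carrier G \<Longrightarrow> h \<in> carrier G \<Longrightarrow> dt g h \<in> carrier G"
      "\<And>g h. g \<in> carrier G \<Longrightarrow> h \<in> carrier G \<Longrightarrow> cl g h \<in> carrier G"
    and unit: "\<And>g. g \<in> carrier G \<Longrightarrow> dt g \<one> = g" "\<And>g. g \<in> carrier G \<Longrightarrow> cl g \<one> = g"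
    and act: "\<And>g h k. g \<in> carrier G \<Longrightarrow> h \<in> carrier G \<Longrightarrow> k \<in> carrier G \<Longrightarrow> dt g (h \<otimes> k) = dt (dt g k) h"
      "\<And>g h k. g \<in> carrier G \<Longrightarrow> h \<in> carrier G \<Longrightarrow> k \<in> carrier G \<Longrightarrow> cl g (h \<otimes> k) = cl (cl g k) h"
    and prod: "\<And>g h k. g \<in> carrier G \<Longrightarrow> h \<in> carrier G \<Longrightarrow> k \<in> carrier G \<Longrightarrow>
        dt (g \<otimes> h) k = dt g (cl k h) \<otimes> dt h k"
      "\<And>g h k. g \<in> carrier G \<Longrightarrow> h \<in> carrier G \<Longrightarrow> k \<in> carrier G \<Longrightarrow>
        cl (g \<otimes> h) k = cl g (dt k h) \<otimes> cl h k"
    and cycle: "\<And>u v w. u \<in> carrier G \<Longrightarrow> v \<in> carrier G \<Longrightarrow> w \<in> carrier G \<Longrightarrow>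
        dt (dt u v) (cl w v) = dt (dt u w) (dt v w)"
      "\<And>u v w. u \<in> carrier G \<Longrightarrow> v \<in> carrier G \<Longrightarrow> w \<in> carrier G \<Longrightarrow>
        cl (dt u v) (dt w v) = dt (cl u w) (cl v w)"
      "\<And>u v w. u \<in> carrier G \<Longrightarrow> v \<in> carrier G \<Longrightarrow> w \<in> carrier G \<Longrightarrow>
        cl (cl u v) (cl w v) = cl (cl u w) (dt v w)"
  shows "q_brace_group TYPE('k::field) G dt cl"
proof -
  let ?K = "group_hopf G :: ('a, 'k) hopf_alg"
  let ?p = "lext (\<lambda>(g, h). bv (dt g h)) :: ('a \<times> 'a, 'k) vect \<Rightarrow> _"
  let ?d = "lext (\<lambda>(g, h). bv (cl g h)) :: ('a \<times> 'a, 'k) vect \<Rightarrow> _"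
  have linp: "linear_map (carrier G \<times> carrier G) (carrier G) ?p"
    and lind: "linear_map (carrier G \<times> carrier G) (carrier G) ?d"
    using closed by (auto intro!: linear_map_lextI simp: fspace_closed)
  let ?s = "lext (\<lambda>(b, c). bv (cl c b, dt b c)) :: ('a \<times> 'a, 'k) vect \<Rightarrow> _"
  have cop: "comul (cop ?K) = lext (\<lambda>g. bv (g, g))" "cbasis (cop ?K) = carrier G"
      "counit (cop ?K) = lext_form (\<lambda>g. 1)"
    by (simp_all add: cop_def sweedler_diagonal)
  have morph: "coalg_morphism (tensor_coalg ?K (cop ?K)) (tensor_coalg (cop ?K) ?K) ?s"
    unfolding coalg_morphism_def
  proof (intro conjI ballI)
    show "linear_map (cbasis (tensor_coalg ?K (cop ?K))) (cbasis (tensor_coalg (cop ?K) ?K)) ?s"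
      using closed by (auto intro!: linear_map_lextI simp: fspace_closed tensor_coalg_def cop)
  next
    fix v
    show "comul (tensor_coalg (cop ?K) ?K) (?s v) = map_tensor ?s ?s (comul (tensor_coalg ?K (cop ?K)) v)"
      by (induction v rule: vect_induct) (auto simp: tensor_coalg_def cop lext_add lext_scal)
    show "counit (tensor_coalg (cop ?K) ?K) (?s v) = counit (tensor_coalg ?K (cop ?K)) v"
      by (induction v rule: vect_induct) (auto simp: tensor_coalg_def cop lext_add lext_scal)
  qed
  have counit: "lext_form (\<lambda>g. 1) (?p (u \<boxtimes> v)) = lext_form (\<lambda>g. 1) u * lext_form (\<lambda>g. 1) v"
    "lext_form (\<lambda>g. 1) (?d (u \<boxtimes> v)) = lext_form (\<lambda>g. 1) u * lext_form (\<lambda>g. 1) v" for u v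
  proof -
    have *: "lext_form (\<lambda>b. lext_form (\<lambda>g. 1) v) u = lext_form (\<lambda>g. 1) u * lext_form (\<lambda>g. 1) v"
      by (induction u rule: vect_induct) (simp_all add: algebra_simps)
    show "lext_form (\<lambda>g. 1) (?p (u \<boxtimes> v)) = lext_form (\<lambda>g. 1) u * lext_form (\<lambda>g. 1) v"
      "lext_form (\<lambda>g. 1) (?d (u \<boxtimes> v)) = lext_form (\<lambda>g. 1) u * lext_form (\<lambda>g. 1) v"
      using * by (simp_all add: lext_tensor lext_form_lext)
  qed
  have magma: "q_magma_coalgebra ?K ?p ?d"
    unfolding q_magma_coalgebra_def
    using coalgebra_group_hopf[where 'k='k] linp lind counit morph by simp
  have "left_regular ?K ?p" "right_regular ?K ?d"
    using regular_lin_op[of dt, where 'k='k] regular_lin_op[of cl, where 'k='k] closed unit act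
    by (simp_all add: left_regular_def right_regular_def)
  moreover from this have "q_cycle_coalgebra ?K ?p ?d"
    unfolding q_cycle_coalgebra_def
    using magma by (intro conjI ballI cycle_lin_op cycle) simp_all
  moreover have "right_op_module ?K ?p" "right_op_module ?K ?d"
    using closed unit act by (auto intro: right_op_module_lin_op)
  ultimately show ?thesis
    unfolding q_brace_group_def hopf_q_brace_def
    using hopf_algebra_group_hopf[where 'k='k] closed
    by (intro conjI ballI product_lin_op prod) simp_all
qed

end

section \<open>Group-like and skew-primitive elements\<close>

text \<open>
  Gaussian binomial coefficients, by the recursion that arises from multiplying \<open>(y + z)\<^sup>m\<close> by
  \<open>y + z\<close> on the right, where \<open>z y = q y z\<close>.
\<close>

fun qbinomial :: "'k::field \<Rightarrow> nat \<Rightarrow> nat \<Rightarrow> 'k" where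
  "qbinomial q m 0 = 1"
| "qbinomial q 0 (Suc i) = 0"
| "qbinomial q (Suc m) (Suc i) = q ^ (m - i) * qbinomial q m i + qbinomial q m (Suc i)"

lemma qbinomial_0: "m < i \<Longrightarrow> qbinomial q m i = 0"
  by (induction q m i rule: qbinomial.induct) auto

lemma qbinomial_1: "qbinomial q m (Suc 0) = (\<Sum>j<m. q ^ j)"
  by (induction m) auto

lemma qbinomial_1_mult: "(q - 1) * qbinomial q m (Suc 0) = q ^ m - 1"
  unfolding qbinomial_1 by (induction m) (auto simp: algebra_simps)

context rank_one_datum
begin

abbreviation H where "H \<equiv> rank_one_hopf G \<chi> a \<alpha>"

abbreviation basis where "basis \<equiv> carrier G \<times> {..<n}"

lemma cbasis_H [simp]: "cbasis H = basis"
  and hmul_H [simp]: "hmul H = rank_one_mul G \<chi> a \<alpha> n"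
  and hone_H [simp]: "hone H = grp \<one>"
  by (simp_all add: rank_one_hopf_def Let_def n_def)

definition mul_tensor where
  "mul_tensor s t = sweedler s (\<lambda>s1 s2. sweedler t (\<lambda>t1 t2. (s1 \<star> t1) \<boxtimes> (s2 \<star> t2)))"

definition coproduct where
  "coproduct = (\<lambda>(g, i). ((\<lambda>t. mul_tensor t (gen_x G \<boxtimes> grp a + grp \<one> \<boxtimes> gen_x G)) ^^ i) (grp g \<boxtimes> grp g))"

lemma comul_H: "comul H = lext coproduct"
  unfolding rank_one_hopf_def Let_def n_def[symmetric] coproduct_def mul_tensor_def by simp

text \<open>
  The q-binomial theorem for \<open>x \<otimes> a + 1 \<otimes> x\<close>.  All exponents stay below \<open>n\<close>, so the relation
  \<open>x\<^sup>n = \<alpha> (a\<^sup>n - 1)\<close> never intervenes and the comultiplication is homogeneous in \<open>x\<close>.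
\<close>

lemma coproduct_eq:
  assumes "g \<in> carrier G" "m < n"
  shows "coproduct (g, m) = (\<Sum>i\<le>m. qbinomial (\<chi> a) m i \<bullet> bv ((g, i), (g \<otimes> a [^] i, m - i)))"
  using assms(2)
proof (induction m)
  case 0
  then show ?case using assms by (simp add: coproduct_def grp_def)
next
  case (Suc m)
  let ?x = "gen_x G \<boxtimes> grp a + grp \<one> \<boxtimes> gen_x G"
  let ?e = "\<lambda>m i. bv ((g, i), (g \<otimes> a [^] i, m - i))"
  have step: "mul_tensor (?e m i) ?x = \<chi> a ^ (m - i) \<bullet> ?e (Suc m) (Suc i) + ?e (Suc m) i" if "i \<le> m" for i
    using assms that Suc.prems
    by (simp add: mul_tensor_def grp_def gen_x_def mult_bv nf_lt chi_one m_assoc Suc_diff_le)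
  have lin: "mul_tensor (\<Sum>i\<in>A. f i) t = (\<Sum>i\<in>A. mul_tensor (f i) t)" for A :: "nat set" and f t
    by (simp add: mul_tensor_def sweedler_def lext_sum)
  have "coproduct (g, Suc m) = mul_tensor (coproduct (g, m)) ?x"
    by (simp add: coproduct_def)
  also have "\<dots> = (\<Sum>i\<le>m. qbinomial (\<chi> a) m i \<bullet> mul_tensor (?e m i) ?x)"
    using Suc by (simp add: lin) (simp add: mul_tensor_def)
  also have "\<dots> = (\<Sum>i\<le>m. (\<chi> a ^ (m - i) * qbinomial (\<chi> a) m i) \<bullet> ?e (Suc m) (Suc i)) +
      (\<Sum>i\<le>m. qbinomial (\<chi> a) m i \<bullet> ?e (Suc m) i)"
    by (simp add: step scal_distribs sum.distrib mult.commute del: tensor_bv)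
  also have "(\<Sum>i\<le>m. qbinomial (\<chi> a) m i \<bullet> ?e (Suc m) i) = (\<Sum>i\<le>Suc m. qbinomial (\<chi> a) m i \<bullet> ?e (Suc m) i)"
    by (simp add: qbinomial_0)
  also have "\<dots> = ?e (Suc m) 0 + (\<Sum>i\<le>m. qbinomial (\<chi> a) m (Suc i) \<bullet> ?e (Suc m) (Suc i))"
    by (simp add: sum.atMost_Suc_shift del: sum.atMost_Suc)
  finally show ?case
    by (simp add: sum.atMost_Suc_shift scal_distribs sum.distrib add_ac del: sum.atMost_Suc)
qed

lemma lookup_bv: "Poly_Mapping.lookup (bv b) c = (if b = c then 1 else 0)"
  by (simp add: bv_def lookup_single when_def)

text \<open>
  Each coefficient of the coproduct of \<open>v\<close> involves a single coefficient of \<open>v\<close>, because \<open>h x\<^sup>i \<otimes> k x\<^sup>j\<close>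
  occurs only in the coproduct of \<open>h x\<^sup>i\<^sup>+\<^sup>j\<close>.
\<close>

lemma lookup_comul:
  assumes "v \<in> fspace basis"
  shows "Poly_Mapping.lookup (comul H v) ((h, i), (k, j)) =
    (if k = h \<otimes> a [^] i then qbinomial (\<chi> a) (i + j) i * Poly_Mapping.lookup v (h, i + j) else 0)"
  using assms
proof (induction v rule: fspace_induct)
  case (step c b v)
  obtain g m where b: "b = (g, m)" "g \<in> carrier G" "m < n" using step by auto
  have "Poly_Mapping.lookup (coproduct (g, m)) ((h, i), (k, j)) =
    (\<Sum>i'\<le>m. if i' = i then (if g = h \<and> k = h \<otimes> a [^] i \<and> m = i + j then qbinomial (\<chi> a) (i + j) i else 0) else 0)"
    unfolding coproduct_eq[OF b(2,3)] lookup_sum lookup_scal lookup_bv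
    by (intro sum.cong) auto
  then have "Poly_Mapping.lookup (coproduct (g, m)) ((h, i), (k, j)) =
    (if g = h \<and> k = h \<otimes> a [^] i \<and> m = i + j then qbinomial (\<chi> a) (i + j) i else 0)"
    by auto
  with step show ?case
    by (simp add: comul_H lext_add lext_scal lookup_add b lookup_bv algebra_simps)
qed (simp add: comul_H)

lemma chi_a_pow_eq_1: "\<chi> a ^ m = 1 \<longleftrightarrow> n dvd m"
proof -
  have "\<chi> a \<in> carrier unit_group" using chi_nonzero by (simp add: unit_group_def)
  from group.pow_eq_id[OF group_unit_group this, of m] show ?thesis
    by (simp add: n_def unit_group_pow) (simp add: unit_group_def)
qed

lemma comul_grp: "comul H (grp g) = grp g \<boxtimes> grp g"
  by (simp add: comul_H grp_def coproduct_def)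

lemma comul_gx:
  assumes "g \<in> carrier G"
  shows "comul H (bv (g, 1)) = bv (g, 1) \<boxtimes> grp (g \<otimes> a) + grp g \<boxtimes> bv (g, 1)"
  using assms n_gt by (simp add: comul_H coproduct_eq grp_def add_ac)

text \<open>
  If \<open>m\<close> is the highest degree that occurs in \<open>v\<close>, then \<open>v \<otimes> v\<close> has a component of degree
  \<open>2 m\<close>, whereas the coproduct of \<open>v\<close> has none above \<open>m\<close>; hence \<open>m = 0\<close>, and distinct elements of
  \<open>G\<close> are linearly independent.
\<close>

lemma group_like_is_grp:
  assumes v: "v \<in> fspace basis" "v \<noteq> 0" and gl: "comul H v = v \<boxtimes> v"
  shows "\<exists>g\<in>carrier G. v = grp g"
proof -
  let ?l = "Poly_Mapping.lookup v"
  have eq: "?l (h, i) * ?l (k, j) =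
      (if k = h \<otimes> a [^] i then qbinomial (\<chi> a) (i + j) i * ?l (h, i + j) else 0)" for h i k j
    using lookup_comul[OF v(1), of h i k j] by (simp add: gl)
  have fin: "finite (snd ` Poly_Mapping.keys v)" and ne: "snd ` Poly_Mapping.keys v \<noteq> {}"
    using v by auto
  define m where "m = Max (snd ` Poly_Mapping.keys v)"
  have "m \<in> snd ` Poly_Mapping.keys v" unfolding m_def using fin ne by (rule Max_in)
  then obtain g where g: "?l (g, m) \<noteq> 0" by (auto simp: in_keys_iff)
  have top: "?l (h, i) = 0" if "m < i" for h i
  proof (rule ccontr)
    assume "?l (h, i) \<noteq> 0"
    then have "i \<in> snd ` Poly_Mapping.keys v" by (force simp: in_keys_iff)
    then have "i \<le> m" unfolding m_def using fin by simp
    with that show False by simp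
  qed
  \<comment> \<open>The coefficient of \<open>v \<otimes> v\<close> at \<open>g x\<^sup>m \<otimes> g x\<^sup>m\<close> is a square, and in degree \<open>2 m > m\<close> it would vanish.\<close>
  have m0: "m = 0"
    using eq[of g m g m] top[of "m + m" g] g by (cases "m = 0") (auto split: if_splits)
  have gC: "g \<in> carrier G" using g v(1) by (auto simp: fspace_iff m0)
  have one: "?l (g, 0) = 1" using eq[of g 0 g 0] g gC by (auto simp: m0)
  have other: "?l b = 0" if "b \<noteq> (g, 0)" for b
  proof (cases "snd b = 0")
    case True
    with that gC eq[of g 0 "fst b" 0] one show ?thesis by (cases b) auto
  next
    case False
    with top[of "snd b" "fst b"] m0 show ?thesis by simp
  qed
  have "?l b = Poly_Mapping.lookup (grp g) b" for b
    using one other[of b] by (cases "b = (g, 0)") (simp_all add: grp_def lookup_bv)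
  then have "v = grp g" by (intro poly_mapping_eqI)
  with gC show ?thesis by blast
qed

text \<open>
  Comparison of the two sides in each degree.  A term \<open>g x\<^sup>m\<close> with \<open>m \<ge> 2\<close> would contribute
  \<open>g x \<otimes> g a x\<^sup>m\<^sup>-\<^sup>1\<close> with coefficient \<open>1 + q + \<dots> + q\<^sup>m\<^sup>-\<^sup>1\<close>; this is
  not zero, as \<open>q = \<chi> a\<close> has order \<open>n > m\<close>, and no such term occurs on the other side.
\<close>

lemma skew_primitive:
  assumes v: "v \<in> fspace basis" and k: "k \<in> carrier G"
    and sp: "comul H v = v \<boxtimes> grp k + grp \<one> \<boxtimes> v"
  shows "\<exists>c b. v = c \<bullet> gen_x G + b \<bullet> (grp \<one> - grp k) \<and> (k \<noteq> a \<longrightarrow> c = 0)"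
proof -
  let ?l = "Poly_Mapping.lookup v"
  have eq: "?l (h, i) * (if k = k' \<and> 0 = j then 1 else 0) + (if \<one> = h \<and> 0 = i then 1 else 0) * ?l (k', j) =
      (if k' = h \<otimes> a [^] i then qbinomial (\<chi> a) (i + j) i * ?l (h, i + j) else 0)" for h i k' j
    using lookup_comul[OF v(1), of h i k' j] by (simp add: sp grp_def lookup_add lookup_bv)
  have out: "?l (h, i) = 0" if "h \<notin> carrier G \<or> \<not> i < n" for h i
    using v that by (auto simp: fspace_iff)
  have high: "?l (h, m) = 0" if "2 \<le> m" for h m
  proof (cases "m < n")
    case True
    have "qbinomial (\<chi> a) m (Suc 0) \<noteq> 0"
    proof
      assume "qbinomial (\<chi> a) m (Suc 0) = 0"
      then have "\<chi> a ^ m = 1" using qbinomial_1_mult[of "\<chi> a" m] by simp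
      with True that show False by (auto simp: chi_a_pow_eq_1 dest: dvd_imp_le)
    qed
    moreover have "qbinomial (\<chi> a) m (Suc 0) * ?l (h, m) = 0"
      using eq[of h 1 "h \<otimes> a" "m - 1"] that a_closed by auto
    ultimately show ?thesis by simp
  qed (use out in auto)
  have lin: "?l (h, 1) = 0" if "\<not> (h = \<one> \<and> k = a)" for h
    using eq[of h 1 "h \<otimes> a" 0] eq[of h 0 h 1] that out[of h 1] a_closed
    by (cases "h \<in> carrier G") (auto split: if_splits)
  have const: "?l (h, 0) = 0" if "h \<noteq> \<one>" "h \<noteq> k" for h
    using eq[of h 0 h 0] that out[of h 0] by (cases "h \<in> carrier G") auto
  have const1: "?l (k, 0) = - ?l (\<one>, 0)" if "k \<noteq> \<one>"
    using eq[of \<one> 0 k 0] that k by (auto simp: eq_neg_iff_add_eq_0 add.commute)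
  have const2: "?l (k, 0) = 0" if "k = \<one>"
  proof -
    have "?l (k, 0) + ?l (k, 0) = ?l (k, 0)" using eq[of \<one> 0 k 0] that by simp
    then show ?thesis by (simp only: add_cancel_left_right)
  qed
  let ?b = "?l (\<one>, 0)" and ?c = "?l (\<one>, 1)"
  have "v = ?c \<bullet> gen_x G + ?b \<bullet> (grp \<one> - grp k)"
  proof (rule poly_mapping_eqI)
    fix b :: "'g \<times> nat"
    obtain h i where b: "b = (h, i)" by (cases b)
    consider "i = 0" | "i = 1" | "2 \<le> i" by linarith
    then show "?l b = Poly_Mapping.lookup (?c \<bullet> gen_x G + ?b \<bullet> (grp \<one> - grp k)) b"
      using high[of i h] lin[of h] const[of h] const1 const2
      by cases (auto simp: b lookup_add lookup_minus grp_def gen_x_def lookup_bv)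
  qed
  with lin[of \<one>] show ?thesis by blast
qed

end

section \<open>Braces on rank one Hopf algebras\<close>

context rank_one_datum
begin

abbreviation V :: "('g \<times> nat, 'k) vect set" where "V \<equiv> fspace basis"

definition gx :: "'g \<Rightarrow> ('g \<times> nat, 'k) vect" where "gx g = bv (g, 1)"

lemma gx_one: "gx \<one> = gen_x G"
  by (simp add: gx_def gen_x_def)

lemma grp_in [simp]: "g \<in> carrier G \<Longrightarrow> grp g \<in> V"
  and gx_in [simp]: "g \<in> carrier G \<Longrightarrow> gx g \<in> V"
  and gen_x_in [simp]: "gen_x G \<in> V"
  using n_gt by (simp_all add: grp_def gx_def gen_x_def fspace_closed)

lemmas V_closed [simp] = fspace_closed(1,3-5)[where B = basis]

lemma comul_simps [simp]:
  "comul H (grp g) = grp g \<boxtimes> grp g"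
  "comul H (gen_x G) = gen_x G \<boxtimes> grp a + grp \<one> \<boxtimes> gen_x G"
  "g \<in> carrier G \<Longrightarrow> comul H (gx g) = gx g \<boxtimes> grp (g \<otimes> a) + grp g \<boxtimes> gx g"
  using comul_gx[of g] comul_gx[of \<one>] by (simp_all add: comul_grp gx_def gen_x_def)

lemma sweedler_basis [simp]:
  "sweedler (grp g \<boxtimes> grp h) F = F (grp g) (grp h)"
  "sweedler (grp g \<boxtimes> gx h) F = F (grp g) (gx h)"
  "sweedler (gx g \<boxtimes> grp h) F = F (gx g) (grp h)"
  "sweedler (grp g \<boxtimes> gen_x G) F = F (grp g) (gen_x G)"
  "sweedler (gen_x G \<boxtimes> grp h) F = F (gen_x G) (grp h)"
  by (simp_all add: grp_def gx_def gen_x_def)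

lemma grp_mult [simp]: "grp g \<star> grp h = grp (g \<otimes> h)"
  by (rule rank_one_relations)

lemma grp_mult_x: "g \<in> carrier G \<Longrightarrow> grp g \<star> gen_x G = gx g"
  using n_gt by (simp add: grp_def gen_x_def gx_def mult_bv nf_lt chi_one)

lemma grp_eq_iff [simp]: "(grp g :: ('g \<times> nat, 'k) vect) = grp h \<longleftrightarrow> g = h"
  unfolding grp_def by (metis lookup_bv one_neq_zero prod.inject)

lemma grp_nonzero [simp]: "(grp g :: ('g \<times> nat, 'k) vect) \<noteq> 0"
  unfolding grp_def by (metis lookup_bv lookup_zero one_neq_zero)

lemma chi_a_neq_1: "\<chi> a \<noteq> 1"
  using chi_a_pow_eq_1[of 1] n_gt by auto

lemma a_neq_one: "a \<noteq> \<one>"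
  using chi_a_neq_1 chi_one by auto

lemma x_grp_eq_iff:
  "c \<bullet> gen_x G + b \<bullet> (grp \<one> - grp a) = c' \<bullet> gen_x G + b' \<bullet> (grp \<one> - grp a) \<longleftrightarrow> c = c' \<and> b = b'"
proof
  assume eq: "c \<bullet> gen_x G + b \<bullet> (grp \<one> - grp a) = c' \<bullet> gen_x G + b' \<bullet> (grp \<one> - grp a)"
  have "c = c'"
    using arg_cong[OF eq, of "\<lambda>v. Poly_Mapping.lookup v (\<one>, 1)"]
    by (simp add: lookup_add lookup_minus grp_def gen_x_def lookup_bv)
  moreover have "b = b'"
    using arg_cong[OF eq, of "\<lambda>v. Poly_Mapping.lookup v (\<one>, 0)"] a_neq_one
    by (simp add: lookup_add lookup_minus grp_def gen_x_def lookup_bv)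
  ultimately show "c = c' \<and> b = b'" by simp
qed simp

end

text \<open>
  The consequences of the axioms of a Hopf q-brace that constrain one of the operations by means of
  the other.  Apart from the cycle identities the axioms are symmetric in the two operations, so each
  fact proved for \<open>\<cdot>\<close> holds for \<open>\<diamondop>\<close>, which stands for the colon, after exchanging them (lemma \<open>swap\<close>).
\<close>

locale half_brace = rank_one_datum G \<chi> a \<alpha> n
  for G :: "('g, 'm) monoid_scheme" (structure) and \<chi> :: "'g \<Rightarrow> 'k::field" and a \<alpha> n +
  fixes dot :: "('g \<times> nat, 'k) vect \<Rightarrow> ('g \<times> nat, 'k) vect \<Rightarrow> ('g \<times> nat, 'k) vect" (infixl \<open>\<cdot>\<close> 73)
    and cln :: "('g \<times> nat, 'k) vect \<Rightarrow> ('g \<times> nat, 'k) vect \<Rightarrow> ('g \<times> nat, 'k) vect" (infixl \<open>\<diamondop>\<close> 73)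
  assumes dot_in: "u \<in> V \<Longrightarrow> v \<in> V \<Longrightarrow> u \<cdot> v \<in> V"
    and dot_add_left: "u \<in> V \<Longrightarrow> u' \<in> V \<Longrightarrow> v \<in> V \<Longrightarrow> (u + u') \<cdot> v = u \<cdot> v + u' \<cdot> v"
    and dot_add_right: "u \<in> V \<Longrightarrow> v \<in> V \<Longrightarrow> v' \<in> V \<Longrightarrow> u \<cdot> (v + v') = u \<cdot> v + u \<cdot> v'"
    and dot_scal_left: "u \<in> V \<Longrightarrow> v \<in> V \<Longrightarrow> (c \<bullet> u) \<cdot> v = c \<bullet> (u \<cdot> v)"
    and dot_scal_right: "u \<in> V \<Longrightarrow> v \<in> V \<Longrightarrow> u \<cdot> (c \<bullet> v) = c \<bullet> (u \<cdot> v)"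
    and dot_one: "u \<in> V \<Longrightarrow> u \<cdot> grp \<one> = u"
    and dot_mult: "u \<in> V \<Longrightarrow> v \<in> V \<Longrightarrow> w \<in> V \<Longrightarrow> u \<cdot> (v \<star> w) = (u \<cdot> w) \<cdot> v"
    and mult_dot: "u \<in> V \<Longrightarrow> v \<in> V \<Longrightarrow> w \<in> V \<Longrightarrow> (u \<star> v) \<cdot> w =
      sweedler (comul H v) (\<lambda>v1 v2. sweedler (comul H w) (\<lambda>w1 w2. (u \<cdot> (w1 \<diamondop> v2)) \<star> (v1 \<cdot> w2)))"
    and comul_dot: "x \<in> basis \<Longrightarrow> y \<in> basis \<Longrightarrow> comul H (bv x \<cdot> bv y) =
      sweedler (comul H (bv x)) (\<lambda>u1 u2. sweedler (comul H (bv y)) (\<lambda>v1 v2. (u1 \<cdot> v2) \<boxtimes> (u2 \<cdot> v1)))"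
    and exchange: "x \<in> basis \<Longrightarrow> y \<in> basis \<Longrightarrow>
      sweedler (comul H (bv x)) (\<lambda>u1 u2. sweedler (comul H (bv y)) (\<lambda>v1 v2. (v1 \<diamondop> u2) \<boxtimes> (u1 \<cdot> v2))) =
      sweedler (comul H (bv x)) (\<lambda>u1 u2. sweedler (comul H (bv y)) (\<lambda>v1 v2. (v2 \<diamondop> u1) \<boxtimes> (u2 \<cdot> v1)))"
begin

lemma dot_diff_left: "u \<in> V \<Longrightarrow> u' \<in> V \<Longrightarrow> v \<in> V \<Longrightarrow> (u - u') \<cdot> v = u \<cdot> v - u' \<cdot> v"
  using dot_add_left[of "u - u'" u' v] by (simp add: algebra_simps)

lemma dot_diff_right: "u \<in> V \<Longrightarrow> v \<in> V \<Longrightarrow> v' \<in> V \<Longrightarrow> u \<cdot> (v - v') = u \<cdot> v - u \<cdot> v'"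
  using dot_add_right[of u "v - v'" v'] by (simp add: algebra_simps)

lemma dot_zero_left: "v \<in> V \<Longrightarrow> 0 \<cdot> v = 0"
  using dot_diff_left[of 0 0 v] by simp

lemma dot_zero_right: "u \<in> V \<Longrightarrow> u \<cdot> 0 = 0"
  using dot_diff_right[of u 0 0] by simp

lemmas dot_linear = dot_in dot_add_left dot_add_right dot_scal_left dot_scal_right
  dot_diff_left dot_diff_right dot_zero_left dot_zero_right dot_one

lemma dot_inv: "u \<in> V \<Longrightarrow> g \<in> carrier G \<Longrightarrow> (u \<cdot> grp g) \<cdot> grp (inv g) = u"
  using dot_mult[of u "grp (inv g)" "grp g"] by (simp add: dot_one)

lemma dot_grp_inj:
  "u \<in> V \<Longrightarrow> v \<in> V \<Longrightarrow> g \<in> carrier G \<Longrightarrow> u \<cdot> grp g = v \<cdot> grp g \<Longrightarrow> u = v"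
  by (metis dot_inv)

lemma comul_dot_simps:
  assumes "g \<in> carrier G" "h \<in> carrier G"
  shows "comul H (grp g \<cdot> grp h) = (grp g \<cdot> grp h) \<boxtimes> (grp g \<cdot> grp h)"
    "comul H (gen_x G \<cdot> grp h) =
      (gen_x G \<cdot> grp h) \<boxtimes> (grp a \<cdot> grp h) + (grp \<one> \<cdot> grp h) \<boxtimes> (gen_x G \<cdot> grp h)"
    "comul H (gen_x G \<cdot> gen_x G) =
      (gen_x G \<cdot> grp a) \<boxtimes> (grp a \<cdot> gen_x G) + (gen_x G \<cdot> gen_x G) \<boxtimes> (grp a \<cdot> grp \<one>) +
      ((grp \<one> \<cdot> grp a) \<boxtimes> (gen_x G \<cdot> gen_x G) + (grp \<one> \<cdot> gen_x G) \<boxtimes> (gen_x G \<cdot> grp \<one>))"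
  using assms n_gt comul_dot[of "(g, 0)" "(h, 0)"] comul_dot[of "(\<one>, 1)" "(h, 0)"]
    comul_dot[of "(\<one>, 1)" "(\<one>, 1)"]
  by (simp_all flip: grp_def gen_x_def One_nat_def del: One_nat_def)

lemma dot_grp_ex:
  assumes "g \<in> carrier G" "h \<in> carrier G"
  shows "\<exists>k\<in>carrier G. grp g \<cdot> grp h = grp k"
proof (rule group_like_is_grp)
  show "grp g \<cdot> grp h \<noteq> 0"
    using dot_inv[of "grp g" h] assms dot_zero_left by auto
qed (use assms comul_dot_simps in \<open>auto simp: dot_in\<close>)

definition gdot :: "'g \<Rightarrow> 'g \<Rightarrow> 'g" where
  "gdot g h = (THE k. k \<in> carrier G \<and> grp g \<cdot> grp h = grp k)"

lemma gdot:
  assumes "g \<in> carrier G" "h \<in> carrier G"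
  shows "gdot g h \<in> carrier G" "grp g \<cdot> grp h = grp (gdot g h)"
proof -
  have "\<exists>!k. k \<in> carrier G \<and> grp g \<cdot> grp h = grp k"
    using dot_grp_ex[OF assms] by auto
  from theI'[OF this] show "gdot g h \<in> carrier G" "grp g \<cdot> grp h = grp (gdot g h)"
    by (auto simp: gdot_def)
qed

end

locale brace_pair = half_brace G \<chi> a \<alpha> n dot cln + cl: half_brace G \<chi> a \<alpha> n cln dot
  for G :: "('g, 'm) monoid_scheme" (structure) and \<chi> :: "'g \<Rightarrow> 'k::field" and a \<alpha> n
    and dot (infixl \<open>\<cdot>\<close> 73) and cln (infixl \<open>\<diamondop>\<close> 73)
begin

lemma swap: "brace_pair G \<chi> a \<alpha> n cln dot"
  by unfold_locales

lemma one_dot_grp [simp]: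
  assumes g: "g \<in> carrier G"
  shows "grp \<one> \<cdot> grp g = grp \<one>"
proof -
  obtain k where k: "k \<in> carrier G" "grp \<one> \<cdot> grp g = grp k" using dot_grp_ex[of \<one> g] g by auto
  have "grp \<one> \<cdot> grp g = (grp \<one> \<cdot> grp g) \<star> (grp \<one> \<cdot> grp g)"
    using mult_dot[of "grp \<one>" "grp \<one>" "grp g"] g by (simp add: cl.dot_one)
  then have "k \<otimes> k = k" using k by simp
  then have "k = \<one>" using k(1) by simp
  with k show ?thesis by simp
qed

lemma one_dot_x [simp]: "grp \<one> \<cdot> gen_x G = 0"
proof -
  have "grp \<one> \<cdot> gen_x G = grp \<one> \<cdot> gen_x G + grp \<one> \<cdot> gen_x G"
    using mult_dot[of "grp \<one>" "grp \<one>" "gen_x G"]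
    by (simp add: cl.dot_one mult_one dot_in)
  then show ?thesis by simp
qed

text \<open>
  The element \<open>x \<cdot> g\<close> is skew-primitive of type \<open>(1, a \<cdot> g)\<close>.  Acting by \<open>g\<close> is injective, hence it
  is not a multiple of \<open>1 - a \<cdot> g\<close>, and only the type \<open>(1, a)\<close> admits other skew-primitive elements.
\<close>

lemma x_dot_grp_ex:
  assumes g: "g \<in> carrier G"
  shows "grp a \<cdot> grp g = grp a \<and>
    (\<exists>c b. c \<noteq> 0 \<and> gen_x G \<cdot> grp g = c \<bullet> gen_x G + b \<bullet> (grp \<one> - grp a))"
proof -
  obtain k where k: "k \<in> carrier G" "grp a \<cdot> grp g = grp k" using dot_grp_ex[of a g] g by auto
  have "comul H (gen_x G \<cdot> grp g) = (gen_x G \<cdot> grp g) \<boxtimes> grp k + grp \<one> \<boxtimes> (gen_x G \<cdot> grp g)"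
    using comul_dot_simps(2)[of \<one> g] g k by simp
  then obtain c b where cb: "gen_x G \<cdot> grp g = c \<bullet> gen_x G + b \<bullet> (grp \<one> - grp k)" "k \<noteq> a \<Longrightarrow> c = 0"
    using skew_primitive[of "gen_x G \<cdot> grp g" k] k g by (auto simp: dot_in)
  have "c \<noteq> 0"
  proof
    assume "c = 0"
    then have "gen_x G \<cdot> grp g = (b \<bullet> (grp \<one> - grp a)) \<cdot> grp g"
      using g k cb by (simp add: dot_linear)
    then have "gen_x G = b \<bullet> (grp \<one> - grp a)"
      by (rule dot_grp_inj[rotated 3]) (use g in auto)
    then show False using x_grp_eq_iff[of 1 0 0 b] by simp
  qed
  with cb k show ?thesis by auto
qed

lemma a_dot_grp [simp]: "g \<in> carrier G \<Longrightarrow> grp a \<cdot> grp g = grp a"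
  using x_dot_grp_ex by blast

text \<open>
  The exchange identity for \<open>g\<close> and \<open>x\<close> reads
  \<open>(x : g) \<otimes> (g \<cdot> a) + 1 \<otimes> (g \<cdot> x) = a \<otimes> (g \<cdot> x) + (x : g) \<otimes> g\<close>, and \<open>x\<close> has a nonzero
  coefficient in \<open>x : g\<close>.
\<close>

lemma grp_dot_a_x:
  assumes g: "g \<in> carrier G"
  shows "grp g \<cdot> grp a = grp g \<and> grp g \<cdot> gen_x G = 0"
proof -
  obtain k where k: "k \<in> carrier G" "grp g \<cdot> grp a = grp k" using dot_grp_ex[of g a] g by auto
  obtain c b where cb: "c \<noteq> 0" "gen_x G \<diamondop> grp g = c \<bullet> gen_x G + b \<bullet> (grp \<one> - grp a)"
    using brace_pair.x_dot_grp_ex[OF swap g] by blast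
  let ?z = "grp g \<cdot> gen_x G"
  have eq: "(gen_x G \<diamondop> grp g) \<boxtimes> grp k + grp \<one> \<boxtimes> ?z =
      grp a \<boxtimes> ?z + (gen_x G \<diamondop> grp g) \<boxtimes> grp g"
    using exchange[of "(g, 0)" "(\<one>, 1)"] g n_gt k
      brace_pair.one_dot_grp[OF swap g] brace_pair.a_dot_grp[OF swap g]
    by (simp flip: grp_def gen_x_def One_nat_def del: One_nat_def add: dot_one)
  have "k = g"
    using arg_cong[OF eq, of "\<lambda>v. Poly_Mapping.lookup v ((\<one>, 1), (k, 0))"] cb
    by (auto simp: lookup_add lookup_minus grp_def gen_x_def lookup_bv split: if_splits)
  then have eq': "grp \<one> \<boxtimes> ?z = grp a \<boxtimes> ?z" using eq by simp
  have "Poly_Mapping.lookup ?z y = 0" for y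
    using arg_cong[OF eq', of "\<lambda>v. Poly_Mapping.lookup v ((\<one>, 0), y)"] a_neq_one
    by (simp add: grp_def lookup_bv)
  then have "?z = 0" by (intro poly_mapping_eqI) simp
  with k \<open>k = g\<close> show ?thesis by simp
qed

lemma grp_dot_a [simp]: "g \<in> carrier G \<Longrightarrow> grp g \<cdot> grp a = grp g"
  and grp_dot_x [simp]: "g \<in> carrier G \<Longrightarrow> grp g \<cdot> gen_x G = 0"
  using grp_dot_a_x by blast+

text \<open>
  Both sides are \<open>x \<cdot> (x g)\<close>, evaluated directly and after rewriting \<open>x g = \<chi>(g) g x\<close>.
\<close>

lemma x_dot_grp_x:
  assumes g: "g \<in> carrier G"
  shows "(gen_x G \<cdot> grp g) \<cdot> gen_x G = \<chi> g \<bullet> ((gen_x G \<cdot> gen_x G) \<cdot> grp g)"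
proof -
  have "(gen_x G \<cdot> grp g) \<cdot> gen_x G = gen_x G \<cdot> (gen_x G \<star> grp g)"
    using g by (simp add: dot_mult)
  also have "gen_x G \<star> grp g = \<chi> g \<bullet> (grp g \<star> gen_x G)" using g by (rule rank_one_relations)
  also have "gen_x G \<cdot> \<dots> = \<chi> g \<bullet> ((gen_x G \<cdot> gen_x G) \<cdot> grp g)"
    using g by (simp add: dot_mult dot_scal_right mult_fspace)
  finally show ?thesis .
qed

text \<open>
  Since \<open>a \<cdot> x = 1 \<cdot> x = 0\<close>, the element \<open>x \<cdot> x\<close> is skew-primitive of type \<open>(1, a)\<close>; its coefficient at \<open>x\<close>
  vanishes because \<open>x_dot_grp_x\<close> for \<open>g = a\<close> equates it with \<open>\<chi> a\<close> times itself, and \<open>\<chi> a \<noteq> 1\<close>.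
\<close>

lemma x_dot_x_ex:
  assumes "gen_x G \<cdot> gen_x G \<noteq> 0"
  shows "\<exists>l. l \<noteq> 0 \<and> gen_x G \<cdot> gen_x G = l \<bullet> (grp \<one> - grp a)"
proof -
  have "comul H (gen_x G \<cdot> gen_x G) = (gen_x G \<cdot> gen_x G) \<boxtimes> grp a + grp \<one> \<boxtimes> (gen_x G \<cdot> gen_x G)"
    using comul_dot_simps(3)[of \<one> \<one>] by simp
  then obtain c l where cl: "gen_x G \<cdot> gen_x G = c \<bullet> gen_x G + l \<bullet> (grp \<one> - grp a)"
    using skew_primitive[of "gen_x G \<cdot> gen_x G" a] by (auto simp: dot_in)
  obtain c' b where cb: "c' \<noteq> 0" "gen_x G \<cdot> grp a = c' \<bullet> gen_x G + b \<bullet> (grp \<one> - grp a)"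
    using x_dot_grp_ex[of a] by auto
  have "(c' * c) \<bullet> gen_x G + (c' * l) \<bullet> (grp \<one> - grp a) =
      (\<chi> a * c * c') \<bullet> gen_x G + (\<chi> a * (c * b + l)) \<bullet> (grp \<one> - grp a)"
    using x_dot_grp_x[of a] by (simp add: cl cb dot_linear) (simp add: scal_distribs algebra_simps)
  then have "c' * c = \<chi> a * c * c'" unfolding x_grp_eq_iff by simp
  then have "c = 0" using cb chi_a_neq_1 by simp
  with cl have "gen_x G \<cdot> gen_x G = l \<bullet> (grp \<one> - grp a)" by simp
  moreover from this assms have "l \<noteq> 0" by auto
  ultimately show ?thesis by blast
qed

lemma x_dot_grp_coeff:
  assumes xx: "gen_x G \<cdot> gen_x G = l \<bullet> (grp \<one> - grp a)" "l \<noteq> 0" and g: "g \<in> carrier G"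
  shows "\<exists>b. gen_x G \<cdot> grp g = \<chi> g \<bullet> gen_x G + b \<bullet> (grp \<one> - grp a)"
proof -
  obtain c b where cb: "gen_x G \<cdot> grp g = c \<bullet> gen_x G + b \<bullet> (grp \<one> - grp a)"
    using x_dot_grp_ex[OF g] by blast
  have "0 \<bullet> gen_x G + (c * l) \<bullet> (grp \<one> - grp a) = 0 \<bullet> gen_x G + (\<chi> g * l) \<bullet> (grp \<one> - grp a)"
    using x_dot_grp_x[of g] g by (simp add: xx cb dot_linear)
  then have "c = \<chi> g" unfolding x_grp_eq_iff using xx by simp
  with cb show ?thesis by auto
qed

text \<open>
  Writing \<open>x \<cdot> g = \<chi>(g) x + b (1 - a)\<close>, the coefficient at \<open>x\<close> of \<open>(x \<cdot> g) \<cdot> (x \<cdot> g)\<close> is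
  \<open>\<chi>(g) b (1 - \<chi>(a))\<close>, while \<open>(x \<cdot> x) \<cdot> g\<close> is a multiple of \<open>1 - a\<close>; so \<open>b = 0\<close>, and then
  the coefficients at \<open>1 - a\<close> give \<open>\<chi>(g)\<^sup>2 = 1\<close>.
\<close>

lemma x_dot_grp_square:
  assumes xx: "gen_x G \<cdot> gen_x G = l \<bullet> (grp \<one> - grp a)" "l \<noteq> 0"
    and sq: "(gen_x G \<cdot> grp g) \<cdot> (gen_x G \<cdot> grp g) = (gen_x G \<cdot> gen_x G) \<cdot> grp g"
    and g: "g \<in> carrier G"
  shows "gen_x G \<cdot> grp g = \<chi> g \<bullet> gen_x G" "\<chi> g * \<chi> g = 1"
proof -
  obtain b where b: "gen_x G \<cdot> grp g = \<chi> g \<bullet> gen_x G + b \<bullet> (grp \<one> - grp a)"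
    using x_dot_grp_coeff[OF xx g] by blast
  obtain b' where b': "gen_x G \<cdot> grp a = \<chi> a \<bullet> gen_x G + b' \<bullet> (grp \<one> - grp a)"
    using x_dot_grp_coeff[OF xx, of a] by auto
  have "(gen_x G \<cdot> grp g) \<cdot> (gen_x G \<cdot> grp g) =
      (\<chi> g * b * (1 - \<chi> a)) \<bullet> gen_x G + (\<chi> g * \<chi> g * l - \<chi> g * b * b') \<bullet> (grp \<one> - grp a)"
    using g by (simp add: b b' xx dot_linear)
      (rule poly_mapping_eqI, simp add: lookup_add lookup_minus algebra_simps)
  moreover have "(gen_x G \<cdot> gen_x G) \<cdot> grp g = 0 \<bullet> gen_x G + l \<bullet> (grp \<one> - grp a)"
    using g by (simp add: xx dot_linear)
  ultimately have "(\<chi> g * b * (1 - \<chi> a)) \<bullet> gen_x G + (\<chi> g * \<chi> g * l - \<chi> g * b * b') \<bullet> (grp \<one> - grp a) =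
      0 \<bullet> gen_x G + l \<bullet> (grp \<one> - grp a)"
    using sq by metis
  then have *: "\<chi> g * b * (1 - \<chi> a) = 0" "\<chi> g * \<chi> g * l - \<chi> g * b * b' = l"
    unfolding x_grp_eq_iff by simp_all
  then have "b = 0" using chi_nonzero[OF g] chi_a_neq_1 by simp
  with * b xx show "gen_x G \<cdot> grp g = \<chi> g \<bullet> gen_x G" "\<chi> g * \<chi> g = 1" by simp_all
qed

lemma gx_dot_grp:
  assumes "g \<in> carrier G" "h \<in> carrier G" and x: "gen_x G \<cdot> grp h = \<chi> h \<bullet> gen_x G"
  shows "gx g \<cdot> grp h = \<chi> h \<bullet> gx (gdot g h)"
proof -
  have "gx g \<cdot> grp h = (grp g \<cdot> (grp h \<diamondop> grp a)) \<star> (gen_x G \<cdot> grp h)"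
    using assms mult_dot[of "grp g" "gen_x G" "grp h"] brace_pair.grp_dot_x[OF swap, of h]
    by (simp add: grp_mult_x dot_linear rank_one_mul_bilinear)
  also have "\<dots> = \<chi> h \<bullet> gx (gdot g h)"
    using assms brace_pair.grp_dot_a[OF swap, of h]
    by (simp add: gdot rank_one_mul_bilinear grp_mult_x)
  finally show ?thesis .
qed

lemma grp_dot_gx: "g \<in> carrier G \<Longrightarrow> h \<in> carrier G \<Longrightarrow> grp h \<cdot> gx g = 0"
  using dot_mult[of "grp h" "grp g" "gen_x G"] by (simp add: grp_mult_x dot_linear)

lemma gdot_mult_a: "g \<in> carrier G \<Longrightarrow> h \<in> carrier G \<Longrightarrow> gdot g (h \<otimes> a) = gdot g h"
  using dot_mult[of "grp g" "grp h" "grp a"] gdot[of g "h \<otimes> a"] gdot[of g h] by simp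

lemma gdot_a: "g \<in> carrier G \<Longrightarrow> gdot g a = g"
  using gdot(2)[of g a] by simp

text \<open>
  Of the four summands of \<open>g x \<cdot> h x\<close> only \<open>(g \<cdot> (h : a)) (x \<cdot> h x)\<close> survives: the others
  contain \<open>g \<cdot> h x = 0\<close>, or \<open>g \<cdot> (h - h a) = 0\<close>, or \<open>h : x = 0\<close>.
\<close>

lemma gx_dot_gx:
  assumes gh: "g \<in> carrier G" "h \<in> carrier G"
    and xx: "gen_x G \<cdot> gen_x G = l \<bullet> (grp \<one> - grp a)"
    and xx': "gen_x G \<diamondop> gen_x G = l' \<bullet> (grp \<one> - grp a)"
    and x: "gen_x G \<cdot> grp a = \<chi> a \<bullet> gen_x G"
    and x': "gen_x G \<diamondop> grp a = \<chi> a \<bullet> gen_x G"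
  shows "gx g \<cdot> gx h = l \<bullet> (grp (gdot g h) - grp (gdot g h \<otimes> a))"
proof -
  interpret swp: brace_pair G \<chi> a \<alpha> n cln dot by (rule swap)
  have ha: "gx h \<diamondop> grp a = \<chi> a \<bullet> gx (cl.gdot h a)"
    using gh x' by (intro swp.gx_dot_grp) auto
  have hx: "gx h \<diamondop> gen_x G = l' \<bullet> (grp h - grp (h \<otimes> a))"
    using gh cl.mult_dot[of "grp h" "gen_x G" "gen_x G"]
    by (simp add: grp_mult_x cl.dot_linear dot_linear rank_one_mul_bilinear xx xx' x)
  have "gx g \<cdot> gx h = (grp g \<cdot> (gx h \<diamondop> grp a)) \<star> (gen_x G \<cdot> grp (h \<otimes> a)) +
     (grp g \<cdot> (grp h \<diamondop> grp a)) \<star> (gen_x G \<cdot> gx h) +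
     ((grp g \<cdot> (gx h \<diamondop> gen_x G)) \<star> (grp \<one> \<cdot> grp (h \<otimes> a)) +
     (grp g \<cdot> (grp h \<diamondop> gen_x G)) \<star> (grp \<one> \<cdot> gx h))"
    using gh mult_dot[of "grp g" "gen_x G" "gx h"] by (simp add: grp_mult_x)
  also have "gen_x G \<cdot> gx h = l \<bullet> (grp \<one> - grp a)"
    using gh dot_mult[of "gen_x G" "grp h" "gen_x G"] by (simp add: grp_mult_x xx dot_linear)
  also have "grp g \<cdot> (gx h \<diamondop> gen_x G) = 0"
    using gh by (simp add: hx dot_linear gdot gdot_mult_a)
  finally show ?thesis
    using gh cl.gdot
    by (simp add: ha swp.gdot_a grp_dot_gx dot_linear gdot rank_one_mul_bilinear)
qed

end

locale rank_one_brace = brace_pair G \<chi> a \<alpha> n dot cln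
  for G :: "('g, 'm) monoid_scheme" (structure) and \<chi> :: "'g \<Rightarrow> 'k::field" and a \<alpha> n
    and dot (infixl \<open>\<cdot>\<close> 73) and cln (infixl \<open>\<diamondop>\<close> 73) +
  assumes cycle1: "u \<in> V \<Longrightarrow> v \<in> V \<Longrightarrow> w \<in> V \<Longrightarrow>
      sweedler (comul H v) (\<lambda>v1 v2. (u \<cdot> v1) \<cdot> (w \<diamondop> v2)) =
      sweedler (comul H w) (\<lambda>w1 w2. (u \<cdot> w2) \<cdot> (v \<cdot> w1))"
    and cycle2: "u \<in> V \<Longrightarrow> v \<in> V \<Longrightarrow> w \<in> V \<Longrightarrow>
      sweedler (comul H v) (\<lambda>v1 v2. (u \<cdot> v1) \<diamondop> (w \<cdot> v2)) =
      sweedler (comul H w) (\<lambda>w1 w2. (u \<diamondop> w2) \<cdot> (v \<diamondop> w1))"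
    and cycle3: "u \<in> V \<Longrightarrow> v \<in> V \<Longrightarrow> w \<in> V \<Longrightarrow>
      sweedler (comul H v) (\<lambda>v1 v2. (u \<diamondop> v1) \<diamondop> (w \<diamondop> v2)) =
      sweedler (comul H w) (\<lambda>w1 w2. (u \<diamondop> w2) \<diamondop> (v \<cdot> w1))"
begin

interpretation swp: brace_pair G \<chi> a \<alpha> n cln dot by (rule swap)

text \<open>
  The cycle identities for \<open>(x, x, g)\<close> and for \<open>(x, g, x)\<close> supply the hypothesis of
  \<open>x_dot_grp_square\<close> for the two operations.  The mixed identity for \<open>(x, x, x)\<close> becomes \<open>2 l x = - 2 l' x\<close> when
  \<open>x : x = l' (1 - a)\<close>, and \<open>2 \<noteq> 0\<close> because \<open>\<chi>(a) = -1\<close> differs from \<open>1\<close>.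
\<close>

lemma x_actions:
  assumes xx: "gen_x G \<cdot> gen_x G = l \<bullet> (grp \<one> - grp a)" "l \<noteq> 0"
    and xx': "gen_x G \<diamondop> gen_x G \<noteq> 0"
  shows "n = 2" "\<chi> a = - 1"
    "g \<in> carrier G \<Longrightarrow> \<chi> g * \<chi> g = 1"
    "g \<in> carrier G \<Longrightarrow> gen_x G \<cdot> grp g = \<chi> g \<bullet> gen_x G"
    "g \<in> carrier G \<Longrightarrow> gen_x G \<diamondop> grp g = \<chi> g \<bullet> gen_x G"
    "gen_x G \<diamondop> gen_x G = (- l) \<bullet> (grp \<one> - grp a)"
proof -
  obtain l' where l': "gen_x G \<diamondop> gen_x G = l' \<bullet> (grp \<one> - grp a)" "l' \<noteq> 0"
    using swp.x_dot_x_ex[OF xx'] by blast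
  have sq: "(gen_x G \<cdot> grp g) \<cdot> (gen_x G \<cdot> grp g) = (gen_x G \<cdot> gen_x G) \<cdot> grp g"
    if "g \<in> carrier G" for g
    using cycle1[of "gen_x G" "gen_x G" "grp g"] that by (simp add: dot_linear)
  have sq': "(gen_x G \<diamondop> grp g) \<diamondop> (gen_x G \<diamondop> grp g) = (gen_x G \<diamondop> gen_x G) \<diamondop> grp g"
    if "g \<in> carrier G" for g
    using cycle3[of "gen_x G" "grp g" "gen_x G"] that by (simp add: cl.dot_linear dot_linear)
  show chi: "\<chi> g * \<chi> g = 1" and x: "gen_x G \<cdot> grp g = \<chi> g \<bullet> gen_x G"
      and x': "gen_x G \<diamondop> grp g = \<chi> g \<bullet> gen_x G" if "g \<in> carrier G" for g
    using x_dot_grp_square[OF xx sq[OF that] that] swp.x_dot_grp_square[OF l' sq'[OF that] that]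
    by simp_all
  have "\<chi> a ^ 2 = 1" using chi[of a] by (simp add: power2_eq_square)
  then have "n dvd 2" unfolding chi_a_pow_eq_1 .
  then have "n \<le> 2" by (rule dvd_imp_le) simp
  with n_gt show "n = 2" by simp
  show a: "\<chi> a = - 1"
    using \<open>\<chi> a ^ 2 = 1\<close> chi_a_neq_1 by (auto simp: power2_eq_1_iff)
  have "(2 * l) \<bullet> gen_x G + 0 \<bullet> (grp \<one> - grp a) = (- 2 * l') \<bullet> gen_x G + 0 \<bullet> (grp \<one> - grp a)"
  proof -
    have eq: "(gen_x G \<cdot> gen_x G) \<diamondop> (gen_x G \<cdot> grp a) + gen_x G \<diamondop> (gen_x G \<cdot> gen_x G) =
        (gen_x G \<diamondop> grp a) \<cdot> (gen_x G \<diamondop> gen_x G) + (gen_x G \<diamondop> gen_x G) \<cdot> gen_x G"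
      using cycle2[of "gen_x G" "gen_x G" "gen_x G"] by (simp add: cl.dot_linear dot_linear)
    have "(2 * l) \<bullet> gen_x G = (gen_x G \<cdot> gen_x G) \<diamondop> (gen_x G \<cdot> grp a) + gen_x G \<diamondop> (gen_x G \<cdot> gen_x G)"
      by (simp add: xx x x' a cl.dot_linear)
        (rule poly_mapping_eqI, simp add: lookup_add lookup_minus algebra_simps)
    moreover have "(- 2 * l') \<bullet> gen_x G = (gen_x G \<diamondop> grp a) \<cdot> (gen_x G \<diamondop> gen_x G) + (gen_x G \<diamondop> gen_x G) \<cdot> gen_x G"
      by (simp add: l' x x' a dot_linear)
        (rule poly_mapping_eqI, simp add: lookup_add lookup_minus algebra_simps)
    ultimately show ?thesis using eq by simp
  qed
  then have "2 * l = - 2 * l'" unfolding x_grp_eq_iff by simp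
  moreover have "(2::'k) \<noteq> 0" using chi_a_neq_1 a by (metis add_eq_0_iff one_add_one)
  ultimately have "l' = - l" by (metis minus_mult_commute mult_cancel_left mult_minus_right minus_minus)
  with l' show "gen_x G \<diamondop> gen_x G = (- l) \<bullet> (grp \<one> - grp a)" by simp
qed

end

section \<open>The skew-brace law\<close>

context rank_one_datum
begin

text \<open>
  The left-hand side is the skew-brace law for \<open>g x\<close> and \<open>h x\<close>, with \<open>s = \<alpha>\<close> and \<open>A\<close>, \<open>B\<close>, \<open>I\<close>
  standing for \<open>k a\<^sup>2\<close>, \<open>k a\<close>, \<open>k\<close>, where \<open>k = (h \<cdot> g) g\<close>.
\<close>

lemma skew_scalar_iff:
  "(- s) \<bullet> (A - I) + (- l) \<bullet> (I - B) = l \<bullet> (B - A) + s \<bullet> (A - I) \<longleftrightarrow> (2 * s) \<bullet> (A - I) = l \<bullet> (A - I)"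
    (is "?L = ?R \<longleftrightarrow> ?L' = ?R'")
proof -
  have "?R - ?L = ?L' - ?R'"
    by (rule poly_mapping_eqI) (simp add: lookup_add lookup_minus algebra_simps)
  then show ?thesis by (metis right_minus_eq)
qed

lemma sweedler_fun_linear:
  "sweedler t (\<lambda>x y. c \<bullet> F x y + F' x y) = c \<bullet> sweedler t F + sweedler t F'"
  by (simp add: sweedler_def case_prod_unfold lext_fun_add lext_fun_scal)

lemma comul_linear:
  "comul H 0 = 0" "comul H (u + v) = comul H u + comul H v" "comul H (c \<bullet> v) = c \<bullet> comul H v"
  by (simp_all add: comul_H lext_add lext_scal)

lemma comul_in: "u \<in> V \<Longrightarrow> comul H u \<in> fspace (basis \<times> basis)"
  unfolding fspace_iff[of "comul H u"] by (auto simp: lookup_comul fspace_iff) (meson le_add1 le_less_trans)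

lemma grp_mult_gx: "g \<in> carrier G \<Longrightarrow> grp g \<star> gx h = gx (g \<otimes> h)"
  using n_gt by (simp add: grp_def gx_def mult_bv nf_lt)

lemma gx_mult_grp: "g \<in> carrier G \<Longrightarrow> gx g \<star> grp h = \<chi> h \<bullet> gx (g \<otimes> h)"
  using n_gt by (simp add: grp_def gx_def mult_bv nf_lt)

lemma gx_mult_gx:
  assumes "n = 2"
  shows "gx g \<star> gx h = (\<chi> h * \<alpha>) \<bullet> (grp (g \<otimes> h \<otimes> a [^] (2::nat)) - grp (g \<otimes> h))"
proof -
  have "gx g \<star> gx h = \<chi> h \<bullet> nf (g \<otimes> h) n"
    using n_gt mult_bv[of 1 1 g h] by (simp add: gx_def assms[symmetric] flip: numeral_2_eq_2)
  also have "nf (g \<otimes> h) n = \<alpha> \<bullet> (grp (g \<otimes> h \<otimes> a [^] n) - grp (g \<otimes> h))"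
    using n_gt by (simp add: nf_ge nf_lt grp_def)
  finally show ?thesis by (simp flip: assms)
qed

end

context rank_one_brace
begin

interpretation swp: brace_pair G \<chi> a \<alpha> n cln dot by (rule swap)

text \<open>
  Necessity of the two conditions comes from the pairs \<open>(g, h)\<close> and \<open>(x, x)\<close>; conversely they settle
  each of the four kinds of pairs of basis vectors, and both sides are bilinear.
\<close>

lemma skew_brace_iff:
  assumes xx: "gen_x G \<cdot> gen_x G = l \<bullet> (grp \<one> - grp a)" "l \<noteq> 0"
    and xx': "gen_x G \<diamondop> gen_x G \<noteq> 0"
  shows "(\<forall>u\<in>V. \<forall>v\<in>V. sweedler (comul H v) (\<lambda>v1 v2. (u \<diamondop> v2) \<star> v1) =
        sweedler (comul H u) (\<lambda>u1 u2. (v \<cdot> u1) \<star> u2)) \<longleftrightarrow>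
      (\<forall>h\<in>carrier G. \<forall>g\<in>carrier G. cl.gdot g h \<otimes> h = gdot h g \<otimes> g) \<and>
      (2 * \<alpha>) \<bullet> (grp (a [^] (2::nat)) - grp \<one>) = l \<bullet> (grp (a [^] (2::nat)) - grp \<one>)"
    (is "?skew \<longleftrightarrow> ?group \<and> ?scalar")
proof -
  note n2 = x_actions(1)[OF xx xx'] and act = x_actions(2-6)[OF xx xx']
  have a2: "a [^] (2::nat) = a \<otimes> a" by (simp add: numeral_2_eq_2)
  show ?thesis
  proof (intro iffI conjI)
    assume skew: ?skew
    show ?group
    proof (intro ballI)
      fix h g assume gh: "h \<in> carrier G" "g \<in> carrier G"
      then show "cl.gdot g h \<otimes> h = gdot h g \<otimes> g"
        using bspec[OF bspec[OF skew grp_in[OF gh(2)]] grp_in[OF gh(1)]] gh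
        by (simp add: gdot cl.gdot)
    qed
    have eq: "(gen_x G \<diamondop> grp a) \<star> gen_x G + (gen_x G \<diamondop> gen_x G) \<star> grp \<one> =
        (gen_x G \<cdot> gen_x G) \<star> grp a + gen_x G \<star> gen_x G"
      using bspec[OF bspec[OF skew gen_x_in] gen_x_in] dot_one[of "gen_x G"] by simp
    have x2: "gen_x G \<star> gen_x G = \<alpha> \<bullet> (grp (a \<otimes> a) - grp \<one>)"
      using gx_mult_gx[OF n2, of \<one> \<one>] by (simp add: gx_one chi_one a2)
    have "(- \<alpha>) \<bullet> (grp (a \<otimes> a) - grp \<one>) + (- l) \<bullet> (grp \<one> - grp a) =
        l \<bullet> (grp a - grp (a \<otimes> a)) + \<alpha> \<bullet> (grp (a \<otimes> a) - grp \<one>)"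
      using eq by (simp add: act xx x2 rank_one_mul_bilinear)
    then show ?scalar unfolding skew_scalar_iff a2 .
  next
    assume gs: "?group \<and> ?scalar"
    have basis_cases: "P (bv b)" if b: "b \<in> basis" and P: "\<And>g. g \<in> carrier G \<Longrightarrow> P (grp g)"
      "\<And>g. g \<in> carrier G \<Longrightarrow> P (gx g)" for b and P :: "('g \<times> nat, 'k) vect \<Rightarrow> bool"
    proof -
      obtain g i where "b = (g, i)" "g \<in> carrier G" "i = 0 \<or> i = 1"
        using b n2 by (cases b) (auto simp: numeral_2_eq_2 less_Suc_eq)
      then show ?thesis using P by (auto simp: grp_def gx_def)
    qed
    let ?Q = "\<lambda>u v. sweedler (comul H v) (\<lambda>v1 v2. (u \<diamondop> v2) \<star> v1) =
        sweedler (comul H u) (\<lambda>u1 u2. (v \<cdot> u1) \<star> u2)"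
    have gg: "cl.gdot g h \<otimes> h = gdot h g \<otimes> g" if "g \<in> carrier G" "h \<in> carrier G" for g h
      using that gs by blast
    have chi2: "\<chi> g * (\<chi> g * c) = c" if "g \<in> carrier G" for g c
      using act(2)[OF that] by (simp flip: mult.assoc)
    have grp_grp: "?Q (grp g) (grp h)" if "g \<in> carrier G" "h \<in> carrier G" for g h
      using that gg[OF that] by (simp add: gdot cl.gdot)
    have gx_grp: "?Q (gx g) (grp h)" if "g \<in> carrier G" "h \<in> carrier G" for g h
      using that gg[OF that] act(2)[OF that(2)]
      by (simp add: gdot cl.gdot swp.gx_dot_grp act grp_dot_gx rank_one_mul_bilinear gx_mult_grp grp_mult_gx)
    have grp_gx: "?Q (grp g) (gx h)" if "g \<in> carrier G" "h \<in> carrier G" for g h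
      using that gg[OF that] act(2)[OF that(1)]
      by (simp add: gdot cl.gdot gx_dot_grp act swp.grp_dot_gx rank_one_mul_bilinear gx_mult_grp grp_mult_gx swp.gdot_mult_a)
    \<comment> \<open>Both sides contain \<open>k x\<^sup>2\<close>, with opposite signs; the scalar condition, multiplied by \<open>k\<close>, balances them.\<close>
    have gx_gx: "?Q (gx g) (gx h)" if "g \<in> carrier G" "h \<in> carrier G" for g h
    proof -
      define k where "k = gdot h g \<otimes> g"
      have k: "k \<in> carrier G" using that by (simp add: k_def gdot)
      have ka: "gdot h g \<otimes> a \<otimes> g = k \<otimes> a" "gdot h g \<otimes> (g \<otimes> a) = k \<otimes> a"
          "gdot h g \<otimes> a \<otimes> (g \<otimes> a) = k \<otimes> (a \<otimes> a)" "cl.gdot g h \<otimes> a \<otimes> h = k \<otimes> a"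
      proof -
        show 1: "gdot h g \<otimes> a \<otimes> g = k \<otimes> a" and "gdot h g \<otimes> (g \<otimes> a) = k \<otimes> a"
          using that by (simp_all add: k_def gdot m_assoc a_central)
        from 1 show "gdot h g \<otimes> a \<otimes> (g \<otimes> a) = k \<otimes> (a \<otimes> a)"
          using that k by (simp add: gdot m_assoc[symmetric])
        have "cl.gdot g h \<otimes> a \<otimes> h = cl.gdot g h \<otimes> h \<otimes> a"
          using that by (simp add: cl.gdot m_assoc a_central)
        then show "cl.gdot g h \<otimes> a \<otimes> h = k \<otimes> a" using gg[OF that] by (simp add: k_def)
      qed
      have "(2 * \<alpha>) \<bullet> (grp (k \<otimes> a [^] (2::nat)) - grp k) = grp k \<star> ((2 * \<alpha>) \<bullet> (grp (a [^] (2::nat)) - grp \<one>))"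
        using k by (simp add: rank_one_mul_bilinear)
      also have "\<dots> = grp k \<star> (l \<bullet> (grp (a [^] (2::nat)) - grp \<one>))" using gs by simp
      also have "\<dots> = l \<bullet> (grp (k \<otimes> a [^] (2::nat)) - grp k)"
        using k by (simp add: rank_one_mul_bilinear)
      finally have key: "(2 * \<alpha>) \<bullet> (grp (k \<otimes> (a \<otimes> a)) - grp k) = l \<bullet> (grp (k \<otimes> (a \<otimes> a)) - grp k)"
        by (simp add: a2)
      have "sweedler (comul H (gx h)) (\<lambda>v1 v2. (gx g \<diamondop> v2) \<star> v1) =
          (- \<alpha>) \<bullet> (grp (k \<otimes> (a \<otimes> a)) - grp k) + (- l) \<bullet> (grp k - grp (k \<otimes> a))"
        using that gg[OF that] act(2)[OF that(2)] ka
        by (simp add: gdot cl.gdot swp.gx_dot_grp act swp.gx_dot_gx[OF that act(5) xx(1)] rank_one_mul_bilinear gx_mult_gx[OF n2] chi2 swp.gdot_mult_a a2 chi_mult k_def[symmetric])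
      moreover have "sweedler (comul H (gx g)) (\<lambda>u1 u2. (gx h \<cdot> u1) \<star> u2) =
          l \<bullet> (grp (k \<otimes> a) - grp (k \<otimes> (a \<otimes> a))) + \<alpha> \<bullet> (grp (k \<otimes> (a \<otimes> a)) - grp k)"
        using that act(2)[OF that(1)] ka
        by (simp add: gdot gx_dot_grp act gx_dot_gx[OF that(2,1) xx(1) act(5)] rank_one_mul_bilinear gx_mult_gx[OF n2] chi2 gdot_mult_a a2 chi_mult k_def[symmetric])
      ultimately show ?thesis using skew_scalar_iff[THEN iffD2, OF key, of "grp (k \<otimes> a)"] by simp
    qed
    have lin_u: "?Q u v" if u: "u \<in> V" and v: "v \<in> grp ` carrier G \<union> gx ` carrier G" for u v
    proof -
      have vV: "v \<in> V" using v by auto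
      show ?thesis using u
      proof (induction u rule: fspace_induct)
        case zero
        from v show ?case by (auto simp: comul_linear cl.dot_zero_left rank_one_mul_bilinear)
      next
        case (step c b u)
        have "?Q (bv b) (grp h)" if h: "h \<in> carrier G" for h
          by (rule basis_cases[OF step(1)]) (erule grp_grp[OF _ h], erule gx_grp[OF _ h])
        moreover have "?Q (bv b) (gx h)" if h: "h \<in> carrier G" for h
          by (rule basis_cases[OF step(1)]) (erule grp_gx[OF _ h], erule gx_gx[OF _ h])
        ultimately have "?Q (bv b) v" using v by (elim UnE imageE) (simp_all only:)
        moreover have "sweedler (comul H v) (\<lambda>v1 v2. ((c \<bullet> bv b + u) \<diamondop> v2) \<star> v1) =
            sweedler (comul H v) (\<lambda>v1 v2. c \<bullet> ((bv b \<diamondop> v2) \<star> v1) + (u \<diamondop> v2) \<star> v1)"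
          using step vV by (intro sweedler_cong[OF comul_in])
            (simp_all add: cl.dot_linear fspace_closed(2) rank_one_mul_bilinear)
        ultimately show ?case
          using step by (simp add: comul_linear sweedler_fun_linear)
      qed
    qed
    show ?skew
    proof (intro ballI)
      fix u v assume u: "u \<in> V" and v: "v \<in> V"
      show "?Q u v"
        using v
      proof (induction v rule: fspace_induct)
        case zero
        have "sweedler (comul H u) (\<lambda>u1 u2. (0 \<cdot> u1) \<star> u2) = sweedler (comul H u) (\<lambda>u1 u2. 0)"
          by (intro sweedler_cong[OF comul_in[OF u]])
            (simp add: dot_zero_left fspace_closed(2) rank_one_mul_bilinear)
        then show ?case by (simp add: comul_linear) (simp add: sweedler_def case_prod_unfold)
      next
        case (step c b v)
        have "?Q u (bv b)"
          by (rule basis_cases[OF step(1)]; rule lin_u[OF u]) auto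
        moreover have "sweedler (comul H u) (\<lambda>u1 u2. ((c \<bullet> bv b + v) \<cdot> u1) \<star> u2) =
            sweedler (comul H u) (\<lambda>u1 u2. c \<bullet> ((bv b \<cdot> u1) \<star> u2) + (v \<cdot> u1) \<star> u2)"
          using step by (intro sweedler_cong[OF comul_in[OF u]])
            (simp add: dot_linear fspace_closed(2) rank_one_mul_bilinear)
        ultimately show ?case
          using step by (simp add: comul_linear sweedler_fun_linear)
      qed
    qed
  qed
qed

lemma q_brace_group_gdot: "q_brace_group TYPE('k) G gdot cl.gdot"
proof (rule q_brace_groupI)
  fix u v w assume G: "u \<in> carrier G" "v \<in> carrier G" "w \<in> carrier G"
  note simps = gdot cl.gdot
  show "gdot (gdot u v) (cl.gdot w v) = gdot (gdot u w) (gdot v w)"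
    using cycle1[of "grp u" "grp v" "grp w"] G by (simp add: simps)
  show "cl.gdot (gdot u v) (gdot w v) = gdot (cl.gdot u w) (cl.gdot v w)"
    using cycle2[of "grp u" "grp v" "grp w"] G by (simp add: simps)
  show "cl.gdot (cl.gdot u v) (cl.gdot w v) = cl.gdot (cl.gdot u w) (gdot v w)"
    using cycle3[of "grp u" "grp v" "grp w"] G by (simp add: simps)
  show "gdot u (v \<otimes> w) = gdot (gdot u w) v" "cl.gdot u (v \<otimes> w) = cl.gdot (cl.gdot u w) v"
    using dot_mult[of "grp u" "grp v" "grp w"] cl.dot_mult[of "grp u" "grp v" "grp w"] G
    by (simp_all add: simps)
  show "gdot (u \<otimes> v) w = gdot u (cl.gdot w v) \<otimes> gdot v w"
    "cl.gdot (u \<otimes> v) w = cl.gdot u (gdot w v) \<otimes> cl.gdot v w"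
    using mult_dot[of "grp u" "grp v" "grp w"] cl.mult_dot[of "grp u" "grp v" "grp w"] G
    by (simp_all add: simps)
  show "gdot u \<one> = u" "cl.gdot u \<one> = u"
    using dot_one[of "grp u"] cl.dot_one[of "grp u"] G by (simp_all add: simps)
qed (simp_all add: gdot cl.gdot)

end

lemma (in rank_one_datum) half_brace_of_hopf_q_brace:
  assumes linp: "linear_map (basis \<times> basis) basis p"
    and module: "right_op_module H p"
    and prod: "\<And>h k l. h \<in> V \<Longrightarrow> k \<in> V \<Longrightarrow> l \<in> V \<Longrightarrow> p ((h \<star> k) \<boxtimes> l) =
        sweedler (comul H k) (\<lambda>k1 k2. sweedler (comul H l) (\<lambda>l1 l2.
          p (h \<boxtimes> d (l1 \<boxtimes> k2)) \<star> p (k1 \<boxtimes> l2)))"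
    and comul: "\<And>b c. b \<in> basis \<Longrightarrow> c \<in> basis \<Longrightarrow> comul H (p (bv b \<boxtimes> bv c)) =
      sweedler (comul H (bv b)) (\<lambda>x1 x2. sweedler (comul H (bv c)) (\<lambda>y1 y2. p (x1 \<boxtimes> y2) \<boxtimes> p (x2 \<boxtimes> y1)))"
    and exch: "\<And>b c. b \<in> basis \<Longrightarrow> c \<in> basis \<Longrightarrow>
      sweedler (comul H (bv b)) (\<lambda>x1 x2. sweedler (comul H (bv c)) (\<lambda>y1 y2. d (y1 \<boxtimes> x2) \<boxtimes> p (x1 \<boxtimes> y2))) =
      sweedler (comul H (bv b)) (\<lambda>x1 x2. sweedler (comul H (bv c)) (\<lambda>y1 y2. d (y2 \<boxtimes> x1) \<boxtimes> p (x2 \<boxtimes> y1)))"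
  shows "half_brace G \<chi> a \<alpha> n (\<lambda>u v. p (u \<boxtimes> v)) (\<lambda>u v. d (u \<boxtimes> v))"
proof unfold_locales
  show "u \<in> V \<Longrightarrow> p (u \<boxtimes> grp \<one>) = u" for u
    using module by (simp add: right_op_module_def)
  show "u \<in> V \<Longrightarrow> v \<in> V \<Longrightarrow> w \<in> V \<Longrightarrow> p (u \<boxtimes> (v \<star> w)) = p (p (u \<boxtimes> w) \<boxtimes> v)" for u v w
    using module by (simp add: right_op_module_def)
qed (use linear_mapD[OF linp] in \<open>auto simp: tensor_fspace simp del: tensor_bv intro: prod comul exch\<close>)

text \<open>
  The exchange identity for the swapped operations is the given one with its two arguments and the
  two tensor factors interchanged.
\<close>

lemma (in rank_one_datum) rank_one_brace_of_hopf_q_brace: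
  assumes "hopf_q_brace H p d"
  shows "rank_one_brace G \<chi> a \<alpha> n (\<lambda>u v. p (u \<boxtimes> v)) (\<lambda>u v. d (u \<boxtimes> v))"
proof -
  have qm: "q_magma_coalgebra H p d"
    using assms by (simp add: hopf_q_brace_def q_cycle_coalgebra_def)
  interpret q_magma H p d by unfold_locales (rule qm)
  have exch: "sweedler (comul H (bv b)) (\<lambda>x1 x2. sweedler (comul H (bv c)) (\<lambda>y1 y2. p (y1 \<boxtimes> x2) \<boxtimes> d (x1 \<boxtimes> y2))) =
      sweedler (comul H (bv b)) (\<lambda>x1 x2. sweedler (comul H (bv c)) (\<lambda>y1 y2. p (y2 \<boxtimes> x1) \<boxtimes> d (x2 \<boxtimes> y1)))"
    if "b \<in> basis" "c \<in> basis" for b c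
  proof -
    have "swap_tensor (sweedler (comul H (bv c)) (\<lambda>x1 x2. sweedler (comul H (bv b)) (\<lambda>y1 y2. d (y2 \<boxtimes> x1) \<boxtimes> p (x2 \<boxtimes> y1)))) =
        swap_tensor (sweedler (comul H (bv c)) (\<lambda>x1 x2. sweedler (comul H (bv b)) (\<lambda>y1 y2. d (y1 \<boxtimes> x2) \<boxtimes> p (x1 \<boxtimes> y2))))"
      using exchange[of c b] that by simp
    then show ?thesis
      unfolding swap_sweedler swap_tensor_tensor
      by (subst (asm) (1 2) sweedler_commute) (rule sym)
  qed
  have prods: "p ((h \<star> k) \<boxtimes> l) = sweedler (comul H k) (\<lambda>k1 k2. sweedler (comul H l) (\<lambda>l1 l2.
          p (h \<boxtimes> d (l1 \<boxtimes> k2)) \<star> p (k1 \<boxtimes> l2)))"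
      "d ((h \<star> k) \<boxtimes> l) = sweedler (comul H k) (\<lambda>k1 k2. sweedler (comul H l) (\<lambda>l1 l2.
          d (h \<boxtimes> p (l1 \<boxtimes> k2)) \<star> d (k1 \<boxtimes> l2)))"
    if "h \<in> V" "k \<in> V" "l \<in> V" for h k l
    using assms that by (auto simp: hopf_q_brace_def)
  have "half_brace G \<chi> a \<alpha> n (\<lambda>u v. p (u \<boxtimes> v)) (\<lambda>u v. d (u \<boxtimes> v))"
    using assms linear_p comul_p exchange prods(1)
    by (intro half_brace_of_hopf_q_brace) (auto simp: hopf_q_brace_def simp del: tensor_bv)
  moreover have "half_brace G \<chi> a \<alpha> n (\<lambda>u v. d (u \<boxtimes> v)) (\<lambda>u v. p (u \<boxtimes> v))"
    using assms linear_d comul_d exch prods(2)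
    by (intro half_brace_of_hopf_q_brace) (auto simp: hopf_q_brace_def simp del: tensor_bv)
  moreover have "q_cycle_coalgebra H p d" using assms by (simp add: hopf_q_brace_def)
  ultimately show ?thesis
    unfolding rank_one_brace_def rank_one_brace_axioms_def brace_pair_def q_cycle_coalgebra_def cbasis_H
    by blast
qed

theorem mainTheorem4:
  fixes G :: "'g monoid"
    and \<chi> :: "'g \<Rightarrow> 'k :: {alg_closed_field, field_char_0}"
    and a :: 'g
    and \<alpha> lam :: 'k
    and p d :: "(('g \<times> nat) \<times> ('g \<times> nat), 'k) vect \<Rightarrow> ('g \<times> nat, 'k) vect"
  assumes "datum G \<chi> a \<alpha>"
    and "hopf_q_brace (rank_one_hopf G \<chi> a \<alpha>) p d"
    and "p (gen_x G \<boxtimes> gen_x G) \<noteq> 0"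
    and "d (gen_x G \<boxtimes> gen_x G) \<noteq> 0"
    and "lam \<noteq> 0"
    and "p (gen_x G \<boxtimes> gen_x G) = lam \<bullet> (grp \<one>\<^bsub>G\<^esub> - grp a)"
  shows "hopf_skew_brace (rank_one_hopf G \<chi> a \<alpha>) p d \<longleftrightarrow>
    skew_brace_group TYPE('k) G (restrict_op G p) (restrict_op G d) \<and>
    (2 * \<alpha>) \<bullet> (grp (a [^]\<^bsub>G\<^esub> (2::nat)) - grp \<one>\<^bsub>G\<^esub>) =
      lam \<bullet> (grp (a [^]\<^bsub>G\<^esub> (2::nat)) - grp \<one>\<^bsub>G\<^esub>)"
proof -
  interpret rank_one_datum G \<chi> a \<alpha> "group.ord unit_group (\<chi> a)"
    using assms(1) by unfold_locales simp_all
  interpret rank_one_brace G \<chi> a \<alpha> "group.ord unit_group (\<chi> a)" "\<lambda>u v. p (u \<boxtimes> v)" "\<lambda>u v. d (u \<boxtimes> v)"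
    using assms(2) by (rule rank_one_brace_of_hopf_q_brace)
  have "restrict_op G p = gdot" "restrict_op G d = cl.gdot"
    by (auto simp: restrict_op_def gdot_def cl.gdot_def fun_eq_iff)
  then show ?thesis
    using skew_brace_iff[OF assms(6,5,4)] q_brace_group_gdot assms(2)
    by (simp add: hopf_skew_brace_def skew_brace_group_def)
qed

end
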